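(* Let $H$ be a separable real Hilbert space, and let $f\colon H\to\mathbb{C}$ be a continuous positive definite function on the additive group $H$ with $f(0)=1$. Then there exist (i) a compact metrizable space $X$ and a Borel probability measure $m$ on $X$, (ii) a bounded linear operator $T\colon H\to L^2(X,m;\mathbb{R})$, and (iii) a positive measurable function $\varphi\in L^0(X,m)$, such that $$f(\xi)=\int_X e^{i\varphi(x)[T\xi](x)}\,\mathrm{d}m(x),\qquad \xi\in H.$$ Moreover: (iv) If $f$ generates a neighborhood basis of $0$, then $T$ can be chosen to be a real-linear homeomorphism onto its range. (v) We may arrange $T$ and $\varphi$ such that if $\mathcal{G}$ is a uniformly bounded subgroup of the group $\{u\in\mathrm{GL}(H): f(u\xi)=f(\xi)\ (\xi\in H)\}$ of invertible operators on $H$ fixing $f$ pointwise, then there exists a continuous homomorphism $\beta$ from $\mathcal{G}$ to the group $\mathrm{Aut}(X,m)$ of all $m$-preserving automorphisms of $X$ with the weak topology, such that $$[T(u\xi)](x)=\beta(u)[T(\xi)](x),\qquad \varphi(\beta(u)x)=\varphi(x),\qquad u\in\mathcal{G},\ \xi\in H,\ m\text{-a.e. }x\in X.$$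
   Context: $L^0(X,m)$ is the space of measurable functions on $X$ (up to $m$-a.e. equality), and $L^2(X,m;\mathbb{R})$ is the real Hilbert space of real-valued square-integrable functions. The function $f$ generates a neighborhood basis of $0$ if for every neighborhood $V$ of $0$ in $H$ there is an open set $\mathcal{O}\subset\mathbb{C}$ with $0\in f^{-1}(\mathcal{O})\subset V$. $\mathrm{GL}(H)$ is the group of bounded invertible linear operators on $H$; a subgroup $\mathcal{G}$ of it is uniformly bounded if $\sup_{u\in\mathcal{G}}\|u\|<\infty$. In the weak topology on $\mathrm{Aut}(X,m)$, $\theta_n\to\theta$ if and only if $m(\theta_n A\,\triangle\,\theta A)\to 0$ for every measurable $A\subset X$. In the expression $\beta(u)[T(\xi)]$, an automorphism $\theta\in\mathrm{Aut}(X,m)$ acts on functions $h$ on $X$ by $(\theta h)(x)=h(\theta^{-1}x)$.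
   Formalization: In (v), T and φ may depend on the uniformly bounded subgroup 𝒢 (X and m do not); a single T and φ for all 𝒢 at once is impossible in general, e.g. for f(ξ)=exp(−Σ a_k|ξ_k|) on ℓ² with a∈ℓ², a_k>0. *)

theory Defs
  imports "HOL-Probability.Probability" "HOL-Algebra.Bij" "HOL-Algebra.Coset"
begin

subsection \<open>Positive definite functions\<close>

definition positive_definite :: "('h::ab_group_add \<Rightarrow> complex) \<Rightarrow> bool" where
  "positive_definite f \<longleftrightarrow>
     (\<forall>(n::nat) (\<xi>::nat \<Rightarrow> 'h) (c::nat \<Rightarrow> complex).
        let s = (\<Sum>i<n. \<Sum>j<n. c i * cnj (c j) * f (\<xi> i - \<xi> j)) in s \<in> \<real> \<and> 0 \<le> Re s)"

definition generates_nhds_basis_0 :: "('h::{topological_space,zero} \<Rightarrow> complex) \<Rightarrow> bool" where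
  "generates_nhds_basis_0 f \<longleftrightarrow>
     (\<forall>V. 0 \<in> interior V \<longrightarrow> (\<exists>U. open U \<and> 0 \<in> f -` U \<and> f -` U \<subseteq> V))"


subsection \<open>The Borel sigma-algebra of an abstract topology\<close>

definition borel_of :: "'a topology \<Rightarrow> 'a measure" where
  "borel_of X = sigma (topspace X) {U. openin X U}"


subsection \<open>The real space \<open>L\<^sup>2\<close> and operators into it\<close>

text \<open>
  Elements of \<open>L\<^sup>0\<close> and \<open>L\<^sup>2\<close> are given by representatives, equality being equality almost
  everywhere.  The topology below is therefore the one of a pseudometric, and its Kolmogorov
  quotient is the usual Hilbert space.
\<close>

definition L2 :: "'a measure \<Rightarrow> ('a \<Rightarrow> real) set" where
  "L2 M = {g \<in> borel_measurable M. integrable M (\<lambda>x. (g x)\<^sup>2)}"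

definition L2_norm :: "'a measure \<Rightarrow> ('a \<Rightarrow> real) \<Rightarrow> real" where
  "L2_norm M g = sqrt (\<integral>x. (g x)\<^sup>2 \<partial>M)"

definition L2_topology :: "'a measure \<Rightarrow> ('a \<Rightarrow> real) topology" where
  "L2_topology M = topology (\<lambda>U. U \<subseteq> L2 M \<and>
     (\<forall>g\<in>U. \<exists>\<epsilon>>0. \<forall>h\<in>L2 M. L2_norm M (\<lambda>x. h x - g x) < \<epsilon> \<longrightarrow> h \<in> U))"

lemma openin_L2_topology:
  "openin (L2_topology M) U \<longleftrightarrow> U \<subseteq> L2 M \<and>
     (\<forall>g\<in>U. \<exists>\<epsilon>>0. \<forall>h\<in>L2 M. L2_norm M (\<lambda>x. h x - g x) < \<epsilon> \<longrightarrow> h \<in> U)"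
proof -
  define P where "P U \<longleftrightarrow> U \<subseteq> L2 M \<and>
     (\<forall>g\<in>U. \<exists>\<epsilon>>0. \<forall>h\<in>L2 M. L2_norm M (\<lambda>x. h x - g x) < \<epsilon> \<longrightarrow> h \<in> U)" for U
  have inter: "P (S \<inter> T)" if S: "P S" and T: "P T" for S T
    unfolding P_def
  proof (intro conjI ballI)
    show "S \<inter> T \<subseteq> L2 M" using S by (auto simp: P_def)
    fix g assume g: "g \<in> S \<inter> T"
    obtain a where "a > 0" "\<forall>h\<in>L2 M. L2_norm M (\<lambda>x. h x - g x) < a \<longrightarrow> h \<in> S"
      using S g unfolding P_def by blast
    moreover obtain b where "b > 0" "\<forall>h\<in>L2 M. L2_norm M (\<lambda>x. h x - g x) < b \<longrightarrow> h \<in> T"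
      using T g unfolding P_def by blast
    ultimately show "\<exists>\<epsilon>>0. \<forall>h\<in>L2 M. L2_norm M (\<lambda>x. h x - g x) < \<epsilon> \<longrightarrow> h \<in> S \<inter> T"
      by (intro exI[of _ "min a b"]) simp
  qed
  have union: "P (\<Union>K)" if K: "\<forall>S\<in>K. P S" for K
    unfolding P_def
  proof (intro conjI ballI)
    show "\<Union>K \<subseteq> L2 M" using K unfolding P_def by blast
    fix g assume "g \<in> \<Union>K"
    then obtain S where "S \<in> K" "g \<in> S" by blast
    moreover then obtain a where "a > 0" "\<forall>h\<in>L2 M. L2_norm M (\<lambda>x. h x - g x) < a \<longrightarrow> h \<in> S"
      using K unfolding P_def by blast
    ultimately show "\<exists>\<epsilon>>0. \<forall>h\<in>L2 M. L2_norm M (\<lambda>x. h x - g x) < \<epsilon> \<longrightarrow> h \<in> \<Union>K"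
      by blast
  qed
  have "istopology P"
    unfolding istopology_def using inter union by simp
  then have "openin (topology P) = P"
    by (rule topology_inverse')
  moreover have "L2_topology M = topology P"
    unfolding L2_topology_def P_def ..
  ultimately show ?thesis
    by (simp add: P_def)
qed

definition bounded_linear_L2 :: "'a measure \<Rightarrow> ('h::real_normed_vector \<Rightarrow> 'a \<Rightarrow> real) \<Rightarrow> bool" where
  "bounded_linear_L2 M T \<longleftrightarrow>
     (\<forall>\<xi>. T \<xi> \<in> L2 M) \<and>
     (\<forall>\<xi> \<eta>. AE x in M. T (\<xi> + \<eta>) x = T \<xi> x + T \<eta> x) \<and>
     (\<forall>a \<xi>. AE x in M. T (a *\<^sub>R \<xi>) x = a * T \<xi> x) \<and>
     (\<exists>C. \<forall>\<xi>. L2_norm M (T \<xi>) \<le> C * norm \<xi>)"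

definition represents ::
    "'a measure \<Rightarrow> ('h::real_normed_vector \<Rightarrow> 'a \<Rightarrow> real) \<Rightarrow> ('a \<Rightarrow> real) \<Rightarrow> ('h \<Rightarrow> complex) \<Rightarrow> bool" where
  "represents M T \<phi> f \<longleftrightarrow>
     bounded_linear_L2 M T \<and>
     \<phi> \<in> borel_measurable M \<and> (AE x in M. \<phi> x > 0) \<and>
     (\<forall>\<xi>. f \<xi> = (\<integral>x. exp (\<i> * complex_of_real (\<phi> x * T \<xi> x)) \<partial>M))"


subsection \<open>The group of measure preserving automorphisms\<close>

definition mp_bij :: "'a measure \<Rightarrow> ('a \<Rightarrow> 'a) set" where
  "mp_bij M = {\<theta> \<in> Bij (space M).
     \<theta> \<in> measurable M M \<and> inv_into (space M) \<theta> \<in> measurable M M \<and> distr M M \<theta> = M}"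

definition mp_bij_group :: "'a measure \<Rightarrow> ('a \<Rightarrow> 'a) monoid" where
  "mp_bij_group M = BijGroup (space M) \<lparr>carrier := mp_bij M\<rparr>"

definition ae_id :: "'a measure \<Rightarrow> ('a \<Rightarrow> 'a) set" where
  "ae_id M = {\<theta> \<in> mp_bij M. AE x in M. \<theta> x = x}"

text \<open>
  Automorphisms are identified when they agree almost everywhere: the coset of \<open>\<theta>\<close> consists
  precisely of the elements of \<open>mp_bij M\<close> that are almost everywhere equal to \<open>\<theta>\<close>.
  On a standard Borel probability space, every bijection between conull Borel sets that preserves
  the measure agrees almost everywhere with an element of \<open>mp_bij\<close>.
\<close>

definition Aut :: "'a measure \<Rightarrow> ('a \<Rightarrow> 'a) set monoid" where
  "Aut M = mp_bij_group M Mod ae_id M"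

lemma mp_bij_subgroup: "subgroup (mp_bij M) (BijGroup (space M))"
proof -
  interpret group "BijGroup (space M)" by (rule group_BijGroup)
  let ?S = "space M"
  have cmp: "compose ?S g f \<in> mp_bij M" if g: "g \<in> mp_bij M" and f: "f \<in> mp_bij M" for f g
  proof -
    have B: "f \<in> Bij ?S" "g \<in> Bij ?S" and m: "f \<in> measurable M M" "g \<in> measurable M M"
      "inv_into ?S f \<in> measurable M M" "inv_into ?S g \<in> measurable M M"
      "distr M M f = M" "distr M M g = M"
      using f g by (auto simp: mp_bij_def)
    have bf: "bij_betw f ?S ?S" "bij_betw g ?S ?S" using B by (auto simp: Bij_def)
    have 1: "compose ?S g f \<in> Bij ?S" by (simp add: B compose_Bij)
    have 2: "compose ?S g f \<in> measurable M M"
      by (rule measurable_cong[THEN iffD2, OF _ measurable_comp[OF m(1,2)]]) (simp add: compose_def)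
    have 3: "inv_into ?S (compose ?S g f) \<in> measurable M M"
    proof (rule measurable_cong[THEN iffD2, OF _ measurable_comp[OF m(4,3)]])
      fix w assume w: "w \<in> ?S"
      let ?z = "inv_into ?S f (inv_into ?S g w)"
      have z: "?z \<in> ?S" "inv_into ?S g w \<in> ?S" using m(3,4) w by (auto dest: measurable_space)
      have "compose ?S g f ?z = w" 
        using z w bf by (simp add: compose_eq bij_betw_inv_into_right)
      moreover have "inj_on (compose ?S g f) ?S" using 1 by (auto simp: Bij_def bij_betw_def)
      ultimately show "inv_into ?S (compose ?S g f) w = (inv_into ?S f \<circ> inv_into ?S g) w"
        using z by (metis comp_apply inv_into_f_f)
    qed
    have "distr M M (compose ?S g f) = distr M M (g \<circ> f)"
      by (rule distr_cong) (auto simp: compose_def)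
    also have "\<dots> = M" using distr_distr[OF m(2,1)] m by simp
    finally show ?thesis using 1 2 3 by (simp add: mp_bij_def)
  qed
  show ?thesis
  proof (rule subgroupI)
    show "mp_bij M \<subseteq> carrier (BijGroup ?S)" by (auto simp: mp_bij_def BijGroup_def)
    have "(\<lambda>x\<in>?S. x) \<in> mp_bij M"
    proof -
      have "inv_into ?S (\<lambda>x\<in>?S. x) \<in> measurable M M"
        by (rule measurable_cong[THEN iffD2, OF _ measurable_ident])
          (metis inj_on_restrict_eq inj_on_def inv_into_f_f restrict_apply' id_apply)
      moreover have "distr M M (\<lambda>x\<in>?S. x) = distr M M (\<lambda>x. x)" by (rule distr_cong) auto
      moreover have "(\<lambda>x\<in>?S. x) \<in> measurable M M"
        by (rule measurable_cong[THEN iffD2, OF _ measurable_ident]) simp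
      ultimately show ?thesis unfolding mp_bij_def by (simp add: id_Bij distr_id)
    qed
    then show "mp_bij M \<noteq> {}" by blast
    show "inv\<^bsub>BijGroup ?S\<^esub> f \<in> mp_bij M" if f: "f \<in> mp_bij M" for f
    proof -
      have B: "f \<in> Bij ?S" and m: "f \<in> measurable M M" "inv_into ?S f \<in> measurable M M" "distr M M f = M"
        using f by (auto simp: mp_bij_def)
      have b: "bij_betw f ?S ?S" using B by (auto simp: Bij_def)
      let ?g = "\<lambda>x\<in>?S. inv_into ?S f x"
      have g: "inv\<^bsub>BijGroup ?S\<^esub> f = ?g" using B by (rule inv_BijGroup)
      have 1: "?g \<in> Bij ?S" using B by (rule restrict_inv_into_Bij)
      have 2: "?g \<in> measurable M M"
        by (rule measurable_cong[THEN iffD2, OF _ m(2)]) simp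
      have "inv_into ?S ?g w = f w" if "w \<in> ?S" for w
      proof -
        have "f w \<in> ?S" "?g (f w) = w" using b that by (auto simp: bij_betw_def inv_into_f_f)
        moreover have "inj_on ?g ?S" using 1 by (auto simp: Bij_def bij_betw_def)
        ultimately show ?thesis by (metis inv_into_f_f)
      qed
      then have 3: "inv_into ?S ?g \<in> measurable M M" using m(1) measurable_cong by blast
      have "distr M M ?g = distr (distr M M f) M ?g" using m by simp
      also have "\<dots> = distr M M (?g \<circ> f)" using distr_distr[OF 2 m(1)] .
      also have "\<dots> = distr M M (\<lambda>x. x)"
        using b by (intro distr_cong) (auto simp: bij_betw_def inv_into_f_f)
      finally show ?thesis using 1 2 3 g by (simp add: mp_bij_def distr_id)
    qed
    show "g \<otimes>\<^bsub>BijGroup ?S\<^esub> f \<in> mp_bij M" if "g \<in> mp_bij M" "f \<in> mp_bij M" for g f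
      using cmp[OF that] that by (simp add: BijGroup_def mp_bij_def)
  qed
qed

lemma group_mp_bij_group: "group (mp_bij_group M)"
  unfolding mp_bij_group_def
  using group.subgroup_imp_group[OF group_BijGroup mp_bij_subgroup] .

lemma AE_mp_bij: assumes "\<theta> \<in> mp_bij M" "AE x in M. P x" shows "AE x in M. P (\<theta> x)"
proof -
  have m: "\<theta> \<in> measurable M M" "distr M M \<theta> = M" using assms by (auto simp: mp_bij_def)
  have "AE x in distr M M \<theta>. P x" by (subst m(2)) (rule assms(2))
  then show ?thesis using AE_distrD[OF m(1)] by blast
qed

lemma mult_mp_bij_group: "f \<in> mp_bij M \<Longrightarrow> g \<in> mp_bij M \<Longrightarrow> f \<otimes>\<^bsub>mp_bij_group M\<^esub> g = compose (space M) f g"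
  by (simp add: mp_bij_group_def BijGroup_def mp_bij_def)

lemma inv_mp_bij_group: "f \<in> mp_bij M \<Longrightarrow> inv\<^bsub>mp_bij_group M\<^esub> f = (\<lambda>x\<in>space M. inv_into (space M) f x)"
  unfolding mp_bij_group_def
  by (subst group.m_inv_consistent[OF group_BijGroup mp_bij_subgroup])
    (auto intro!: inv_BijGroup simp: mp_bij_def)

lemma carrier_mp_bij_group [simp]: "carrier (mp_bij_group M) = mp_bij M" by (simp add: mp_bij_group_def)

lemma bij_betw_mp_bij: "f \<in> mp_bij M \<Longrightarrow> bij_betw f (space M) (space M)" by (auto simp: mp_bij_def Bij_def)

lemma normal_ae_id: "ae_id M \<lhd> mp_bij_group M"
proof -
  interpret group "mp_bij_group M" by (rule group_mp_bij_group)
  have sub: "ae_id M \<subseteq> mp_bij M" by (auto simp: ae_id_def)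
  have invm: "inv\<^bsub>mp_bij_group M\<^esub> f \<in> mp_bij M" if "f \<in> mp_bij M" for f using inv_closed that by simp
  have mm: "f \<otimes>\<^bsub>mp_bij_group M\<^esub> g \<in> mp_bij M" if "f \<in> mp_bij M" "g \<in> mp_bij M" for f g using m_closed that by simp
  have sg: "subgroup (ae_id M) (mp_bij_group M)"
  proof (rule subgroupI)
    show "ae_id M \<subseteq> carrier (mp_bij_group M)" using sub by simp
    have "\<one>\<^bsub>mp_bij_group M\<^esub> \<in> ae_id M"
      using one_closed by (auto simp: ae_id_def mp_bij_group_def BijGroup_def)
    then show "ae_id M \<noteq> {}" by blast
    show "inv\<^bsub>mp_bij_group M\<^esub> f \<in> ae_id M" if f: "f \<in> ae_id M" for f
    proof -
      have f': "f \<in> mp_bij M" "AE x in M. f x = x" using f by (auto simp: ae_id_def)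
      have "AE x in M. x \<in> space M \<longrightarrow> inv_into (space M) f x = x"
        using f'(2) by eventually_elim (metis bij_betw_mp_bij f'(1) bij_betw_inv_into_left)
      then have "AE x in M. (\<lambda>x\<in>space M. inv_into (space M) f x) x = x" using AE_space by eventually_elim auto
      then show ?thesis using invm[OF f'(1)] inv_mp_bij_group[OF f'(1)] by (simp add: ae_id_def)
    qed
    show "f \<otimes>\<^bsub>mp_bij_group M\<^esub> g \<in> ae_id M" if "f \<in> ae_id M" "g \<in> ae_id M" for f g
    proof -
      have f': "f \<in> mp_bij M" "AE x in M. f x = x" "g \<in> mp_bij M" "AE x in M. g x = x"
        using that by (auto simp: ae_id_def)
      have "AE x in M. compose (space M) f g x = x"
        using f'(2,4) AE_space by eventually_elim (auto simp: compose_def)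
      then show ?thesis using f' mm by (simp add: ae_id_def mult_mp_bij_group)
    qed
  qed
  show ?thesis
  proof (rule normal_invI[OF sg])
    fix x h assume x: "x \<in> carrier (mp_bij_group M)" and h: "h \<in> ae_id M"
    have x': "x \<in> mp_bij M" and h': "h \<in> mp_bij M" "AE y in M. h y = y" using x h by (auto simp: ae_id_def)
    let ?i = "inv\<^bsub>mp_bij_group M\<^esub> x"
    have i: "?i \<in> mp_bij M" using invm x' .
    have e: "x \<otimes>\<^bsub>mp_bij_group M\<^esub> h \<otimes>\<^bsub>mp_bij_group M\<^esub> ?i = compose (space M) (compose (space M) x h) ?i"
      using mult_mp_bij_group[OF mm[OF x' h'(1)] i] mult_mp_bij_group[OF x' h'(1)] by simp
    have "AE y in M. h (?i y) = ?i y" using AE_mp_bij[OF i h'(2)] .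
    then have "AE y in M. compose (space M) (compose (space M) x h) ?i y = y"
      using AE_space
    proof eventually_elim
      case (elim y)
      have "?i y = inv_into (space M) x y" using elim inv_mp_bij_group[OF x'] by simp
      moreover have "inv_into (space M) x y \<in> space M" "x (inv_into (space M) x y) = y"
        using bij_betw_mp_bij[OF x'] elim by (auto simp: bij_betw_def inv_into_into f_inv_into_f)
      ultimately show ?case using elim by (simp add: compose_def)
    qed
    then show "x \<otimes>\<^bsub>mp_bij_group M\<^esub> h \<otimes>\<^bsub>mp_bij_group M\<^esub> ?i \<in> ae_id M"
      using e mm[OF mm[OF x' h'(1)] i] by (auto simp: ae_id_def)
  qed
qed

lemma group_Aut: "group (Aut M)"
  unfolding Aut_def by (rule normal.factorgroup_is_group[OF normal_ae_id])

lemma rcoset_ae_id: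
  assumes t: "\<theta> \<in> mp_bij M"
  shows "ae_id M #>\<^bsub>mp_bij_group M\<^esub> \<theta> = {\<sigma> \<in> mp_bij M. AE x in M. \<sigma> x = \<theta> x}"
proof -
  interpret group "mp_bij_group M" by (rule group_mp_bij_group)
  have mm: "f \<otimes>\<^bsub>mp_bij_group M\<^esub> g \<in> mp_bij M" if "f \<in> mp_bij M" "g \<in> mp_bij M" for f g
    using m_closed that by simp
  show ?thesis
  proof (intro equalityI subsetI)
    fix s assume "s \<in> ae_id M #>\<^bsub>mp_bij_group M\<^esub> \<theta>"
    then obtain n where n: "n \<in> ae_id M" "s = n \<otimes>\<^bsub>mp_bij_group M\<^esub> \<theta>" by (auto simp: r_coset_def)
    have n': "n \<in> mp_bij M" "AE x in M. n x = x" using n by (auto simp: ae_id_def)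
    have "AE x in M. n (\<theta> x) = \<theta> x" using AE_mp_bij[OF t n'(2)] .
    then have "AE x in M. compose (space M) n \<theta> x = \<theta> x" using AE_space by eventually_elim (simp add: compose_def)
    then show "s \<in> {\<sigma> \<in> mp_bij M. AE x in M. \<sigma> x = \<theta> x}"
      using n'(1) t mult_mp_bij_group[OF n'(1) t] mm[OF n'(1) t] n(2) by auto
  next
    fix s assume s: "s \<in> {\<sigma> \<in> mp_bij M. AE x in M. \<sigma> x = \<theta> x}"
    let ?i = "inv\<^bsub>mp_bij_group M\<^esub> \<theta>"
    have i: "?i \<in> mp_bij M" using inv_closed t by simp
    have "AE x in M. s (?i x) = \<theta> (?i x)" using AE_mp_bij[OF i] s by blast
    then have "AE x in M. compose (space M) s ?i x = x" using AE_space
    proof eventually_elim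
      case (elim y)
      then show ?case using inv_mp_bij_group[OF t] bij_betw_mp_bij[OF t] by (simp add: compose_def bij_betw_def f_inv_into_f)
    qed
    then have "s \<otimes>\<^bsub>mp_bij_group M\<^esub> ?i \<in> ae_id M"
      using s i mult_mp_bij_group[OF _ i] mm[OF _ i] by (auto simp: ae_id_def)
    moreover have "s = (s \<otimes>\<^bsub>mp_bij_group M\<^esub> ?i) \<otimes>\<^bsub>mp_bij_group M\<^esub> \<theta>"
      using s t i by (simp add: m_assoc)
    ultimately show "s \<in> ae_id M #>\<^bsub>mp_bij_group M\<^esub> \<theta>" unfolding r_coset_def by blast
  qed
qed

text \<open>
  The coarsest topology for which all maps \<open>\<theta> \<mapsto> \<theta> A\<close> into the measure algebra are continuous.
\<close>

definition weak_topology :: "'a measure \<Rightarrow> ('a \<Rightarrow> 'a) set topology" where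
  "weak_topology M = topology_generated_by
     {{\<Theta> \<in> carrier (Aut M). \<forall>\<theta>\<in>\<Theta>. \<forall>\<sigma>\<in>\<Sigma>. measure M (sym_diff (\<theta> ` A) (\<sigma> ` A)) < \<epsilon>} | \<Sigma> A \<epsilon>.
        \<Sigma> \<in> carrier (Aut M) \<and> A \<in> sets M \<and> \<epsilon> > 0}"

lemma topspace_weak_topology: "topspace (weak_topology M) = carrier (Aut M)"
proof -
  let ?B = "\<lambda>\<Sigma> A \<epsilon>. {\<Theta> \<in> carrier (Aut M). \<forall>\<theta>\<in>\<Theta>. \<forall>\<sigma>\<in>\<Sigma>. measure M (sym_diff (\<theta> ` A) (\<sigma> ` A)) < \<epsilon>}"
  let ?S = "{?B \<Sigma> A \<epsilon> | \<Sigma> A \<epsilon>. \<Sigma> \<in> carrier (Aut M) \<and> A \<in> sets M \<and> \<epsilon> > 0}"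
  have "\<Theta> \<in> \<Union>?S" if "\<Theta> \<in> carrier (Aut M)" for \<Theta>
  proof (rule UnionI)
    show "\<Theta> \<in> ?B \<Theta> {} 1" using that by simp
    show "?B \<Theta> {} 1 \<in> ?S"
      using that by (intro CollectI exI[of _ \<Theta>] exI[of _ "{}"] exI[of _ 1]) simp
  qed
  moreover have "\<Union>?S \<subseteq> carrier (Aut M)" by blast
  ultimately have "\<Union>?S = carrier (Aut M)" by blast
  then show ?thesis
    unfolding weak_topology_def topology_generated_by_topspace by simp
qed


subsection \<open>Groups of bounded invertible operators\<close>

definition GL :: "('h::real_normed_vector \<Rightarrow>\<^sub>L 'h) monoid" where
  "GL = units_of \<lparr>carrier = UNIV, mult = (o\<^sub>L), one = id_blinfun\<rparr>"

lemma group_GL: "group (GL :: ('h::real_normed_vector \<Rightarrow>\<^sub>L 'h) monoid)"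
  unfolding GL_def by (intro monoid.units_group monoidI) (auto simp: blinfun_eqI)

lemma carrier_GL:
  "carrier (GL :: ('h::real_normed_vector \<Rightarrow>\<^sub>L 'h) monoid) = {u. \<exists>v. u o\<^sub>L v = id_blinfun \<and> v o\<^sub>L u = id_blinfun}"
  unfolding GL_def by (auto simp: units_of_def Units_def)

definition GL_fixing :: "('h::real_normed_vector \<Rightarrow> complex) \<Rightarrow> ('h \<Rightarrow>\<^sub>L 'h) set" where
  "GL_fixing f = {u \<in> carrier GL. \<forall>\<xi>. f (u \<xi>) = f \<xi>}"

definition uniformly_bounded :: "('h::real_normed_vector \<Rightarrow>\<^sub>L 'h) set \<Rightarrow> bool" where
  "uniformly_bounded G \<longleftrightarrow> bdd_above (norm ` G)"

text \<open>
  Groups of operators carry the strong operator topology.  An automorphism \<open>\<theta>\<close> acts on functions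
  by \<open>h \<mapsto> h \<circ> \<theta>\<^sup>-\<^sup>1\<close>; the two almost everywhere identities do not depend on the
  representative \<open>\<theta>\<close> of \<open>\<beta> u\<close>.
\<close>

definition implements ::
    "'a measure \<Rightarrow> ('h::real_normed_vector \<Rightarrow> 'a \<Rightarrow> real) \<Rightarrow> ('a \<Rightarrow> real) \<Rightarrow>
     ('h \<Rightarrow>\<^sub>L 'h) set \<Rightarrow> (('h \<Rightarrow>\<^sub>L 'h) \<Rightarrow> ('a \<Rightarrow> 'a) set) \<Rightarrow> bool" where
  "implements M T \<phi> G \<beta> \<longleftrightarrow>
     \<beta> \<in> hom (GL\<lparr>carrier := G\<rparr>) (Aut M) \<and>
     continuous_map (subtopology strong_operator_topology G) (weak_topology M) \<beta> \<and>
     (\<forall>u\<in>G. \<forall>\<theta>\<in>\<beta> u.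
        (\<forall>\<xi>. AE x in M. T (u \<xi>) x = T \<xi> (inv_into (space M) \<theta> x)) \<and>
        (AE x in M. \<phi> (\<theta> x) = \<phi> x))"

end

theory Submission
  imports Defs
begin

text \<open>
  By Bochner's theorem \<open>f \<xi> = E exp (i L \<xi>)\<close> for a random linear functional \<open>L\<close> on \<open>H\<close>, realised on
  the cube \<open>[-\<pi>/2, \<pi>/2]\<^sup>\<nat>\<close> with coordinates \<open>arctan (L (d i))\<close>, where \<open>d\<close> is dense in \<open>H\<close>; the law is a
  weak limit of Fejer measures on finite grids.  It remains to find a weight \<open>v > 0\<close> such that
  \<open>E (v L \<xi>)\<^sup>2 \<le> N(\<xi>)\<^sup>2\<close> for a norm \<open>N\<close> invariant under \<open>\<G>\<close>; then \<open>T \<xi> = v L \<xi>\<close> and \<open>\<phi> = 1 / v\<close>.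

  For finite families \<open>xs\<close> of vectors minimise \<open>E exp (- \<Sum> (L \<xi>)\<^sup>2) + \<Sum> N(\<xi>)\<^sup>2\<close>.  Strict convexity makes
  \<open>exp (- \<Sum> (L \<xi>)\<^sup>2 / 2)\<close> converge along every minimising sequence to one and the same limit \<open>v\<close>,
  which is therefore invariant under all measure preserving maps induced by \<open>\<G>\<close>.  The
  first variation gives the bound, and continuity of \<open>f\<close> together with the parallelogram law gives \<open>v > 0\<close>.
\<close>

subsection \<open>Finite trigonometric measures\<close>

text \<open>The variables \<open>L \<xi>\<close> may lack second moments, so \<open>L\<close> itself
  cannot serve as \<open>T\<close>; a weight restores them, and since only the product of
  \<open>T\<close> and \<open>\<phi>\<close> enters the formula it can be divided out again. That
  such a weight exists is a Hilbert space effect: a Gaussian average over finitely many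
  \<open>L \<xi>\<close> is controlled by the sum of the squared norms alone, however many vectors
  there are. The group carries no invariant mean, so invariance of the weight cannot come from
  averaging over it; uniqueness takes over that role. The infimum need not be attained by a finite
  family, which is why uniqueness is phrased for limits of minimising sequences. The norm
  \<open>N\<close>, and with it the weight, depends on the group, whereas the cube, its measure and
  \<open>L\<close> do not. Finally, \<open>L\<close> is linear only up to null sets that depend on
  the vectors. Symmetries are therefore defined on the coordinates belonging to the sequence
  \<open>d\<close> and reach other vectors by continuity in probability.\<close>

lemma positive_definite_finite:
  fixes f :: "'h::ab_group_add \<Rightarrow> complex"
  assumes "positive_definite f" "finite B"
  shows "(\<Sum>j\<in>B. \<Sum>k\<in>B. c j * cnj (c k) * f (\<xi> j - \<xi> k)) \<in> \<real>"
    and "0 \<le> Re (\<Sum>j\<in>B. \<Sum>k\<in>B. c j * cnj (c k) * f (\<xi> j - \<xi> k))"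
proof -
  obtain b where b: "bij_betw b {..<card B} B"
    using assms(2) by (metis atLeast0LessThan ex_bij_betw_nat_finite)
  have "(\<Sum>j\<in>B. \<Sum>k\<in>B. c j * cnj (c k) * f (\<xi> j - \<xi> k)) =
      (\<Sum>j<card B. \<Sum>k<card B. (c \<circ> b) j * cnj ((c \<circ> b) k) * f ((\<xi> \<circ> b) j - (\<xi> \<circ> b) k))"
    by (simp add: sum.reindex_bij_betw[OF b, symmetric])
  with assms(1) show "(\<Sum>j\<in>B. \<Sum>k\<in>B. c j * cnj (c k) * f (\<xi> j - \<xi> k)) \<in> \<real>"
    and "0 \<le> Re (\<Sum>j\<in>B. \<Sum>k\<in>B. c j * cnj (c k) * f (\<xi> j - \<xi> k))"
    unfolding positive_definite_def Let_def by (simp_all only:)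
qed

text \<open>Orthogonality of characters on a cyclic group of order \<open>2 * N\<close>, summed over
  one full period. The bound on \<open>a\<close> leaves 0 as the only multiple of
  \<open>2 * N\<close>.\<close>

lemma sum_cis_root_of_unity:
  fixes a :: int
  assumes N: "N > 0" and a: "\<bar>a\<bar> < 2 * int N"
  shows "(\<Sum>x\<in>{-int N..<int N}. cis (pi * of_int (a * x) / N)) = (if a = 0 then 2 * of_nat N else 0)"
proof (cases "a = 0")
  case True
  then show ?thesis by simp
next
  case False
  let ?w = "cis (pi * of_int a / N)"
  have "(\<Sum>x\<in>{-int N..<int N}. cis (pi * of_int (a * x) / N)) =
      (\<Sum>k<2*N. cis (- pi * a) * ?w ^ k)"
  proof (rule sum.reindex_bij_witness[of _ "\<lambda>k. int k - int N" "\<lambda>x. nat (x + int N)"])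
    fix x assume x: "x \<in> {-int N..<int N}"
    have "cis (- pi * a) * ?w ^ nat (x + int N) = cis (- pi * a + real (nat (x + int N)) * (pi * of_int a / N))"
      by (simp only: Complex.DeMoivre cis_mult)
    also have "- pi * a + real (nat (x + int N)) * (pi * of_int a / N) = pi * of_int (a * x) / N"
      using x N by (simp add: field_simps)
    finally show "cis (- pi * a) * ?w ^ nat (x + int N) = cis (pi * of_int (a * x) / N)" .
  qed auto
  also have "\<dots> = cis (- pi * a) * (\<Sum>k<2*N. ?w ^ k)"
    by (simp add: sum_distrib_left)
  also have "(\<Sum>k<2*N. ?w ^ k) = 0"
  proof -
    have "?w \<noteq> 1"
    proof
      assume "?w = 1"
      then have "cos (pi * of_int a / N) = 1" by (metis cis.sel(1) one_complex.sel(1))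
      then obtain n :: int where "pi * of_int a / N = of_int n * 2 * pi"
        using cos_one_2pi_int by blast
      then have "real_of_int a = 2 * n * N" using N by (simp add: field_simps)
      then have "a = 2 * n * int N"
        by (metis (mono_tags, opaque_lifting) of_int_eq_iff of_int_mult of_int_numeral of_int_of_nat_eq)
      moreover from this False have "\<bar>n\<bar> \<ge> 1" by auto
      ultimately have "\<bar>a\<bar> \<ge> 2 * int N" using N by (simp add: abs_mult)
      with a show False by simp
    qed
    moreover have "?w ^ (2*N) = 1"
    proof -
      have "real (2*N) * (pi * of_int a / N) = 2 * pi * of_int a" using N by simp
      then show ?thesis by (simp only: Complex.DeMoivre cis_multiple_2pi Ints_of_int)
    qed
    ultimately show ?thesis using geometric_sum[of ?w "2*N"] by simp
  qed
  finally show ?thesis using False by simp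
qed

text \<open>The autocorrelation of an interval of length \<open>N\<close> is a triangle; it is the
  source of the Fejer factors.\<close>

lemma card_int_box_difference:
  fixes m :: int
  assumes "\<bar>m\<bar> < int N"
  shows "(\<Sum>a\<in>{0..<int N}. \<Sum>b\<in>{0..<int N}. if m = a - b then 1 else 0::real) = N - \<bar>m\<bar>"
proof -
  have "(\<Sum>a\<in>{0..<int N}. \<Sum>b\<in>{0..<int N}. if m = a - b then 1 else 0::real) =
      (\<Sum>a\<in>{0..<int N}. if a \<in> {max 0 m..<min (int N) (int N + m)} then 1 else 0::real)"
  proof (rule sum.cong)
    fix a assume a: "a \<in> {0..<int N}"
    have "(\<Sum>b\<in>{0..<int N}. if m = a - b then 1 else 0::real) = (\<Sum>b\<in>{0..<int N}. if b = a - m then 1 else 0)"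
      by (rule sum.cong) auto
    also have "\<dots> = (if a - m \<in> {0..<int N} then 1 else 0)" by (simp add: sum.delta)
    also have "\<dots> = (if a \<in> {max 0 m..<min (int N) (int N + m)} then 1 else 0)"
      using a by auto
    finally show "(\<Sum>b\<in>{0..<int N}. if m = a - b then 1 else 0::real) = \<dots>" .
  qed simp
  also have "\<dots> = real (card ({0..<int N} \<inter> {max 0 m..<min (int N) (int N + m)}))"
    by (simp only: sum.inter_restrict[symmetric, OF finite_atLeastLessThan_int]) simp
  also have "{0..<int N} \<inter> {max 0 m..<min (int N) (int N + m)} = {max 0 m..<min (int N) (int N + m)}"
    by auto
  also have "real (card \<dots>) = N - \<bar>m\<bar>" using assms by (auto simp: min_def max_def)
  finally show ?thesis .
qed

lemma cis_sum: "finite I \<Longrightarrow> cis (\<Sum>i\<in>I. g i) = (\<Prod>i\<in>I. cis (g i))"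
  by (induction I rule: finite_induct) (auto simp: cis_mult[symmetric])

text \<open>Fejer's construction on a finite grid: the quadratic form of \<open>f\<close> with
  characters as coefficients is a nonnegative trigonometric polynomial, and normalising it gives a
  probability. Its transform reproduces \<open>f\<close> at all small frequencies, apart from the
  triangular factors.\<close>

lemma fejer_pmf:
  fixes f :: "'h::real_vector \<Rightarrow> complex" and e :: "nat \<Rightarrow> 'h"
  assumes pd: "positive_definite f" and f0: "f 0 = 1" and N: "N > 0"
  obtains p :: "(nat \<Rightarrow> real) pmf" where
    "finite (set_pmf p)" "\<And>x i. x \<in> set_pmf p \<Longrightarrow> \<bar>x i\<bar> \<le> pi"
    "\<And>m. (\<And>i. i < n \<Longrightarrow> \<bar>m i\<bar> < int N) \<Longrightarrow>
      measure_pmf.expectation p (\<lambda>x. cis (\<Sum>i<n. of_int (m i) * x i)) =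
        f (\<Sum>i<n. of_int (m i) *\<^sub>R e i) * (\<Prod>i<n. 1 - \<bar>real_of_int (m i)\<bar> / N)"
proof -
  define S where "S j = (\<Sum>i<n. real_of_int (j i) *\<^sub>R e i)" for j :: "nat \<Rightarrow> int"
  \<comment> \<open>The frequencies \<open>m - (j - k)\<close> met below stay under
    \<open>2 * N\<close>, so \<open>2 * N\<close> grid points per coordinate sum them without
    aliasing.\<close>
  define A where "A = PiE {..<n} (\<lambda>_. {-int N..<int N})"
  define B where "B = PiE {..<n} (\<lambda>_. {0..<int N})"
  define E where "E a x = cis (\<Sum>i<n. pi * of_int (a i * x i) / N)" for a x :: "nat \<Rightarrow> int"
  have fin [simp]: "finite A" "finite B" by (auto simp: A_def B_def intro!: finite_PiE)
  \<comment> \<open>The doubled conjugation matches the shape of \<open>positive_definite\<close>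
    for the coefficients \<open>cnj (E j x)\<close>.\<close>
  define s where "s x = (\<Sum>j\<in>B. \<Sum>k\<in>B. cnj (E j x) * cnj (cnj (E k x)) * f (S j - S k))" for x
  have s: "s x = of_real (Re (s x))" "0 \<le> Re (s x)" for x
    using positive_definite_finite[OF pd fin(2), of "\<lambda>j. cnj (E j x)" S]
    by (auto simp: s_def complex_is_Real_iff complex_eq_iff)
  have E_add: "E a x * E b x = E (\<lambda>i. a i + b i) x" for a b x
    by (simp add: E_def cis_mult sum.distrib[symmetric] add_divide_distrib[symmetric] algebra_simps)
  have E_cnj: "cnj (E a x) = E (\<lambda>i. - a i) x" for a x
    by (simp add: E_def cis_cnj sum_negf)
  have E_sum: "(\<Sum>x\<in>A. E a x) = (\<Prod>i<n. if a i = 0 then 2 * of_nat N else 0)" if "\<And>i. i < n \<Longrightarrow> \<bar>a i\<bar> < 2 * int N" for a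
  proof -
    have "(\<Sum>x\<in>A. E a x) = (\<Sum>x\<in>A. \<Prod>i<n. cis (pi * of_int (a i * x i) / N))"
      by (simp add: E_def cis_sum)
    also have "\<dots> = (\<Prod>i<n. \<Sum>y\<in>{-int N..<int N}. cis (pi * of_int (a i * y) / N))"
      unfolding A_def by (subst prod_sum_PiE) auto
    also have "\<dots> = (\<Prod>i<n. if a i = 0 then 2 * of_nat N else 0)"
      using that by (intro prod.cong refl sum_cis_root_of_unity N) auto
    finally show ?thesis .
  qed
  have key: "(\<Sum>x\<in>A. s x * E m x) = (2 * of_nat N * of_nat N) ^ n * f (S m) * (\<Prod>i<n. 1 - \<bar>real_of_int (m i)\<bar> / N)"
    if m: "\<And>i. i < n \<Longrightarrow> \<bar>m i\<bar> < int N" for m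
  proof -
    have "(\<Sum>x\<in>A. s x * E m x) = (\<Sum>x\<in>A. \<Sum>j\<in>B. \<Sum>k\<in>B. f (S j - S k) * E (\<lambda>i. m i - (j i - k i)) x)"
      unfolding s_def sum_distrib_right
    proof (intro sum.cong refl)
      fix x j k
      have "cnj (E j x) * cnj (cnj (E k x)) * f (S j - S k) * E m x =
          f (S j - S k) * (E m x * (E (\<lambda>i. - j i) x * E k x))"
        by (simp add: E_cnj mult_ac)
      then show "cnj (E j x) * cnj (cnj (E k x)) * f (S j - S k) * E m x =
          f (S j - S k) * E (\<lambda>i. m i - (j i - k i)) x"
        by (simp add: E_add algebra_simps)
    qed
    also have "\<dots> = (\<Sum>j\<in>B. \<Sum>k\<in>B. \<Sum>x\<in>A. f (S j - S k) * E (\<lambda>i. m i - (j i - k i)) x)"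
      by (subst sum.swap, rule sum.cong[OF refl], subst sum.swap) simp
    also have "\<dots> = (\<Sum>j\<in>B. \<Sum>k\<in>B. (2 * of_nat N) ^ n * f (S m) * (\<Prod>i<n. if m i = j i - k i then 1 else 0))"
    proof (intro sum.cong refl)
      fix j k assume jk: "j \<in> B" "k \<in> B"
      have "\<bar>m i - (j i - k i)\<bar> < 2 * int N" if "i < n" for i
      proof -
        have "j i \<in> {0..<int N}" "k i \<in> {0..<int N}" using jk that by (auto simp: B_def PiE_iff)
        with m[OF that] show ?thesis by auto
      qed
      then have "(\<Sum>x\<in>A. f (S j - S k) * E (\<lambda>i. m i - (j i - k i)) x) =
          f (S j - S k) * (\<Prod>i<n. if m i - (j i - k i) = 0 then 2 * of_nat N else 0)"
        by (simp only: E_sum flip: sum_distrib_left)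
      \<comment> \<open>Only pairs with \<open>m = j - k\<close> in every coordinate survive, and
        there additivity of \<open>S\<close> turns \<open>f (S j - S k)\<close> into
        \<open>f (S m)\<close>.\<close>
      also have "\<dots> = (2 * of_nat N) ^ n * f (S m) * (\<Prod>i<n. if m i = j i - k i then 1 else 0)"
      proof (cases "\<forall>i<n. m i = j i - k i")
        case True
        then have "S m = S j - S k"
          unfolding S_def sum_subtractf[symmetric] by (intro sum.cong) (auto simp: scaleR_diff_left)
        then show ?thesis using True by simp
      next
        case False
        then have "(\<Prod>i<n. if m i - (j i - k i) = 0 then 2 * of_nat N else 0::complex) = 0"
          "(\<Prod>i<n. if m i = j i - k i then 1 else 0::complex) = 0"
          by (auto intro!: prod_zero)
        then show ?thesis by (simp only: mult_zero_right)
      qed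
      finally show "(\<Sum>x\<in>A. f (S j - S k) * E (\<lambda>i. m i - (j i - k i)) x) = \<dots>" .
    qed
    also have "\<dots> = (2 * of_nat N) ^ n * f (S m) * (\<Sum>j\<in>B. \<Sum>k\<in>B. \<Prod>i<n. if m i = j i - k i then 1 else 0)"
      by (simp add: sum_distrib_left)
    also have "(\<Sum>j\<in>B. \<Sum>k\<in>B. \<Prod>i<n. if m i = j i - k i then 1 else 0::complex) =
        (\<Prod>i<n. \<Sum>a\<in>{0..<int N}. \<Sum>b\<in>{0..<int N}. if m i = a - b then 1 else 0)"
    proof -
      have "(\<Sum>j\<in>B. \<Sum>k\<in>B. \<Prod>i<n. if m i = j i - k i then 1 else 0::complex) =
        (\<Sum>j\<in>B. \<Prod>i<n. \<Sum>b\<in>{0..<int N}. if m i = j i - b then 1 else 0)"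
        unfolding B_def by (intro sum.cong refl, subst prod_sum_PiE) auto
      also have "\<dots> = (\<Prod>i<n. \<Sum>a\<in>{0..<int N}. \<Sum>b\<in>{0..<int N}. if m i = a - b then 1 else 0)"
        unfolding B_def by (subst prod_sum_PiE) auto
      finally show ?thesis .
    qed
    also have "\<dots> = (\<Prod>i<n. of_real (real N - \<bar>real_of_int (m i)\<bar>))"
    proof (intro prod.cong refl)
      fix i assume "i \<in> {..<n}"
      then have "\<bar>m i\<bar> < int N" using m by simp
      from arg_cong[OF card_int_box_difference[OF this], of complex_of_real]
      show "(\<Sum>a\<in>{0..<int N}. \<Sum>b\<in>{0..<int N}. if m i = a - b then 1 else 0) = complex_of_real (real N - \<bar>real_of_int (m i)\<bar>)"
        by (simp add: if_distrib[of complex_of_real] cong: if_cong)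
    qed
    also have "\<dots> = of_nat N ^ n * (\<Prod>i<n. 1 - \<bar>real_of_int (m i)\<bar> / N)"
    proof -
      have "(\<Prod>i<n. complex_of_real (real N - \<bar>real_of_int (m i)\<bar>)) = (\<Prod>i<n. of_nat N * of_real (1 - \<bar>real_of_int (m i)\<bar> / N))"
        using N by (intro prod.cong refl) (simp add: field_simps)
      then show ?thesis by (simp add: prod.distrib)
    qed
    finally show ?thesis by (simp add: power_mult_distrib algebra_simps)
  qed
  \<comment> \<open>The total mass, read off \<open>key\<close> at \<open>m = 0\<close>: per
    coordinate, \<open>2 * N\<close> grid points and \<open>N\<close> pairs with
    \<open>j = k\<close>.\<close>
  define c where "c = (2 * real N * real N) ^ n"
  have c: "c > 0" using N by (simp add: c_def)
  define P where "P x = (if x \<in> A then Re (s x) / c else 0)" for x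
  have P0: "P x \<ge> 0" for x using s c by (simp add: P_def)
  have sumP: "(\<Sum>x\<in>A. P x * E m x) = f (S m) * (\<Prod>i<n. 1 - \<bar>real_of_int (m i)\<bar> / N)"
    if m: "\<And>i. i < n \<Longrightarrow> \<bar>m i\<bar> < int N" for m
  proof -
    have "(\<Sum>x\<in>A. P x * E m x) = (\<Sum>x\<in>A. s x * E m x) / of_real c"
      unfolding sum_divide_distrib
    proof (intro sum.cong refl)
      fix x assume "x \<in> A"
      then have "complex_of_real (P x) = s x / of_real c" using s(1)[of x] by (simp add: P_def)
      then show "P x * E m x = s x * E m x / of_real c" by simp
    qed
    also have "\<dots> = f (S m) * (\<Prod>i<n. 1 - \<bar>real_of_int (m i)\<bar> / N)"
      using c key[OF m] N by (simp add: c_def)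
    finally show ?thesis .
  qed
  have "complex_of_real (\<Sum>x\<in>A. P x) = of_real 1"
    using sumP[of "\<lambda>_. 0"] N f0 by (simp add: E_def S_def)
  then have P1: "(\<Sum>x\<in>A. P x) = 1" using of_real_eq_iff by blast
  define q where "q = embed_pmf P"
  have q: "pmf q x = P x" for x
    unfolding q_def
  proof (rule pmf_embed_pmf)
    have "(\<integral>\<^sup>+ x. ennreal (P x) \<partial>count_space UNIV) = (\<integral>\<^sup>+ x\<in>A. ennreal (P x) \<partial>count_space UNIV)"
      by (intro nn_integral_cong) (auto simp: P_def)
    also have "\<dots> = (\<integral>\<^sup>+ x. ennreal (P x) \<partial>count_space A)"
      by (simp add: nn_integral_count_space_indicator)
    also have "\<dots> = 1" using P0 P1 by (simp add: nn_integral_count_space_finite)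
    finally show "(\<integral>\<^sup>+ x. ennreal (P x) \<partial>count_space UNIV) = 1" .
  qed (rule P0)
  define h where "h x = (\<lambda>i. if i < n then pi * of_int (x i) / N else 0)" for x :: "nat \<Rightarrow> int"
  have sq: "set_pmf q \<subseteq> A" using q by (auto simp: set_pmf_iff P_def split: if_splits)
  show ?thesis
  proof (rule that[of "map_pmf h q"])
    show "finite (set_pmf (map_pmf h q))" using sq finite_subset[OF sq fin(1)] by simp
    show "\<bar>x i\<bar> \<le> pi" if x: "x \<in> set_pmf (map_pmf h q)" for x i
    proof -
      obtain y where y: "y \<in> A" "x = h y" using x sq by auto
      show ?thesis
      proof (cases "i < n")
        case True
        then have "y i \<in> {-int N..<int N}" using y by (auto simp: A_def PiE_iff)
        then have "\<bar>y i\<bar> \<le> int N" by auto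
        then have "\<bar>real_of_int (y i)\<bar> \<le> real N" by linarith
        then show ?thesis using True N y by (simp add: h_def abs_mult field_simps)
      qed (simp add: y h_def)
    qed
    fix m :: "nat \<Rightarrow> int" assume m: "\<And>i. i < n \<Longrightarrow> \<bar>m i\<bar> < int N"
    have "measure_pmf.expectation (map_pmf h q) (\<lambda>x. cis (\<Sum>i<n. of_int (m i) * x i)) =
        (\<Sum>x\<in>A. pmf q x *\<^sub>R cis (\<Sum>i<n. of_int (m i) * h x i))"
      unfolding integral_map_pmf using sq by (intro integral_measure_pmf) auto
    also have "\<dots> = (\<Sum>x\<in>A. P x * E m x)"
      by (intro sum.cong refl) (simp add: q E_def h_def scaleR_conv_of_real mult.assoc mult.left_commute)
    finally show "measure_pmf.expectation (map_pmf h q) (\<lambda>x. cis (\<Sum>i<n. of_int (m i) * x i)) =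
        f (\<Sum>i<n. of_int (m i) *\<^sub>R e i) * (\<Prod>i<n. 1 - \<bar>real_of_int (m i)\<bar> / N)"
      using sumP[OF m] by (simp add: S_def)
  qed
qed

subsection \<open>Laws on the cube and the Schoenberg curve\<close>

lemma dyadic_approximation:
  fixes t :: real
  shows "(\<lambda>b. of_int \<lfloor>2 ^ b * t\<rfloor> / 2 ^ b) \<longlonglongrightarrow> t"
proof (rule real_tendsto_sandwich)
  show "\<forall>\<^sub>F n in sequentially. t - (1/2) ^ n \<le> of_int \<lfloor>2 ^ n * t\<rfloor> / 2 ^ n"
  proof (rule always_eventually, rule)
    fix n
    have "2 ^ n * t - 1 \<le> of_int \<lfloor>2 ^ n * t\<rfloor>" by linarith
    moreover have "t - (1/2) ^ n = (2 ^ n * t - 1) / 2 ^ n" by (simp add: field_simps power_divide)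
    ultimately show "t - (1/2) ^ n \<le> of_int \<lfloor>2 ^ n * t\<rfloor> / 2 ^ n" by (simp add: divide_right_mono)
  qed
  show "\<forall>\<^sub>F n in sequentially. of_int \<lfloor>2 ^ n * t\<rfloor> / 2 ^ n \<le> t"
    by (rule always_eventually, rule) (simp add: field_simps)
  have "(\<lambda>n. t - (1/2) ^ n) \<longlonglongrightarrow> t - 0"
    by (intro tendsto_diff tendsto_const LIMSEQ_power_zero) simp
  then show "(\<lambda>n. t - (1/2) ^ n) \<longlonglongrightarrow> t" by simp
qed simp

section \<open>Binary digits, Cantor codes and the Schoenberg curve\<close>

definition binary_digit :: "real \<Rightarrow> nat \<Rightarrow> int" where
  "binary_digit y j = \<lfloor>2 ^ Suc j * y\<rfloor> mod 2"

lemma binary_digit_cases: "binary_digit y j = 0 \<or> binary_digit y j = 1"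
  by (auto simp: binary_digit_def)

lemma binary_digit_sums:
  assumes "0 \<le> y" "y < 1"
  shows "(\<lambda>j. (1/2) ^ Suc j * of_int (binary_digit y j)) sums y"
proof -
  have step: "\<lfloor>2 ^ Suc j * y\<rfloor> = 2 * \<lfloor>2 ^ j * y\<rfloor> + binary_digit y j" for j
  proof -
    have "\<lfloor>2 ^ Suc j * y\<rfloor> div 2 = \<lfloor>2 ^ j * y\<rfloor>"
      using floor_divide_real_eq_div[of 2 "2 ^ Suc j * y"] by simp
    then show ?thesis unfolding binary_digit_def by presburger
  qed
  have partial: "(\<Sum>j<n. (1/2) ^ Suc j * of_int (binary_digit y j)) = real_of_int \<lfloor>2 ^ n * y\<rfloor> / 2 ^ n" for n
  proof (induction n)
    case 0
    have "\<lfloor>y\<rfloor> = 0" using assms by (simp add: floor_eq_iff)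
    then show ?case by simp
  next
    case (Suc n)
    have "(\<Sum>j<Suc n. (1/2) ^ Suc j * of_int (binary_digit y j)) =
        real_of_int \<lfloor>2 ^ n * y\<rfloor> / 2 ^ n + (1/2) ^ Suc n * of_int (binary_digit y n)"
      using Suc by simp
    also have "\<dots> = of_int \<lfloor>2 ^ Suc n * y\<rfloor> / 2 ^ Suc n"
      unfolding step by (simp add: field_simps power_divide)
    finally show ?case .
  qed
  show ?thesis unfolding sums_def partial by (rule dyadic_approximation)
qed

definition cantor_code :: "(nat \<Rightarrow> int) \<Rightarrow> real" where
  "cantor_code b = (\<Sum>m. 2 * of_int (b m) / 3 ^ Suc m)"

text \<open>A variant of Schoenberg's periodic function: with \<open>y = 3 ^ m * c\<close>, cutting
  \<open>1/2 - cos (pi * y)\<close> off to the unit interval gives a continuous even function of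
  period 2 that is 0 on [0, 1/3] and 1 on [2/3, 1].\<close>

definition schoenberg_digit :: "nat \<Rightarrow> real \<Rightarrow> real" where
  "schoenberg_digit m c = max 0 (min 1 (1/2 - cos (pi * (3 ^ m * c))))"

lemma cantor_code_bounds:
  assumes b: "\<And>m. b m = 0 \<or> b m = 1"
  shows "summable (\<lambda>m. 2 * real_of_int (b m) / 3 ^ Suc m)"
    and "0 \<le> cantor_code b" and "cantor_code b \<le> 1"
proof -
  have g: "(\<lambda>m. 2 / 3 ^ Suc m) sums (1::real)"
  proof -
    have "(\<lambda>m. (2/3) * (1/3) ^ m) sums ((2/3) * (1 / (1 - 1/3 :: real)))"
      by (intro sums_mult geometric_sums) simp
    then show ?thesis by (simp add: power_divide)
  qed
  have le: "0 \<le> 2 * real_of_int (b m) / 3 ^ Suc m" "norm (2 * real_of_int (b m) / 3 ^ Suc m) \<le> 2 / 3 ^ Suc m" "2 * real_of_int (b m) / 3 ^ Suc m \<le> 2 / 3 ^ Suc m" for m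
    using b[of m] by auto
  from sums_summable[OF g] show s: "summable (\<lambda>m. 2 * real_of_int (b m) / 3 ^ Suc m)"
    by (rule summable_comparison_test') (rule le(2))
  show "0 \<le> cantor_code b" unfolding cantor_code_def by (intro suminf_nonneg s le)
  show "cantor_code b \<le> 1"
    unfolding cantor_code_def sums_unique[OF g] by (intro suminf_le s sums_summable[OF g] le)
qed

text \<open>Multiplying by \<open>3 ^ n\<close> moves digit \<open>n\<close> to the front. The
  integer split off is even, because Cantor digits are 0 or 2, so the cosine does not see
  it.\<close>

lemma schoenberg_digit_cantor_code:
  assumes b: "\<And>m. b m = 0 \<or> b m = 1"
  shows "schoenberg_digit n (cantor_code b) = of_int (b n)"
proof -
  let ?u = "\<lambda>m. 2 * real_of_int (b m) / 3 ^ Suc m"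
  \<comment> \<open>What remains of \<open>3 ^ n * cantor_code b\<close> after the even integer: it
    lies in [0, 1/3] or in [2/3, 1] according to \<open>b n\<close>.\<close>
  define y where "y = 2 * of_int (b n) / 3 + cantor_code (\<lambda>m. b (m + Suc n)) / 3"
  have s: "summable ?u" "summable (\<lambda>m. 2 * real_of_int (b (m + Suc n)) / 3 ^ Suc m)"
    using cantor_code_bounds(1)[of b] cantor_code_bounds(1)[of "\<lambda>m. b (m + Suc n)"] b by blast+
  have "cantor_code b = (\<Sum>m. ?u (m + Suc n)) + (\<Sum>m<Suc n. ?u m)"
    unfolding cantor_code_def by (rule suminf_split_initial_segment[OF s(1)])
  also have "(\<Sum>m. ?u (m + Suc n)) = (\<Sum>m. 1 / 3 ^ Suc n * (2 * real_of_int (b (m + Suc n)) / 3 ^ Suc m))"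
    by (intro suminf_cong) (simp add: power_add)
  also have "\<dots> = 1 / 3 ^ Suc n * cantor_code (\<lambda>m. b (m + Suc n))"
    unfolding cantor_code_def by (rule suminf_mult[OF s(2)])
  finally have "3 ^ n * cantor_code b = y + (\<Sum>m<n. 3 ^ n * ?u m)"
    by (simp add: y_def distrib_left sum_distrib_left field_simps)
  also have "(\<Sum>m<n. 3 ^ n * ?u m) = 2 * of_int (\<Sum>m<n. b m * 3 ^ (n - Suc m))"
    unfolding sum_distrib_left of_int_sum
  proof (intro sum.cong refl)
    fix m assume "m \<in> {..<n}"
    then have "(3::real) ^ n = 3 ^ Suc m * 3 ^ (n - Suc m)" by (simp del: power_Suc flip: power_add)
    then show "3 ^ n * ?u m = 2 * real_of_int (b m * 3 ^ (n - Suc m))" by simp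
  qed
  finally have "pi * (3 ^ n * cantor_code b) = pi * y + 2 * pi * of_int (\<Sum>m<n. b m * 3 ^ (n - Suc m))"
    by (simp add: algebra_simps)
  then have c: "cos (pi * (3 ^ n * cantor_code b)) = cos (pi * y)"
    by (simp only: cos_add cos_int_2pin sin_int_2pin)
  have t: "0 \<le> cantor_code (\<lambda>m. b (m + Suc n))" "cantor_code (\<lambda>m. b (m + Suc n)) \<le> 1"
    using b by (auto intro!: cantor_code_bounds)
  show ?thesis
  proof (cases "b n = 0")
    case True
    have "cos (pi / 3) \<le> cos (pi * y)"
      using t True by (intro cos_monotone_0_pi_le) (auto simp: y_def field_simps)
    then show ?thesis using True by (simp add: schoenberg_digit_def c cos_60)
  next
    case False
    have "cos (pi * y) \<le> cos (2 * pi / 3)"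
      using t b[of n] False by (intro cos_monotone_0_pi_le) (auto simp: y_def field_simps)
    then show ?thesis using b[of n] False by (simp add: schoenberg_digit_def c cos_120)
  qed
qed

text \<open>A space-filling curve for the Hilbert cube: \<open>prod_encode\<close> deals the digits
  of one Cantor code out to countably many coordinates. It is continuous on the whole line because
  every digit function is.\<close>

definition schoenberg_curve :: "real \<Rightarrow> nat \<Rightarrow> real" where
  "schoenberg_curve c k = (\<Sum>j. (1/2) ^ Suc j * schoenberg_digit (prod_encode (k, j)) c)"

lemma schoenberg_digit_bounds: "0 \<le> schoenberg_digit m c" "schoenberg_digit m c \<le> 1"
  by (auto simp: schoenberg_digit_def)

lemma half_power_Suc_sums: "(\<lambda>j. (1/2) ^ Suc j) sums (1::real)"
proof -
  have "(\<lambda>j. (1/2) * (1/2) ^ j) sums ((1/2) * (1 / (1 - 1/2 :: real)))"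
    by (intro sums_mult geometric_sums) simp
  then show ?thesis by simp
qed

lemma schoenberg_curve_bounds: "0 \<le> schoenberg_curve c k" "schoenberg_curve c k \<le> 1"
proof -
  have s: "summable (\<lambda>j. (1/2) ^ Suc j * schoenberg_digit (prod_encode (k, j)) c)"
    by (rule summable_comparison_test'[OF sums_summable[OF half_power_Suc_sums], of 0])
      (simp add: schoenberg_digit_bounds abs_mult)
  show "0 \<le> schoenberg_curve c k" unfolding schoenberg_curve_def
    by (intro suminf_nonneg s) (simp add: schoenberg_digit_bounds)
  have "schoenberg_curve c k \<le> (\<Sum>j. (1/2) ^ Suc j)" unfolding schoenberg_curve_def
    by (intro suminf_le s sums_summable[OF half_power_Suc_sums]) (simp add: schoenberg_digit_bounds)
  then show "schoenberg_curve c k \<le> 1" using sums_unique[OF half_power_Suc_sums] by simp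
qed

lemma continuous_on_schoenberg_curve: "continuous_on UNIV (\<lambda>c. schoenberg_curve c k)"
proof -
  have "uniform_limit UNIV (\<lambda>n c. \<Sum>j<n. (1/2) ^ Suc j * schoenberg_digit (prod_encode (k, j)) c)
      (\<lambda>c. schoenberg_curve c k) sequentially"
    unfolding schoenberg_curve_def
    by (rule Weierstrass_m_test[OF _ sums_summable[OF half_power_Suc_sums]])
      (simp add: schoenberg_digit_bounds abs_mult)
  then show ?thesis
    by (rule uniform_limit_theorem[rotated])
      (auto intro!: always_eventually continuous_intros simp: schoenberg_digit_def)
qed

definition schoenberg_code :: "(nat \<Rightarrow> real) \<Rightarrow> real" where
  "schoenberg_code x = cantor_code (\<lambda>m. binary_digit (x (fst (prod_decode m))) (snd (prod_decode m)))"

text \<open>The curve has a section over the half-open cube. The value 1 is excluded because all its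
  digits in the sense of \<open>binary_digit\<close> are 0.\<close>

lemma schoenberg_curve_code:
  assumes "\<And>i. 0 \<le> x i" "\<And>i. x i < 1"
  shows "schoenberg_curve (schoenberg_code x) = x"
proof
  fix k
  have "schoenberg_curve (schoenberg_code x) k = (\<Sum>j. (1/2) ^ Suc j * of_int (binary_digit (x k) j))"
    unfolding schoenberg_curve_def schoenberg_code_def
    by (subst schoenberg_digit_cantor_code) (auto simp: binary_digit_cases)
  then show "schoenberg_curve (schoenberg_code x) k = x k"
    using sums_unique[OF binary_digit_sums[of "x k"]] assms by simp
qed

text \<open>
  Composing with the Schoenberg curve
  and its section reduces the infinite-dimensional statement to Helly's theorem on the line.
\<close>

lemma skorohod_subsequence:
  fixes p :: "nat \<Rightarrow> (nat \<Rightarrow> real) pmf"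
  assumes p: "\<And>l x i. x \<in> set_pmf (p l) \<Longrightarrow> 0 \<le> x i \<and> x i < 1"
  obtains r :: "nat \<Rightarrow> nat" and \<Omega> :: "real measure" and Y :: "nat \<Rightarrow> real \<Rightarrow> nat \<Rightarrow> real"
    and Z :: "real \<Rightarrow> nat \<Rightarrow> real"
  where "strict_mono r" "prob_space \<Omega>" "\<And>l. Y l \<in> borel_measurable \<Omega>" "Z \<in> borel_measurable \<Omega>"
    "\<And>l g. (g :: (nat \<Rightarrow> real) \<Rightarrow> complex) \<in> borel_measurable borel \<Longrightarrow>
       (\<integral>w. g (Y l w) \<partial>\<Omega>) = measure_pmf.expectation (p (r l)) g"
    "\<And>w i. w \<in> space \<Omega> \<Longrightarrow> (\<lambda>l. Y l w i) \<longlonglongrightarrow> Z w i"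
    "\<And>w i. 0 \<le> Z w i \<and> Z w i \<le> 1"
proof -
  \<comment> \<open>Every function is measurable for a pmf, so the section may be discontinuous;
    continuity matters for the curve alone.\<close>
  define \<mu> where "\<mu> l = distr (measure_pmf (p l)) borel schoenberg_code" for l
  have curve [measurable]: "schoenberg_curve \<in> borel_measurable borel"
    by (intro measurable_coordinatewise_then_product borel_measurable_continuous_onI continuous_on_schoenberg_curve)
  have \<mu>: "real_distribution (\<mu> l)" for l
    unfolding \<mu>_def by (intro prob_space.real_distribution_distr prob_space_measure_pmf) simp
  have bnd: "0 \<le> schoenberg_code x" "schoenberg_code x \<le> 1" for x
    unfolding schoenberg_code_def by (auto intro!: cantor_code_bounds binary_digit_cases)
  have "tight \<mu>"
    unfolding tight_def
  proof (intro conjI allI impI \<mu>)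
    fix \<epsilon> :: real assume \<epsilon>: "\<epsilon> > 0"
    \<comment> \<open>Tightness is tested on intervals open at the left, so the left end has to lie
      strictly below 0.\<close>
    have "measure (\<mu> n) {-1<..1} = 1" for n
    proof -
      have "-1 < schoenberg_code x" for x using bnd(1)[of x] by linarith
      then have "schoenberg_code -` {-1<..1} = UNIV" using bnd by auto
      then show ?thesis unfolding \<mu>_def by (subst measure_distr) auto
    qed
    then show "\<exists>a b. a < b \<and> (\<forall>n. measure (\<mu> n) {a<..b} > 1 - \<epsilon>)"
      using \<epsilon> by (intro exI[of _ "-1"] exI[of _ 1]) auto
  qed
  then obtain r M where r: "strict_mono r" "real_distribution M" "weak_conv_m (\<mu> \<circ> (\<lambda>x. x) \<circ> r) M"
    using tight_imp_convergent_subsubsequence[of \<mu> "\<lambda>x. x"] by (auto simp: strict_mono_def)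
  have "\<And>n. real_distribution ((\<mu> \<circ> (\<lambda>x. x) \<circ> r) n)" using \<mu> by simp
  from Skorohod[OF this r(2,3)]
  obtain \<Omega> :: "real measure" and y z where \<Omega>: "prob_space \<Omega>" "\<And>n. y n \<in> borel_measurable \<Omega>"
    "\<And>n. distr \<Omega> borel (y n) = \<mu> (r n)"
    "\<And>w. w \<in> space \<Omega> \<Longrightarrow> (\<lambda>n. y n w) \<longlonglongrightarrow> z w" "z \<in> borel_measurable \<Omega>"
    by (elim exE conjE) (rule that, assumption, erule spec, simp, erule bspec, assumption, simp)
  note [measurable] = \<Omega>(2,5)
  show ?thesis
  proof (rule that[of r \<Omega> "\<lambda>l w. schoenberg_curve (y l w)" "\<lambda>w. schoenberg_curve (z w)"])
    fix l and g :: "(nat \<Rightarrow> real) \<Rightarrow> complex" assume [measurable]: "g \<in> borel_measurable borel"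
    have "(\<integral>w. g (schoenberg_curve (y l w)) \<partial>\<Omega>) = (\<integral>c. g (schoenberg_curve c) \<partial>distr \<Omega> borel (y l))"
      by (subst integral_distr) auto
    also have "\<dots> = (\<integral>x. g (schoenberg_curve (schoenberg_code x)) \<partial>measure_pmf (p (r l)))"
      unfolding \<Omega>(3) \<mu>_def by (subst integral_distr) auto
    \<comment> \<open>The support of \<open>p\<close> lies in the half-open cube, where the curve
      undoes its section.\<close>
    also have "\<dots> = measure_pmf.expectation (p (r l)) g"
      using p by (intro integral_cong_AE) (auto simp: AE_measure_pmf_iff schoenberg_curve_code)
    finally show "(\<integral>w. g (schoenberg_curve (y l w)) \<partial>\<Omega>) = measure_pmf.expectation (p (r l)) g" .
  next
    fix w i assume "w \<in> space \<Omega>"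
    then show "(\<lambda>l. schoenberg_curve (y l w) i) \<longlonglongrightarrow> schoenberg_curve (z w) i"
      using continuous_on_tendsto_compose[OF continuous_on_schoenberg_curve \<Omega>(4)] by simp
  qed (use r(1) \<Omega>(1) schoenberg_curve_bounds in \<open>auto\<close>)
qed

subsection \<open>Bochner's theorem for countably many directions\<close>

lemma abs_sin_ge_half:
  assumes "\<bar>u\<bar> \<le> pi / 2"
  shows "\<bar>u\<bar> / 2 \<le> \<bar>sin u\<bar>"
proof -
  have "\<bar>sin u - (\<Sum>m<3. sin_coeff m * u ^ m)\<bar> \<le> inverse (fact 3) * \<bar>u\<bar> ^ 3"
    by (rule Maclaurin_sin_bound)
  then have *: "\<bar>sin u - u\<bar> \<le> \<bar>u\<bar> ^ 3 / 6"
    by (simp add: numeral_3_eq_3 sin_coeff_def fact_numeral)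
  \<comment> \<open>1.6 exceeds \<open>pi / 2\<close>, and its square is below 3, so the cubic
    remainder costs at most half of \<open>|u|\<close>.\<close>
  have "\<bar>u\<bar> \<le> 1.6" using assms pi_less_4 pi_approx by (simp add: pi_approx)
  then have "\<bar>u\<bar> ^ 2 \<le> 1.6 ^ 2" by (intro power_mono) auto
  then have "\<bar>u\<bar> * \<bar>u\<bar> ^ 2 \<le> \<bar>u\<bar> * 3" by (intro mult_left_mono) (auto simp: power2_eq_square)
  then have "\<bar>u\<bar> ^ 3 / 6 \<le> \<bar>u\<bar> / 2" by (simp add: power3_eq_cube power2_eq_square)
  with * show ?thesis by linarith
qed

lemma norm_one_minus_cis_ge:
  assumes "\<bar>x\<bar> \<le> pi"
  shows "\<bar>x\<bar> / 2 \<le> norm (1 - cis x)"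
proof -
  have "norm (1 - cis x) = 2 * \<bar>sin (x / 2)\<bar>"
    using dist_exp_i_1[of x] by (simp add: cis_conv_exp norm_minus_commute)
  then show ?thesis using abs_sin_ge_half[of "x/2"] assms by simp
qed

text \<open>
  The left-hand side is a continuous substitute for the indicator of \<open>y\<close> being near the end
  points of the interval, that is of \<open>X\<close> being near infinity.
\<close>

lemma tail_function_le:
  fixes X :: real
  assumes a: "a = K / s" and K: "K > 0" and s: "s > 0" and x: "\<bar>x\<bar> \<le> pi" and X: "X = x * s"
  shows "max 0 (\<bar>sin (arctan X)\<bar> - 4 / a * \<bar>cos (arctan X)\<bar>) \<le> 1 - Re ((\<Sum>k<K. cis (real k * x)) / of_nat K)"
proof -
  let ?A = "(\<Sum>k<K. cis (real k * x)) / of_nat K"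
  have A1: "norm ?A \<le> 1"
    using K sum_norm_le[of "{..<K}" "\<lambda>k. cis (real k * x)" "\<lambda>_. 1"] by (simp add: norm_divide)
  \<comment> \<open>A geometric sum with numerator at most 2 and denominator at least
    \<open>|x| / 2\<close>; moreover \<open>a * X = K * x\<close>.\<close>
  have "norm ?A * (a * \<bar>X\<bar>) \<le> 4"
  proof (cases "cis x = 1")
    case True
    then have "x = 0" using norm_one_minus_cis_ge[OF x] by simp
    then show ?thesis by (simp add: X)
  next
    case False
    have "(1 - cis x) * (\<Sum>k<K. cis (real k * x)) = 1 - cis x ^ K"
      by (simp add: sum_gp_strict Complex.DeMoivre[symmetric] False)
    then have "norm (1 - cis x) * norm (\<Sum>k<K. cis (real k * x)) = norm (1 - cis x ^ K)"
      by (metis norm_mult)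
    also have "\<dots> \<le> 2" using norm_triangle_ineq4[of 1 "cis x ^ K"] by (simp add: norm_power)
    finally have 1: "norm (1 - cis x) * norm (\<Sum>k<K. cis (real k * x)) \<le> 2" .
    have "\<bar>x\<bar> / 2 * norm (\<Sum>k<K. cis (real k * x)) \<le> 2"
      by (rule order_trans[OF mult_right_mono[OF norm_one_minus_cis_ge[OF x]] 1]) simp
    then show ?thesis using K s by (simp add: X a norm_divide abs_mult mult.commute)
  qed
  moreover have a0: "a > 0" using a K s by simp
  ultimately have "norm ?A * \<bar>X\<bar> \<le> 4 / a" by (simp add: field_simps)
  then have "norm ?A * \<bar>X\<bar> * \<bar>cos (arctan X)\<bar> \<le> 4 / a * \<bar>cos (arctan X)\<bar>"
    by (rule mult_right_mono) simp
  \<comment> \<open>The sine is then split in the proportions \<open>1 - norm ?A\<close> and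
    \<open>norm ?A\<close>: the first part is at most \<open>1 - norm ?A\<close>, the second is
    absorbed by the cosine term.\<close>
  moreover have "\<bar>sin (arctan X)\<bar> = \<bar>X\<bar> * \<bar>cos (arctan X)\<bar>"
    by (simp add: sin_arctan cos_arctan abs_mult)
  ultimately have "norm ?A * \<bar>sin (arctan X)\<bar> \<le> 4 / a * \<bar>cos (arctan X)\<bar>" by (simp add: mult.assoc)
  moreover have "(1 - norm ?A) * \<bar>sin (arctan X)\<bar> \<le> (1 - norm ?A) * 1"
    using A1 by (intro mult_left_mono) auto
  ultimately have "\<bar>sin (arctan X)\<bar> - 4 / a * \<bar>cos (arctan X)\<bar> \<le> 1 - norm ?A" by (simp add: algebra_simps)
  then show ?thesis using complex_Re_le_cmod[of ?A] A1 by linarith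
qed

lemma (in prob_space) AE_not_in_of_prob_le:
  assumes A: "A \<in> sets M" and le: "\<And>e. e > 0 \<Longrightarrow> prob A \<le> e"
  shows "AE x in M. x \<notin> A"
proof -
  have "prob A \<le> 0" using le by (rule field_le_epsilon[of _ 0, simplified])
  then have "prob A = 0" using measure_nonneg[of M A] by linarith
  then show ?thesis using A by (simp add: prob_eq_0)
qed

text \<open>Fejer measures are taken for the vectors \<open>d i / 2 ^ l\<close>,
  \<open>i < l\<close>, with \<open>N = 4 ^ l\<close>. The mesh \<open>1 / 2 ^ l\<close> of
  admissible frequencies tends to 0 while their range \<open>2 ^ l\<close> grows, and the Fejer
  factors become \<open>1 - |t i| / 2 ^ l\<close>. After compactification by arctan a subsequence
  converges; continuity of \<open>f\<close> keeps the limit from charging the end points, which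
  correspond to infinity.\<close>

lemma bochner_process:
  fixes f :: "'h::real_normed_vector \<Rightarrow> complex" and d :: "nat \<Rightarrow> 'h"
  assumes pd: "positive_definite f" and f0: "f 0 = 1" and cont: "continuous_on UNIV f"
  obtains \<Omega> :: "real measure" and X :: "nat \<Rightarrow> real \<Rightarrow> real" where
    "prob_space \<Omega>" "\<And>i. X i \<in> borel_measurable \<Omega>"
    "\<And>n t. (\<integral>w. cis (\<Sum>i<n. t i * X i w) \<partial>\<Omega>) = f (\<Sum>i<n. t i *\<^sub>R d i)"
proof -
  define Q where "Q l p \<longleftrightarrow> finite (set_pmf p) \<and> (\<forall>x i. x \<in> set_pmf p \<longrightarrow> \<bar>x i\<bar> \<le> pi) \<and>
      (\<forall>m. (\<forall>i<l. \<bar>m i\<bar> < int (4 ^ l)) \<longrightarrow>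
        measure_pmf.expectation p (\<lambda>x. cis (\<Sum>i<l. of_int (m i) * x i)) =
          f (\<Sum>i<l. of_int (m i) *\<^sub>R ((1/2) ^ l *\<^sub>R d i)) * (\<Prod>i<l. 1 - \<bar>real_of_int (m i)\<bar> / (4 ^ l :: nat)))"
    for l :: nat and p :: "(nat \<Rightarrow> real) pmf"
  have "\<exists>p. Q l p" for l
    unfolding Q_def
    by (rule fejer_pmf[OF pd f0, of "4 ^ l" l "\<lambda>i. (1/2) ^ l *\<^sub>R d i"]) (simp, blast)
  then obtain p where "\<And>l. Q l (p l)" by metis
  note p = this[unfolded Q_def, THEN conjunct1] this[unfolded Q_def, THEN conjunct2, THEN conjunct1, rule_format]
    this[unfolded Q_def, THEN conjunct2, THEN conjunct2, rule_format]
  have char: "measure_pmf.expectation (p l) (\<lambda>x. cis (\<Sum>i<n. t i * (x i * 2 ^ l))) =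
      f (\<Sum>i<n. t i *\<^sub>R d i) * (\<Prod>i<n. 1 - \<bar>t i\<bar> / 2 ^ l)"
    if t: "\<And>i. i < n \<Longrightarrow> t i * 2 ^ b = of_int (k i)" "\<And>i. i < n \<Longrightarrow> \<bar>t i\<bar> < 2 ^ l"
      and bl: "b \<le> l" and nl: "n \<le> l" for l n b t and k :: "nat \<Rightarrow> int"
  proof -
    \<comment> \<open>A frequency with denominator \<open>2 ^ b\<close> is an integer multiple of
      the mesh as soon as \<open>b \<le> l\<close>; the remaining directions are padded by
      0.\<close>
    define m where "m i = (if i < n then k i * 2 ^ (l - b) else 0)" for i
    have m: "real_of_int (m i) = t i * 2 ^ l" if "i < n" for i
    proof -
      have "(2::real) ^ l = 2 ^ b * 2 ^ (l - b)" using bl by (simp flip: power_add)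
      then show ?thesis using t(1)[OF that] that by (simp add: m_def)
    qed
    have four: "(4::real) ^ l = 2 ^ l * 2 ^ l" by (simp flip: power_mult_distrib)
    have "\<bar>m i\<bar> < int (4 ^ l)" for i
    proof (cases "i < n")
      case True
      have "real_of_int \<bar>m i\<bar> < real_of_int (4 ^ l)"
        using t(2)[OF True] by (simp add: m[OF True] abs_mult four)
      then show ?thesis by (simp only: of_int_less_iff) simp
    qed (simp add: m_def)
    from p(3)[OF this] have *: "measure_pmf.expectation (p l) (\<lambda>x. cis (\<Sum>i<l. of_int (m i) * x i)) =
          f (\<Sum>i<l. of_int (m i) *\<^sub>R ((1/2) ^ l *\<^sub>R d i)) * (\<Prod>i<l. 1 - \<bar>real_of_int (m i)\<bar> / (4 ^ l :: nat))" .
    have sub: "{..<n} \<subseteq> {..<l}" using nl by auto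
    have "(\<Sum>i<l. of_int (m i) * x i) = (\<Sum>i<n. t i * (x i * 2 ^ l))" for x :: "nat \<Rightarrow> real"
      using sub by (intro sum.mono_neutral_cong_right) (auto simp: m, auto simp: m_def)
    moreover have "(\<Sum>i<l. of_int (m i) *\<^sub>R ((1/2) ^ l *\<^sub>R d i)) = (\<Sum>i<n. t i *\<^sub>R d i)"
      using sub by (intro sum.mono_neutral_cong_right) (auto simp: m power_divide, auto simp: m_def)
    moreover have "(\<Prod>i<l. 1 - \<bar>real_of_int (m i)\<bar> / (4 ^ l :: nat)) = (\<Prod>i<n. 1 - \<bar>t i\<bar> / 2 ^ l)"
      using sub by (intro prod.mono_neutral_cong_right) (auto simp: m four abs_mult, auto simp: m_def)
    ultimately show ?thesis using * by simp
  qed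

  \<comment> \<open>Values strictly inside the unit interval, as \<open>skorohod_subsequence\<close>
    asks; the angle \<open>pi * (y - 1/2)\<close> recovers the arctan.\<close>
  define y where "y l x = (\<lambda>i. 1/2 + arctan (x i * 2 ^ l) / pi)" for l and x :: "nat \<Rightarrow> real"
  have y_bounds: "0 < y l x i" "y l x i < 1" for l x i
  proof -
    have "- pi < 2 * arctan (x i * 2 ^ l)" "2 * arctan (x i * 2 ^ l) < pi"
      using arctan_lbound[of "x i * 2 ^ l"] arctan_ubound[of "x i * 2 ^ l"] by auto
    then show "0 < y l x i" "y l x i < 1" by (auto simp: y_def field_simps)
  qed
  have angle: "pi * (y l x i - 1/2) = arctan (x i * 2 ^ l)" for l x i by (simp add: y_def)
  have y01: "0 \<le> x i \<and> x i < 1" if "x \<in> set_pmf (map_pmf (y l) (p l))" for l x i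
    using that y_bounds by (auto simp: less_imp_le)
  obtain r \<Omega> Y Z where r: "strict_mono (r :: nat \<Rightarrow> nat)" and ps: "prob_space (\<Omega> :: real measure)"
    and meas [measurable]: "\<And>l. Y l \<in> borel_measurable \<Omega>" "Z \<in> borel_measurable \<Omega>"
    and law: "\<And>l g. (g :: (nat \<Rightarrow> real) \<Rightarrow> complex) \<in> borel_measurable borel \<Longrightarrow>
       (\<integral>w. g (Y l w) \<partial>\<Omega>) = measure_pmf.expectation (map_pmf (y (r l)) (p (r l))) g"
    and lim: "\<And>w i. w \<in> space \<Omega> \<Longrightarrow> (\<lambda>l. Y l w i) \<longlonglongrightarrow> Z w i"
    and Z01: "\<And>w i. 0 \<le> Z w i \<and> Z w i \<le> 1"
  proof (rule skorohod_subsequence[of "\<lambda>l. map_pmf (y l) (p l)"])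
    show "0 \<le> x i \<and> x i < 1" if "x \<in> set_pmf (map_pmf (y l) (p l))" for l x i
      using that by (rule y01)
  qed (rule that)
  interpret prob_space \<Omega> by fact
  have [measurable]: "(\<lambda>w. Y l w i) \<in> borel_measurable \<Omega>" "(\<lambda>w. Z w i) \<in> borel_measurable \<Omega>" for l i
    by (auto intro: measurable_product_then_coordinatewise)
  have coord: "(\<lambda>x. x i) \<in> borel_measurable (borel :: (nat \<Rightarrow> real) measure)" for i :: nat
    by (rule measurable_product_then_coordinatewise) simp
  have r_le: "l \<le> r l" for l using r by (rule seq_suble)
  have pow_r: "(\<lambda>l. c / 2 ^ r l) \<longlonglongrightarrow> 0" for c :: real
  proof -
    have "(\<lambda>l. c * (1/2) ^ l) \<longlonglongrightarrow> c * 0" by (intro tendsto_mult tendsto_const LIMSEQ_power_zero) simp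
    from LIMSEQ_subseq_LIMSEQ[OF this r] show ?thesis by (simp add: o_def power_divide)
  qed

  define U where "U l i w = tan (pi * (Y l w i - 1/2))" for l i w
  \<comment> \<open>Where \<open>Z\<close> takes the value 0 or 1 this tangent is meaningless;
    \<open>tight\<close> shows that those points form a null set.\<close>
  define X where "X i w = tan (pi * (Z w i - 1/2))" for i w
  have [measurable]: "U l i \<in> borel_measurable \<Omega>" "X i \<in> borel_measurable \<Omega>" for l i
    unfolding U_def X_def tan_def by measurable
  have charU: "(\<integral>w. cis (\<Sum>i<n. t i * U l i w) \<partial>\<Omega>) = f (\<Sum>i<n. t i *\<^sub>R d i) * (\<Prod>i<n. 1 - \<bar>t i\<bar> / 2 ^ r l)"
    if "\<And>i. i < n \<Longrightarrow> t i * 2 ^ b = of_int (k i)" "\<And>i. i < n \<Longrightarrow> \<bar>t i\<bar> < 2 ^ r l" "b \<le> r l" "n \<le> r l"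
    for l n b t and k :: "nat \<Rightarrow> int"
  proof -
    have "(\<lambda>x. cis (\<Sum>i<n. t i * tan (pi * (x i - 1/2)))) \<in> borel_measurable borel"
      using coord[measurable] unfolding tan_def cis_conv_exp by measurable
    from law[OF this, of l]
    have "(\<integral>w. cis (\<Sum>i<n. t i * U l i w) \<partial>\<Omega>) =
        measure_pmf.expectation (p (r l)) (\<lambda>x. cis (\<Sum>i<n. t i * (x i * 2 ^ r l)))"
      unfolding U_def integral_map_pmf angle tan_arctan .
    then show ?thesis using char[OF that] by simp
  qed

  \<comment> \<open>The function \<open>B\<close> below equals 1 at both end points. Its mean is
    bounded by the average of \<open>1 - Re (f (s *\<^sub>R d i))\<close> over grid points
    \<open>s\<close> in [0, a), where continuity at 0 makes this small.\<close>
  have tight: "AE w in \<Omega>. 0 < Z w i \<and> Z w i < 1" for i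
  proof -
    define bad where "bad = {w \<in> space \<Omega>. Z w i = 0 \<or> Z w i = 1}"
    have [measurable]: "bad \<in> sets \<Omega>" unfolding bad_def by measurable
    have "prob bad \<le> \<epsilon>" if \<epsilon>: "\<epsilon> > 0" for \<epsilon>
    proof -
      have "((\<lambda>s. f (s *\<^sub>R d i)) \<longlongrightarrow> f (0 *\<^sub>R d i)) (at_right 0)"
        using cont by (intro continuous_on_tendsto_compose[OF cont] tendsto_intros) auto
      then have "\<forall>\<^sub>F s in at_right 0. dist (f (s *\<^sub>R d i)) 1 < \<epsilon>"
        using \<epsilon> f0 by (auto simp: tendsto_iff)
      then obtain s0 :: real where s0: "s0 > 0" "\<And>s. 0 < s \<Longrightarrow> s < s0 \<Longrightarrow> dist (f (s *\<^sub>R d i)) 1 < \<epsilon>"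
        by (auto simp: eventually_at_right_field)
      obtain b where b: "(1/2) ^ b < s0" using real_arch_pow_inv[of s0 "1/2"] s0 by auto
      \<comment> \<open>For dyadic \<open>a\<close> the number \<open>K\<close> of grid points below
        \<open>a\<close> is exactly \<open>a * 2 ^ L\<close>.\<close>
      define a :: real where "a = (1/2) ^ b"
      have near: "norm (f (s *\<^sub>R d i) - 1) \<le> \<epsilon>" if "0 \<le> s" "s \<le> a" for s
        using s0(2)[of s] that b f0 \<epsilon> by (cases "s = 0") (auto simp: a_def dist_norm)
      define B where "B x = max 0 (\<bar>sin (pi * (x - 1/2))\<bar> - 4 / a * \<bar>cos (pi * (x - 1/2))\<bar>)" for x :: real
      have B_meas [measurable]: "B \<in> borel_measurable borel" unfolding B_def by measurable
      have a0: "a > 0" by (simp add: a_def)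
      have B01: "0 \<le> B x" "B x \<le> 1" for x
      proof -
        have "0 \<le> 4 / a * \<bar>cos (pi * (x - 1/2))\<bar>" using a0 by simp
        then show "0 \<le> B x" "B x \<le> 1" using abs_sin_le_one[of "pi * (x - 1/2)"] unfolding B_def by linarith+
      qed
      \<comment> \<open>The term \<open>2 / 2 ^ r l\<close> pays for the Fejer factor; the lower
        bound on \<open>l\<close> admits both the denominator of \<open>a\<close> and the direction
        \<open>d i\<close>.\<close>
      have EB: "expectation (\<lambda>w. B (Y l w i)) \<le> \<epsilon> + 2 / 2 ^ r l" if l: "l \<ge> Suc (max b i)" for l
      proof -
        define L where "L = r l"
        have L: "b \<le> L" "i < L" using r_le[of l] l by (auto simp: L_def)
        define K :: nat where "K = 2 ^ (L - b)"
        have "(2::real) ^ L = 2 ^ b * real K" using L by (simp add: K_def flip: power_add)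
        then have K: "K > 0" "a = K / 2 ^ L" by (auto simp: K_def a_def field_simps power_divide)
        have intp: "integrable (measure_pmf (p L)) g" for g :: "(nat \<Rightarrow> real) \<Rightarrow> real"
          by (rule integrable_measure_pmf_finite[OF p(1)])
        have intpc: "integrable (measure_pmf (p L)) g" for g :: "(nat \<Rightarrow> real) \<Rightarrow> complex"
          by (rule integrable_measure_pmf_finite[OF p(1)])
        from coord have mB: "(\<lambda>x::nat \<Rightarrow> real. complex_of_real (B (x i))) \<in> borel_measurable borel"
          by (rule measurable_compose[where g = "\<lambda>x. complex_of_real (B x)"]) measurable
        have "complex_of_real (expectation (\<lambda>w. B (Y l w i))) = (\<integral>w. complex_of_real (B (Y l w i)) \<partial>\<Omega>)"
          by simp
        also have "\<dots> = measure_pmf.expectation (map_pmf (y L) (p L)) (\<lambda>x. complex_of_real (B (x i)))"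
          unfolding L_def by (rule law[OF mB])
        also have "\<dots> = complex_of_real (measure_pmf.expectation (p L) (\<lambda>x. B (y L x i)))"
          by (simp add: integral_map_pmf)
        finally have "expectation (\<lambda>w. B (Y l w i)) = measure_pmf.expectation (p L) (\<lambda>x. B (y L x i))"
          by (simp only: of_real_eq_iff)
        also have "\<dots> \<le> measure_pmf.expectation (p L) (\<lambda>x. 1 - Re ((\<Sum>k<K. cis (real k * x i)) / of_nat K))"
          unfolding B_def angle
          by (intro integral_mono_AE intp AE_pmfI tail_function_le[OF K(2,1) _ p(2)]) auto
        also have "\<dots> = 1 - Re ((\<Sum>k<K. measure_pmf.expectation (p L) (\<lambda>x. cis (real k * x i))) / of_nat K)"
        proof -
          have "measure_pmf.expectation (p L) (\<lambda>x. 1 - Re ((\<Sum>k<K. cis (real k * x i)) / of_nat K)) =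
              1 - Re (measure_pmf.expectation (p L) (\<lambda>x. (\<Sum>k<K. cis (real k * x i)) / of_nat K))"
            by (subst Bochner_Integration.integral_diff[OF intp intp], subst integral_Re[OF intpc]) simp
          also have "measure_pmf.expectation (p L) (\<lambda>x. (\<Sum>k<K. cis (real k * x i)) / of_nat K) =
              (\<Sum>k<K. measure_pmf.expectation (p L) (\<lambda>x. cis (real k * x i))) / of_nat K"
            by (simp add: intpc Bochner_Integration.integral_sum)
          finally show ?thesis .
        qed
        also have "\<dots> \<le> \<epsilon> + 2 / 2 ^ L"
        proof -
          define c where "c k = measure_pmf.expectation (p L) (\<lambda>x. cis (real k * x i))" for k
          have "norm (c k - 1) \<le> \<epsilon> + 2 / 2 ^ L" if k: "k < K" for k
          proof -
            define s where "s = real k / 2 ^ L"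
            have s: "0 \<le> s" "s \<le> a" "s * 2 ^ L = k" using k K by (auto simp: s_def divide_right_mono)
            have a1: "a \<le> 1" by (simp add: a_def power_le_one)
            define t where "t j = (if j = i then s else 0)" for j
            have "measure_pmf.expectation (p L) (\<lambda>x. cis (\<Sum>j<Suc i. t j * (x j * 2 ^ L))) =
                f (\<Sum>j<Suc i. t j *\<^sub>R d j) * (\<Prod>j<Suc i. 1 - \<bar>t j\<bar> / 2 ^ L)"
            proof (rule char)
              show "t j * 2 ^ L = of_int (if j = i then int k else 0)" for j using s by (simp add: t_def)
              have "s < 2 ^ L" using s a1 L by (intro le_less_trans[of s 1]) auto
              then show "\<bar>t j\<bar> < 2 ^ L" for j using s by (simp add: t_def)
            qed (use L in auto)
            moreover have "(\<Sum>j<Suc i. t j * (x j * 2 ^ L)) = real k * x i" for x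
              using s(3) by (simp add: t_def mult_ac)
            moreover have "(\<Sum>j<Suc i. t j *\<^sub>R d j) = s *\<^sub>R d i" by (simp add: t_def)
            moreover have "(\<Prod>j<Suc i. 1 - \<bar>t j\<bar> / 2 ^ L) = 1 - s / 2 ^ L" using s by (simp add: t_def)
            ultimately have "c k = f (s *\<^sub>R d i) * of_real (1 - s / 2 ^ L)" by (simp only: c_def)
            then have "c k - 1 = (f (s *\<^sub>R d i) - 1) * of_real (1 - s / 2 ^ L) - of_real (s / 2 ^ L)"
              unfolding of_real_diff of_real_1 by (simp only: ring_distribs mult_1_left mult_1_right) (simp only: diff_diff_eq2 diff_add_eq add_diff_cancel algebra_simps)
            also have "norm \<dots> \<le> norm (f (s *\<^sub>R d i) - 1) * \<bar>1 - s / 2 ^ L\<bar> + \<bar>s / 2 ^ L\<bar>"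
              by (rule order_trans[OF norm_triangle_ineq4]) (simp add: norm_mult del: of_real_diff of_real_divide)
            also have "\<dots> \<le> \<epsilon> * 1 + 2 / 2 ^ L"
            proof (intro add_mono mult_mono near s)
              have "s / 2 ^ L \<le> 1" using s a1 by (simp add: divide_le_eq order_trans[of s 1])
              then show "\<bar>1 - s / 2 ^ L\<bar> \<le> 1" using s by simp
              show "\<bar>s / 2 ^ L\<bar> \<le> 2 / 2 ^ L" using s a1 by (simp add: divide_right_mono)
            qed (use \<epsilon> in auto)
            finally show ?thesis by simp
          qed
          then have "norm (\<Sum>k<K. c k - 1) \<le> K * (\<epsilon> + 2 / 2 ^ L)"
            using sum_norm_le[of "{..<K}" "\<lambda>k. c k - 1" "\<lambda>_. \<epsilon> + 2 / 2 ^ L"] by simp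
          moreover have "(\<Sum>k<K. c k - 1) = of_nat K * ((\<Sum>k<K. c k) / of_nat K - 1)"
            using K by (simp add: sum_subtractf field_simps)
          ultimately have "norm ((\<Sum>k<K. c k) / of_nat K - 1) \<le> \<epsilon> + 2 / 2 ^ L"
            using K by (simp add: norm_mult)
          then show ?thesis
            using abs_Re_le_cmod[of "(\<Sum>k<K. c k) / of_nat K - 1"] unfolding c_def by simp
        qed
        finally show ?thesis by (simp add: L_def)
      qed
      \<comment> \<open>On \<open>bad\<close> the values \<open>B (Y l w i)\<close> tend to 1, so
        after multiplication by the indicator the limit is \<open>prob bad\<close>.\<close>
      have "(\<lambda>l. expectation (\<lambda>w. indicator bad w * B (Y l w i))) \<longlonglongrightarrow> expectation (indicator bad :: real \<Rightarrow> real)"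
      proof (rule integral_dominated_convergence[where w = "\<lambda>_. 1"])
        show "AE w in \<Omega>. (\<lambda>l. indicator bad w * B (Y l w i)) \<longlonglongrightarrow> indicator bad w"
        proof (rule AE_I2)
          fix w assume w: "w \<in> space \<Omega>"
          show "(\<lambda>l. indicator bad w * B (Y l w i)) \<longlonglongrightarrow> indicator bad w"
          proof (cases "w \<in> bad")
            case True
            have "(\<lambda>l. B (Y l w i)) \<longlonglongrightarrow> B (Z w i)"
              unfolding B_def by (intro tendsto_intros lim[OF w])
            moreover have "B (Z w i) = 1" using True
              by (auto simp: bad_def B_def)
            ultimately show ?thesis using True by simp
          qed simp
        qed
        show "AE w in \<Omega>. norm (indicator bad w * B (Y l w i)) \<le> 1" for l
          by (rule AE_I2) (use B01 in \<open>auto simp: indicator_def\<close>)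
      qed auto
      then have 1: "(\<lambda>l. expectation (\<lambda>w. indicator bad w * B (Y l w i))) \<longlonglongrightarrow> prob bad" by simp
      have 2: "(\<lambda>l. \<epsilon> + 2 / 2 ^ r l) \<longlonglongrightarrow> \<epsilon> + 0" by (intro tendsto_add tendsto_const pow_r)
      have "\<exists>N. \<forall>l\<ge>N. expectation (\<lambda>w. indicator bad w * B (Y l w i)) \<le> \<epsilon> + 2 / 2 ^ r l"
      proof (intro exI allI impI)
        fix l assume l: "l \<ge> Suc (max b i)"
        have "expectation (\<lambda>w. indicator bad w * B (Y l w i)) \<le> expectation (\<lambda>w. B (Y l w i))"
          by (intro integral_mono integrable_const_bound[where B = 1])
            (use B01 in \<open>auto simp: indicator_def\<close>)
        with EB[OF l] show "expectation (\<lambda>w. indicator bad w * B (Y l w i)) \<le> \<epsilon> + 2 / 2 ^ r l" by simp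
      qed
      from LIMSEQ_le[OF 1 2 this] show ?thesis by simp
    qed
    then have "AE w in \<Omega>. w \<notin> bad" by (intro AE_not_in_of_prob_le) auto
    then show ?thesis using AE_space by eventually_elim (use Z01 in \<open>auto simp: bad_def less_le\<close>)
  qed

  have limU: "AE w in \<Omega>. \<forall>i. (\<lambda>l. U l i w) \<longlonglongrightarrow> X i w"
    unfolding AE_all_countable
  proof
    fix i
    show "AE w in \<Omega>. (\<lambda>l. U l i w) \<longlonglongrightarrow> X i w"
      using tight[of i] AE_space
    proof eventually_elim
      case (elim w)
      then have c: "cos (pi * (Z w i - 1/2)) > 0" by (intro cos_gt_zero_pi) (auto simp: field_simps)
      show ?case unfolding U_def X_def
        by (intro isCont_tendsto_compose[OF isCont_tan] tendsto_mult tendsto_diff tendsto_const lim elim) (use c in simp)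
    qed
  qed
  \<comment> \<open>For dyadic \<open>t\<close> the transforms along the subsequence are known for
    all large \<open>l\<close>. Other \<open>t\<close> follow by dyadic approximation on both
    sides.\<close>
  have dyadic: "(\<integral>w. cis (\<Sum>i<n. t i * X i w) \<partial>\<Omega>) = f (\<Sum>i<n. t i *\<^sub>R d i)"
    if t: "\<And>i. i < n \<Longrightarrow> t i * 2 ^ b = of_int (k i)" for t n b and k :: "nat \<Rightarrow> int"
  proof (rule LIMSEQ_unique)
    show "(\<lambda>l. \<integral>w. cis (\<Sum>i<n. t i * U l i w) \<partial>\<Omega>) \<longlonglongrightarrow> (\<integral>w. cis (\<Sum>i<n. t i * X i w) \<partial>\<Omega>)"
    proof (rule integral_dominated_convergence[where w = "\<lambda>_. 1"])
      show "AE w in \<Omega>. (\<lambda>l. cis (\<Sum>i<n. t i * U l i w)) \<longlonglongrightarrow> cis (\<Sum>i<n. t i * X i w)"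
        using limU by eventually_elim (auto simp: cis_conv_exp intro!: tendsto_intros)
    qed (auto simp: cis_conv_exp)
    have "(\<lambda>l. f (\<Sum>i<n. t i *\<^sub>R d i) * of_real (\<Prod>i<n. 1 - \<bar>t i\<bar> / 2 ^ r l)) \<longlonglongrightarrow>
        f (\<Sum>i<n. t i *\<^sub>R d i) * of_real (\<Prod>i<n. 1 - 0)"
      by (intro tendsto_intros pow_r)
    moreover have "\<forall>\<^sub>F l in sequentially. f (\<Sum>i<n. t i *\<^sub>R d i) * of_real (\<Prod>i<n. 1 - \<bar>t i\<bar> / 2 ^ r l) =
        (\<integral>w. cis (\<Sum>i<n. t i * U l i w) \<partial>\<Omega>)"
    proof -
      have "\<forall>\<^sub>F l in sequentially. \<forall>i\<in>{..<n}. \<bar>t i\<bar> / 2 ^ r l < 1"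
        by (intro eventually_ball_finite ballI order_tendstoD(2)[OF pow_r]) auto
      then show ?thesis using eventually_ge_at_top[of "max b n"]
      proof eventually_elim
        case (elim l)
        then have "b \<le> r l" "n \<le> r l" using r_le[of l] by auto
        then show ?case using elim charU[OF t, where n1 = n and l1 = l] by (simp add: field_simps)
      qed
    qed
    ultimately show "(\<lambda>l. \<integral>w. cis (\<Sum>i<n. t i * U l i w) \<partial>\<Omega>) \<longlonglongrightarrow> f (\<Sum>i<n. t i *\<^sub>R d i)"
      by (simp add: Lim_transform_eventually)
  qed
  show ?thesis
  proof (rule that[of \<Omega> X])
    fix n and t :: "nat \<Rightarrow> real"
    define s where "s b i = of_int \<lfloor>2 ^ b * t i\<rfloor> / (2 ^ b :: real)" for b i
    have s: "(\<lambda>b. s b i) \<longlonglongrightarrow> t i" for i unfolding s_def by (rule dyadic_approximation)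
    show "(\<integral>w. cis (\<Sum>i<n. t i * X i w) \<partial>\<Omega>) = f (\<Sum>i<n. t i *\<^sub>R d i)"
    proof (rule LIMSEQ_unique)
      show "(\<lambda>b. \<integral>w. cis (\<Sum>i<n. s b i * X i w) \<partial>\<Omega>) \<longlonglongrightarrow> (\<integral>w. cis (\<Sum>i<n. t i * X i w) \<partial>\<Omega>)"
        by (rule integral_dominated_convergence[where w = "\<lambda>_. 1"])
          (auto simp: cis_conv_exp intro!: tendsto_intros s)
      have "(\<integral>w. cis (\<Sum>i<n. s b i * X i w) \<partial>\<Omega>) = f (\<Sum>i<n. s b i *\<^sub>R d i)" for b
      proof (rule dyadic)
        show "s b i * 2 ^ b = of_int \<lfloor>2 ^ b * t i\<rfloor>" for i by (simp add: s_def)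
      qed
      moreover have "(\<lambda>b. f (\<Sum>i<n. s b i *\<^sub>R d i)) \<longlonglongrightarrow> f (\<Sum>i<n. t i *\<^sub>R d i)"
        by (intro continuous_on_tendsto_compose[OF cont] tendsto_intros s) auto
      ultimately show "(\<lambda>b. \<integral>w. cis (\<Sum>i<n. s b i * X i w) \<partial>\<Omega>) \<longlonglongrightarrow> f (\<Sum>i<n. t i *\<^sub>R d i)" by simp
    qed
  qed (use ps in auto)
qed

subsection \<open>Products of cosines and Gaussian averages\<close>

text \<open>The central limit theorem for random signs. With \<open>n = Suc m\<close> the power is
  compared with that of \<open>1 - y^2 / (2 * n)\<close> through
  \<open>|a ^ n - b ^ n| \<le> n * |a - b|\<close> for bases in [-1, 1]; the Taylor remainder of
  order four leaves an error of order \<open>1 / n\<close>.\<close>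

lemma tendsto_cos_power_exp:
  fixes y :: real
  shows "(\<lambda>m. cos (y / sqrt (real (Suc m))) ^ Suc m) \<longlonglongrightarrow> exp (- (y\<^sup>2) / 2)"
proof -
  define a where "a m = 1 + (- (y\<^sup>2) / 2) / real (Suc m)" for m
  have "(\<lambda>m. (1 + (- (y\<^sup>2) / 2) / real m) ^ m) \<longlonglongrightarrow> exp (- (y\<^sup>2) / 2)"
    by (rule tendsto_exp_limit_sequentially)
  from LIMSEQ_Suc[OF this] have 1: "(\<lambda>m. a m ^ Suc m) \<longlonglongrightarrow> exp (- (y\<^sup>2) / 2)"
    by (simp add: a_def)
  have "(\<lambda>m. cos (y / sqrt (real (Suc m))) ^ Suc m - a m ^ Suc m) \<longlonglongrightarrow> 0"
  proof (rule Lim_null_comparison)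
    have "(\<lambda>m. y ^ 4 / 24 * inverse (real (Suc m))) \<longlonglongrightarrow> y ^ 4 / 24 * 0"
      by (intro tendsto_mult tendsto_const LIMSEQ_inverse_real_of_nat)
    then show "(\<lambda>m. y ^ 4 / 24 * inverse (real (Suc m))) \<longlonglongrightarrow> 0" by simp
    have "\<forall>\<^sub>F m in sequentially. y\<^sup>2 / 2 \<le> real (Suc m)"
      by (rule filterlim_sequentially_Suc[THEN iffD2, THEN filterlim_at_top[THEN iffD1, rule_format]])
        (rule filterlim_real_sequentially)
    then show "\<forall>\<^sub>F m in sequentially. norm (cos (y / sqrt (real (Suc m))) ^ Suc m - a m ^ Suc m) \<le> y ^ 4 / 24 * inverse (real (Suc m))"
    proof eventually_elim
      case (elim m)
      let ?z = "y / sqrt (real (Suc m))"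
      have z2: "?z\<^sup>2 = y\<^sup>2 / real (Suc m)" by (simp add: power_divide)
      have z4: "?z ^ 4 = y ^ 4 / (real (Suc m))\<^sup>2"
      proof -
        have "?z ^ 4 = (?z\<^sup>2)\<^sup>2" by (simp only: power4_eq_xxxx power2_eq_square mult.assoc)
        also have "\<dots> = y ^ 4 / (real (Suc m))\<^sup>2"
          unfolding z2 by (simp only: power4_eq_xxxx power2_eq_square times_divide_times_eq mult.assoc)
        finally show ?thesis .
      qed
      have a: "a m = 1 - ?z\<^sup>2 / 2" unfolding z2 a_def by simp
      \<comment> \<open>The lower bound on \<open>m\<close> was chosen for this: the power estimate
        asks for both bases in [-1, 1].\<close>
      have "\<bar>a m\<bar> \<le> 1"
      proof -
        have "y\<^sup>2 / real (Suc m) \<le> 2" using elim by (simp add: divide_le_eq)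
        moreover have "0 \<le> y\<^sup>2 / real (Suc m)" by simp
        moreover have "\<bar>1 - t / 2\<bar> \<le> 1" if "t \<le> 2" "0 \<le> t" for t :: real using that by linarith
        ultimately show ?thesis unfolding a z2 by blast
      qed
      then have "norm (cos ?z ^ Suc m - a m ^ Suc m) \<le> real (Suc m) * norm (cos ?z - a m)"
        by (intro norm_power_diff) auto
      also have "norm (cos ?z - a m) \<le> ?z ^ 4 / 24"
      proof -
        obtain t where t: "cos ?z = (\<Sum>m<4. cos_coeff m * ?z ^ m) + cos (t + 1/2 * real 4 * pi) / fact 4 * ?z ^ 4"
          using Maclaurin_cos_expansion[of ?z 4] by blast
        have "(\<Sum>m<4. cos_coeff m * x ^ m) = 1 - x\<^sup>2 / 2" for x :: real
          by (simp add: cos_coeff_def lessThan_nat_numeral fact_numeral)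
        then have "(\<Sum>m<4. cos_coeff m * ?z ^ m) = a m" unfolding a .
        then have "norm (cos ?z - a m) = \<bar>cos (t + 1/2 * real 4 * pi)\<bar> * (?z ^ 4 / 24)"
          by (simp only: t) (simp add: abs_mult fact_numeral power_even_abs)
        also have "\<dots> \<le> 1 * (?z ^ 4 / 24)"
          by (intro mult_right_mono abs_cos_le_one) simp
        finally show ?thesis by simp
      qed
      also have "real (Suc m) * (?z ^ 4 / 24) = y ^ 4 / 24 * inverse (real (Suc m))"
      proof -
        have "n * (b / n\<^sup>2 / 24) = b / 24 * inverse n" if "n \<noteq> 0" for n b :: real
          using that by (simp add: power2_eq_square field_simps)
        then show ?thesis unfolding z4 by (simp del: of_nat_Suc)
      qed
      finally show ?case by simp
    qed
  qed
  from tendsto_add[OF this 1] show ?thesis by simp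
qed

text \<open>The error is quadratic in the norm because squares are what the parallelogram law
  preserves. Outside the ball of radius \<open>r\<close> the constant \<open>K = 2 / r^2\<close>
  makes it at least 2, the largest possible oscillation of \<open>Re f\<close>.\<close>

lemma Re_ge_of_continuous_0:
  fixes f :: "'h::real_normed_vector \<Rightarrow> complex"
  assumes "continuous_on UNIV f" "f 0 = 1" "\<epsilon> > 0"
  obtains K where "K \<ge> 0" "\<And>\<eta>. norm (f \<eta>) \<le> 1 \<Longrightarrow> 1 - \<epsilon> - K * (norm \<eta>)\<^sup>2 \<le> Re (f \<eta>)"
proof -
  have "isCont f 0" using assms(1) by (simp add: continuous_on_eq_continuous_at)
  then obtain r where r: "r > 0" "\<And>\<eta>. norm \<eta> < r \<Longrightarrow> dist (f \<eta>) 1 < \<epsilon>"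
    using assms(2,3) unfolding continuous_at_eps_delta by (auto simp: dist_norm)
  show ?thesis
  proof (rule that[of "2 / r\<^sup>2"])
    fix \<eta> :: 'h assume f: "norm (f \<eta>) \<le> 1"
    show "1 - \<epsilon> - 2 / r\<^sup>2 * (norm \<eta>)\<^sup>2 \<le> Re (f \<eta>)"
    proof (cases "norm \<eta> < r")
      case True
      have "\<bar>Re (f \<eta> - 1)\<bar> < \<epsilon>"
        using abs_Re_le_cmod[of "f \<eta> - 1"] r(2)[OF True] by (simp add: dist_norm)
      moreover have "0 \<le> 2 / r\<^sup>2 * (norm \<eta>)\<^sup>2" by simp
      ultimately show ?thesis unfolding minus_complex.sel one_complex.sel by linarith
    next
      case False
      then have "r\<^sup>2 \<le> (norm \<eta>)\<^sup>2" using r by (intro power_mono) auto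
      then have "2 \<le> 2 / r\<^sup>2 * (norm \<eta>)\<^sup>2" using r by (simp add: field_simps)
      moreover have "-1 \<le> Re (f \<eta>)" using abs_Re_le_cmod[of "f \<eta>"] f by linarith
      ultimately show ?thesis using assms(3) by linarith
    qed
  qed (use r in auto)
qed

text \<open>A linear relation rather than a linear map, since the estimates are applied twice: to
  finite combinations of a countable family, where one vector may carry several random variables,
  and to the completed process, where additivity holds only almost everywhere.\<close>

locale char_relation = prob_space M for M :: "'a measure" +
  fixes f :: "'h::real_inner \<Rightarrow> complex" and R :: "('h \<times> ('a \<Rightarrow> real)) set"
  assumes R_measurable: "(\<eta>, Y) \<in> R \<Longrightarrow> Y \<in> borel_measurable M"
    and R_char: "(\<eta>, Y) \<in> R \<Longrightarrow> (\<integral>x. cis (Y x) \<partial>M) = f \<eta>"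
    and R_add: "(\<eta>, Y) \<in> R \<Longrightarrow> (\<zeta>, Z) \<in> R \<Longrightarrow> (\<eta> + \<zeta>, \<lambda>x. Y x + Z x) \<in> R"
    and R_scale: "(\<eta>, Y) \<in> R \<Longrightarrow> (c *\<^sub>R \<eta>, \<lambda>x. c * Y x) \<in> R"
    and R_nonempty: "R \<noteq> {}"
    and f_cont: "continuous_on UNIV f" and f_0: "f 0 = 1"
begin

lemma R_norm_le_1: "(\<eta>, Y) \<in> R \<Longrightarrow> norm (f \<eta>) \<le> 1"
proof -
  assume R: "(\<eta>, Y) \<in> R"
  have [measurable]: "Y \<in> borel_measurable M" by (rule R_measurable[OF R])
  have "norm (\<integral>x. cis (Y x) \<partial>M) \<le> (\<integral>x. norm (cis (Y x)) \<partial>M)" by (rule integral_norm_bound)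
  also have "\<dots> = 1" by (simp add: prob_space)
  finally show ?thesis by (simp add: R_char[OF R])
qed

lemma R_expectation_cos:
  assumes R: "(\<eta>, Y) \<in> R" shows "expectation (\<lambda>x. cos (Y x)) = Re (f \<eta>)"
proof -
  have [measurable]: "Y \<in> borel_measurable M" by (rule R_measurable[OF R])
  have "integrable M (\<lambda>x. cis (Y x))"
    by (rule integrable_const_bound[where B = 1]) (auto simp: cis_conv_exp)
  then have "expectation (\<lambda>x. Re (cis (Y x))) = Re (\<integral>x. cis (Y x) \<partial>M)" by (rule integral_Re)
  then show ?thesis by (simp add: R_char[OF R])
qed

lemma R_prod_list_measurable:
  "set ps \<subseteq> R \<Longrightarrow> (\<lambda>x. \<Prod>p\<leftarrow>ps. cos (snd p x)) \<in> borel_measurable M"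
proof (induction ps)
  case (Cons p ps)
  then have [measurable]: "snd p \<in> borel_measurable M" "(\<lambda>x. \<Prod>p\<leftarrow>ps. cos (snd p x)) \<in> borel_measurable M"
    using R_measurable[of "fst p" "snd p"] by auto
  show ?case by simp
qed simp

lemma abs_prod_list_cos_le: "\<bar>\<Prod>p\<leftarrow>ps. cos (snd p x)\<bar> \<le> (1::real)"
proof (induction ps)
  case (Cons p ps)
  have "\<bar>cos (snd p x) * (\<Prod>p\<leftarrow>ps. cos (snd p x))\<bar> \<le> 1 * 1"
    unfolding abs_mult by (intro mult_mono Cons) auto
  then show ?case by simp
qed simp

text \<open>
  Averaging over signs replaces Gaussian randomisation: by the parallelogram law the sum of squared
  norms is preserved when a product of two cosines is turned into a sum.
\<close>

lemma expectation_cos_prod_ge: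
  assumes bound: "\<And>\<eta>. norm (f \<eta>) \<le> 1 \<Longrightarrow> 1 - \<epsilon> - K * (norm \<eta>)\<^sup>2 \<le> Re (f \<eta>)"
  assumes "set ps \<subseteq> R" "(\<eta>, Y) \<in> R"
  shows "1 - \<epsilon> - K * ((norm \<eta>)\<^sup>2 + (\<Sum>p\<leftarrow>ps. (norm (fst p))\<^sup>2)) \<le>
    expectation (\<lambda>x. cos (Y x) * (\<Prod>p\<leftarrow>ps. cos (snd p x)))"
  using assms(2,3)
proof (induction ps arbitrary: \<eta> Y)
  case Nil
  then show ?case using bound[OF R_norm_le_1[of \<eta> Y]] R_expectation_cos[of \<eta> Y] by simp
next
  case (Cons p ps)
  obtain \<zeta> Z where p: "p = (\<zeta>, Z)" by (cases p)
  have R: "(\<zeta>, Z) \<in> R" "(\<eta>, Y) \<in> R" "set ps \<subseteq> R" using Cons.prems p by auto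
  define P where "P x = (\<Prod>p\<leftarrow>ps. cos (snd p x))" for x
  have [measurable]: "Y \<in> borel_measurable M" "Z \<in> borel_measurable M" "P \<in> borel_measurable M"
    using R R_measurable R_prod_list_measurable unfolding P_def by blast+
  have P1: "\<bar>P x\<bar> \<le> 1" for x unfolding P_def by (rule abs_prod_list_cos_le)
  have int: "integrable M (\<lambda>x. cos (g x) * P x)" if [measurable]: "g \<in> borel_measurable M" for g
    by (rule integrable_const_bound[where B = 1])
      (auto simp: abs_mult intro!: AE_I2 mult_le_one P1)
  have plus: "(\<eta> + \<zeta>, \<lambda>x. Y x + Z x) \<in> R" using R by (intro R_add)
  have "(\<eta> + (-1) *\<^sub>R \<zeta>, \<lambda>x. Y x + (-1) * Z x) \<in> R" using R by (intro R_add R_scale)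
  then have minus: "(\<eta> - \<zeta>, \<lambda>x. Y x - Z x) \<in> R" by simp
  let ?S = "\<Sum>p\<leftarrow>ps. (norm (fst p))\<^sup>2"
  have "1 - \<epsilon> - K * ((norm (\<eta> + \<zeta>))\<^sup>2 + ?S) \<le> expectation (\<lambda>x. cos (Y x + Z x) * P x)"
    unfolding P_def by (rule Cons.IH[OF R(3) plus])
  moreover have "1 - \<epsilon> - K * ((norm (\<eta> - \<zeta>))\<^sup>2 + ?S) \<le> expectation (\<lambda>x. cos (Y x - Z x) * P x)"
    unfolding P_def by (rule Cons.IH[OF R(3) minus])
  moreover have par: "(norm (\<eta> + \<zeta>))\<^sup>2 + (norm (\<eta> - \<zeta>))\<^sup>2 = 2 * (norm \<eta>)\<^sup>2 + 2 * (norm \<zeta>)\<^sup>2"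
    by (simp add: power2_norm_eq_inner inner_simps inner_commute)
  moreover have "K * (norm (\<eta> + \<zeta>))\<^sup>2 + K * (norm (\<eta> - \<zeta>))\<^sup>2 = 2 * (K * (norm \<eta>)\<^sup>2) + 2 * (K * (norm \<zeta>)\<^sup>2)"
    using arg_cong[OF par, of "\<lambda>x. K * x"] by (simp only: distrib_left mult.left_commute[of K 2])
  moreover have "2 * expectation (\<lambda>x. cos (Y x) * (cos (Z x) * P x)) =
      expectation (\<lambda>x. cos (Y x + Z x) * P x) + expectation (\<lambda>x. cos (Y x - Z x) * P x)"
  proof -
    have "expectation (\<lambda>x. cos (Y x) * (cos (Z x) * P x)) =
        expectation (\<lambda>x. (cos (Y x + Z x) * P x + cos (Y x - Z x) * P x) / 2)"
      by (intro Bochner_Integration.integral_cong refl) (simp add: cos_add cos_diff algebra_simps)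
    also have "\<dots> = (expectation (\<lambda>x. cos (Y x + Z x) * P x) + expectation (\<lambda>x. cos (Y x - Z x) * P x)) / 2"
      by (simp add: int)
    finally show ?thesis by simp
  qed
  ultimately have "1 - \<epsilon> - K * ((norm \<eta>)\<^sup>2 + ((norm \<zeta>)\<^sup>2 + ?S)) \<le> expectation (\<lambda>x. cos (Y x) * (cos (Z x) * P x))"
    unfolding distrib_left by linarith
  then show ?case by (simp add: p P_def)
qed

text \<open>Replace each vector by \<open>m + 1\<close> copies scaled by
  \<open>1 / sqrt (m + 1)\<close>: the sum of squared norms stays the same, while the product of the
  cosines tends to the Gaussian.\<close>

lemma expectation_exp_ge:
  assumes bound: "\<And>\<eta>. norm (f \<eta>) \<le> 1 \<Longrightarrow> 1 - \<epsilon> - K * (norm \<eta>)\<^sup>2 \<le> Re (f \<eta>)"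
  assumes ps: "set ps \<subseteq> R"
  shows "1 - \<epsilon> - K * (\<Sum>p\<leftarrow>ps. (norm (fst p))\<^sup>2) \<le> expectation (\<lambda>x. exp (- (\<Sum>p\<leftarrow>ps. (snd p x)\<^sup>2) / 2))"
proof -
  obtain \<eta>0 Y0 where "(\<eta>0, Y0) \<in> R" using R_nonempty by auto
  \<comment> \<open>The product estimate singles out one pair; the zero pair contributes the factor
    \<open>cos 0 = 1\<close> and no norm.\<close>
  from R_scale[OF this, of 0] have R0: "(0, \<lambda>_. 0) \<in> R" by simp
  define c where "c m = 1 / sqrt (real (Suc m))" for m
  define qs where "qs m = concat (map (\<lambda>p. replicate (Suc m) (c m *\<^sub>R fst p, \<lambda>x. c m * snd p x)) ps)" for m
  have qs: "set (qs m) \<subseteq> R" for m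
    using ps R_scale by (fastforce simp: qs_def)
  have norms: "(\<Sum>p\<leftarrow>qs m. (norm (fst p))\<^sup>2) = (\<Sum>p\<leftarrow>ps. (norm (fst p))\<^sup>2)" for m
  proof -
    have "a / (1 + real m) + real m * a / (1 + real m) = a" for a :: real
      unfolding add_divide_distrib[symmetric] using nonzero_mult_div_cancel_left[of "1 + real m" a]
      by (simp add: distrib_right)
    then show ?thesis unfolding qs_def
      by (induction ps) (auto simp: sum_list_replicate c_def power_mult_distrib power_divide)
  qed
  have prods: "(\<Prod>p\<leftarrow>qs m. cos (snd p x)) = (\<Prod>p\<leftarrow>ps. cos (snd p x / sqrt (real (Suc m))) ^ Suc m)" for m x
    unfolding qs_def by (induction ps) (auto simp: prod_list_replicate c_def)
  have "(\<lambda>m. expectation (\<lambda>x. \<Prod>p\<leftarrow>qs m. cos (snd p x))) \<longlonglongrightarrow>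
      expectation (\<lambda>x. exp (- (\<Sum>p\<leftarrow>ps. (snd p x)\<^sup>2) / 2))"
  proof (rule integral_dominated_convergence[where w = "\<lambda>_. 1"])
    show meas: "(\<lambda>x. \<Prod>p\<leftarrow>qs m. cos (snd p x)) \<in> borel_measurable M" for m
      by (rule R_prod_list_measurable[OF qs])
    have lim: "(\<lambda>m. \<Prod>p\<leftarrow>qs m. cos (snd p x)) \<longlonglongrightarrow> exp (- (\<Sum>p\<leftarrow>ps. (snd p x)\<^sup>2) / 2)" for x
      unfolding prods
    proof (induction ps)
      case (Cons p ps)
      from tendsto_mult[OF tendsto_cos_power_exp[of "snd p x"] Cons.IH]
      show ?case by (simp add: exp_add[symmetric] diff_divide_distrib)
    qed simp
    then show "AE x in M. (\<lambda>m. \<Prod>p\<leftarrow>qs m. cos (snd p x)) \<longlonglongrightarrow> exp (- (\<Sum>p\<leftarrow>ps. (snd p x)\<^sup>2) / 2)"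
      by simp
    show "(\<lambda>x. exp (- (\<Sum>p\<leftarrow>ps. (snd p x)\<^sup>2) / 2)) \<in> borel_measurable M"
      by (rule borel_measurable_LIMSEQ_real[OF lim meas])
    show "AE x in M. norm (\<Prod>p\<leftarrow>qs m. cos (snd p x)) \<le> 1" for m
      unfolding real_norm_def by (rule AE_I2) (rule abs_prod_list_cos_le)
  qed simp
  moreover have "1 - \<epsilon> - K * (\<Sum>p\<leftarrow>ps. (norm (fst p))\<^sup>2) \<le> expectation (\<lambda>x. \<Prod>p\<leftarrow>qs m. cos (snd p x))" for m
    using expectation_cos_prod_ge[OF bound qs R0, of m] by (simp add: norms)
  ultimately show ?thesis by (intro LIMSEQ_le_const) auto
qed

text \<open>Continuity in probability at 0, with a modulus that depends on the vector alone and not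
  on the random variable attached to it. It is a Chebyshev inequality with
  \<open>1 - exp (- (c * Y)^2 / 2)\<close> in place of the square, which need not be
  integrable.\<close>

lemma R_prob_small:
  assumes "\<kappa> > 0" "\<epsilon> > 0"
  obtains \<delta> where "\<delta> > 0" "\<And>\<eta> Y. (\<eta>, Y) \<in> R \<Longrightarrow> norm \<eta> < \<delta> \<Longrightarrow> \<P>(x in M. \<kappa> \<le> \<bar>Y x\<bar>) \<le> \<epsilon>"
proof -
  obtain K where K: "K \<ge> 0" "\<And>\<eta>. norm (f \<eta>) \<le> 1 \<Longrightarrow> 1 - \<epsilon> / 4 - K * (norm \<eta>)\<^sup>2 \<le> Re (f \<eta>)"
    using Re_ge_of_continuous_0[OF f_cont f_0, of "\<epsilon> / 4"] assms by auto
  \<comment> \<open>With this \<open>c\<close>, \<open>|Y| \<ge> \<kappa>\<close> implies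
    \<open>|c * Y| \<ge> 2\<close>, where the test function is at least 1/2. The summand 1 in
    \<open>\<delta>\<close> keeps the quotient defined when \<open>K = 0\<close>.\<close>
  define c where "c = 2 / \<kappa>"
  define \<delta> where "\<delta> = sqrt (\<epsilon> / (4 * (K * c\<^sup>2 + 1)))"
  have pos: "K * c\<^sup>2 + 1 > 0" using K by (simp add: add_nonneg_pos)
  show ?thesis
  proof (rule that[of \<delta>])
    show "\<delta> > 0" using pos assms by (simp add: \<delta>_def)
    fix \<eta> Y assume R: "(\<eta>, Y) \<in> R" and \<eta>: "norm \<eta> < \<delta>"
    have [measurable]: "Y \<in> borel_measurable M" by (rule R_measurable[OF R])
    have "(norm \<eta>)\<^sup>2 < \<delta>\<^sup>2" using \<eta> by (intro power_strict_mono) auto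
    then have "(K * c\<^sup>2 + 1) * (norm \<eta>)\<^sup>2 < \<epsilon> / 4"
      using pos assms by (simp add: \<delta>_def field_simps)
    then have "K * (c\<^sup>2 * (norm \<eta>)\<^sup>2) \<le> \<epsilon> / 4"
      by (simp add: algebra_simps) (use zero_le_power2[of "norm \<eta>"] in linarith)
    moreover have "1 - \<epsilon> / 4 - K * (c\<^sup>2 * (norm \<eta>)\<^sup>2) \<le> expectation (\<lambda>x. exp (- ((c * Y x)\<^sup>2) / 2))"
      using expectation_exp_ge[OF K(2), of "[(c *\<^sub>R \<eta>, \<lambda>x. c * Y x)]"] R_scale[OF R]
      by (simp add: power_mult_distrib)
    moreover have "\<P>(x in M. \<kappa> \<le> \<bar>Y x\<bar>) / 2 \<le> 1 - expectation (\<lambda>x. exp (- ((c * Y x)\<^sup>2) / 2))"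
    proof -
      have int: "integrable M (\<lambda>x. exp (- ((c * Y x)\<^sup>2) / 2))"
        by (rule integrable_const_bound[where B = 1]) auto
      have "\<P>(x in M. \<kappa> \<le> \<bar>Y x\<bar>) / 2 = expectation (\<lambda>x. indicator {x\<in>space M. \<kappa> \<le> \<bar>Y x\<bar>} x / 2)"
        by simp
      also have "\<dots> \<le> expectation (\<lambda>x. 1 - exp (- ((c * Y x)\<^sup>2) / 2))"
      proof (rule integral_mono)
        fix x
        show "indicator {x\<in>space M. \<kappa> \<le> \<bar>Y x\<bar>} x / 2 \<le> 1 - exp (- ((c * Y x)\<^sup>2) / 2)"
        proof (cases "\<kappa> \<le> \<bar>Y x\<bar>")
          case True
          then have "2 \<le> \<bar>c * Y x\<bar>" using assms by (simp add: c_def abs_mult field_simps)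
          then have "2\<^sup>2 \<le> \<bar>c * Y x\<bar>\<^sup>2" by (intro power_mono) auto
          then have "exp (- ((c * Y x)\<^sup>2) / 2) \<le> exp (- 1)" by simp
          also have "\<dots> \<le> 1 / 2" using exp_ge_add_one_self[of 1] by (simp add: exp_minus field_simps)
          finally show ?thesis by (simp add: indicator_def)
        qed (simp add: indicator_def)
      qed (use int in \<open>auto intro!: integrable_real_indicator simp: emeasure_eq_measure\<close>)
      also have "\<dots> = 1 - expectation (\<lambda>x. exp (- ((c * Y x)\<^sup>2) / 2))"
        using int by (simp add: prob_space)
      finally show ?thesis .
    qed
    ultimately show "\<P>(x in M. \<kappa> \<le> \<bar>Y x\<bar>) \<le> \<epsilon>" by simp
  qed
qed

end

subsection \<open>Extension to a linear process\<close>

text \<open>The means of \<open>1 - cos (Y / n)\<close> vanish, so almost surely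
  \<open>Y / n\<close> is a multiple of \<open>2 * pi\<close> for every positive integer
  \<open>n\<close>; for \<open>n\<close> above \<open>|Y|\<close> only 0 is left.\<close>

lemma (in prob_space) AE_eq_0_of_char:
  assumes [measurable]: "Y \<in> borel_measurable M" and Y: "\<And>s. (\<integral>x. cis (s * Y x) \<partial>M) = 1"
  shows "AE x in M. Y x = 0"
proof -
  have "AE x in M. cos (Y x / real (Suc n)) = 1" for n
  proof -
    let ?s = "1 / real (Suc n)"
    have "integrable M (\<lambda>x. cis (?s * Y x))"
      by (rule integrable_const_bound[where B = 1]) (auto simp: cis_conv_exp)
    then have "expectation (\<lambda>x. Re (cis (?s * Y x))) = Re (\<integral>x. cis (?s * Y x) \<partial>M)" by (rule integral_Re)
    then have *: "expectation (\<lambda>x. cos (?s * Y x)) = 1" unfolding Y by simp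
    have int: "integrable M (\<lambda>x. cos (?s * Y x))"
      by (rule integrable_const_bound[where B = 1]) auto
    have "expectation (\<lambda>x. 1 - cos (?s * Y x)) = 0"
      by (subst Bochner_Integration.integral_diff[OF _ int]) (use * in \<open>auto simp: prob_space\<close>)
    then have "AE x in M. 1 - cos (?s * Y x) = 0"
      by (subst (asm) integral_nonneg_eq_0_iff_AE) (use int in auto)
    then show ?thesis by eventually_elim simp
  qed
  then have "AE x in M. \<forall>n. cos (Y x / real (Suc n)) = 1" unfolding AE_all_countable by blast
  then show ?thesis
  proof eventually_elim
    case (elim x)
    obtain n :: nat where n: "\<bar>Y x\<bar> < real n" using reals_Archimedean2 by blast
    from elim have "cos (Y x / real (Suc n)) = 1" ..
    then obtain k :: int where k: "Y x / real (Suc n) = of_int k * 2 * pi" using cos_one_2pi_int by blast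
    have "\<bar>Y x / real (Suc n)\<bar> < 1" using n by (simp add: abs_divide divide_less_eq)
    then have "\<bar>real_of_int k\<bar> * (2 * pi) < 1" unfolding k by (simp add: abs_mult)
    moreover have "1 \<le> \<bar>real_of_int k\<bar> \<Longrightarrow> 1 * (2 * pi) \<le> \<bar>real_of_int k\<bar> * (2 * pi)"
      by (intro mult_right_mono) auto
    ultimately have "\<not> 1 \<le> \<bar>real_of_int k\<bar>" using pi_gt3 by linarith
    then have "k = 0" by linarith
    with k show "Y x = 0" by simp
  qed
qed

text \<open>The exceptional null sets depend on the vectors and the scalar, so single paths need not
  be linear. Pathwise arguments therefore use countably many vectors at a time.\<close>

locale linear_process = prob_space M for M :: "'a measure" +
  fixes f :: "'h::real_inner \<Rightarrow> complex" and L :: "'h \<Rightarrow> 'a \<Rightarrow> real"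
  assumes L_measurable [measurable]: "L \<xi> \<in> borel_measurable M"
    and L_add: "AE x in M. L (\<xi> + \<eta>) x = L \<xi> x + L \<eta> x"
    and L_scale: "AE x in M. L (a *\<^sub>R \<xi>) x = a * L \<xi> x"
    and L_char: "(\<integral>x. cis (L \<xi> x) \<partial>M) = f \<xi>"
    and L_cont: "continuous_on UNIV f" and L_f_0: "f 0 = 1"

text \<open>Closing under almost everywhere equality is what makes sums and multiples stay in the
  relation.\<close>

definition (in linear_process) related :: "('h \<times> ('a \<Rightarrow> real)) set" where
  "related = {(\<eta>, Y). Y \<in> borel_measurable M \<and> (AE x in M. Y x = L \<eta> x)}"

sublocale linear_process \<subseteq> char_relation M f related
proof unfold_locales
  fix \<eta> Y assume "(\<eta>, Y) \<in> related"
  then have [measurable]: "Y \<in> borel_measurable M" and Y: "AE x in M. Y x = L \<eta> x" by (auto simp: related_def)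
  show "Y \<in> borel_measurable M" by fact
  have "(\<integral>x. cis (Y x) \<partial>M) = (\<integral>x. cis (L \<eta> x) \<partial>M)"
    using Y by (intro integral_cong_AE) (auto simp: cis_conv_exp)
  then show "(\<integral>x. cis (Y x) \<partial>M) = f \<eta>" by (simp add: L_char)
  show "(c *\<^sub>R \<eta>, \<lambda>x. c * Y x) \<in> related" for c
    using Y L_scale[of c \<eta>] by (auto simp: related_def)
  fix \<zeta> Z assume "(\<zeta>, Z) \<in> related"
  then have [measurable]: "Z \<in> borel_measurable M" and Z: "AE x in M. Z x = L \<zeta> x" by (auto simp: related_def)
  show "(\<eta> + \<zeta>, \<lambda>x. Y x + Z x) \<in> related"
    using Y Z L_add[of \<eta> \<zeta>] by (auto simp: related_def)
next
  have "(0, L 0) \<in> related" by (simp add: related_def)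
  then show "related \<noteq> {}" by blast
qed (use L_cont L_f_0 in auto)

text \<open>\<open>L \<xi>\<close> is the limit of \<open>X\<close> along approximations of
  \<open>\<xi>\<close> so fast that the Borel-Cantelli lemma applies. Linearity is not traced
  through the approximation: the defect of additivity has all its transforms equal to
  \<open>f 0 = 1\<close>, hence vanishes almost everywhere.\<close>

lemma (in prob_space) linear_process_extension:
  fixes f :: "'h::real_inner \<Rightarrow> complex" and d :: "nat \<Rightarrow> 'h" and X :: "nat \<Rightarrow> 'a \<Rightarrow> real"
  assumes X [measurable]: "\<And>i. X i \<in> borel_measurable M"
    and char: "\<And>n t. (\<integral>x. cis (\<Sum>i<n. t i * X i x) \<partial>M) = f (\<Sum>i<n. t i *\<^sub>R d i)"
    and dense: "closure (range d) = UNIV" and cont: "continuous_on UNIV f" and f0: "f 0 = 1"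
  obtains L where "linear_process M f L" "\<And>i. AE x in M. L (d i) x = X i x"
proof -
  define R where "R = {(\<Sum>i<n. t i *\<^sub>R d i, \<lambda>x. \<Sum>i<n. t i * X i x) | n t. True}"
  have R_I: "(\<Sum>i<n. t i *\<^sub>R d i, \<lambda>x. \<Sum>i<n. t i * X i x) \<in> R" for n t unfolding R_def by blast
  have pad: "(\<Sum>i<n. t i *\<^sub>R d i) = (\<Sum>i<m. (if i < n then t i else 0) *\<^sub>R d i)"
    "(\<Sum>i<n. t i * X i x) = (\<Sum>i<m. (if i < n then t i else 0) * X i x)" if "n \<le> m" for n m t x
    using that by (auto intro!: sum.mono_neutral_cong_left split: if_splits)
  have R_add': "(\<eta> + \<zeta>, \<lambda>x. Y x + Z x) \<in> R" if R1: "(\<eta>, Y) \<in> R" and R2: "(\<zeta>, Z) \<in> R" for \<eta> \<zeta> Y Z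
  proof -
    obtain n t where 1: "\<eta> = (\<Sum>i<n. t i *\<^sub>R d i)" "Y = (\<lambda>x. \<Sum>i<n. t i * X i x)"
      using R1 unfolding R_def by blast
    obtain m s where 2: "\<zeta> = (\<Sum>i<m. s i *\<^sub>R d i)" "Z = (\<lambda>x. \<Sum>i<m. s i * X i x)"
      using R2 unfolding R_def by blast
    let ?k = "max n m" and ?r = "\<lambda>i. (if i < n then t i else 0) + (if i < m then s i else 0)"
    have "\<eta> + \<zeta> = (\<Sum>i<?k. ?r i *\<^sub>R d i)"
      unfolding 1 2 pad(1)[OF max.cobounded1[of n m]] pad(1)[OF max.cobounded2[of m n]]
      by (simp only: sum.distrib[symmetric] scaleR_add_left)
    moreover have "(\<lambda>x. Y x + Z x) = (\<lambda>x. \<Sum>i<?k. ?r i * X i x)"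
      unfolding 1 2 pad(2)[OF max.cobounded1[of n m]] pad(2)[OF max.cobounded2[of m n]]
      by (simp only: sum.distrib[symmetric] distrib_right)
    ultimately show ?thesis using R_I[of ?r ?k] by simp
  qed
  interpret R: char_relation M f R
  proof unfold_locales
    show "(c *\<^sub>R \<eta>, \<lambda>x. c * Y x) \<in> R" if R1: "(\<eta>, Y) \<in> R" for c \<eta> Y
    proof -
      obtain n t where 1: "\<eta> = (\<Sum>i<n. t i *\<^sub>R d i)" "Y = (\<lambda>x. \<Sum>i<n. t i * X i x)"
        using R1 unfolding R_def by blast
      show ?thesis using R_I[of "\<lambda>i. c * t i" n] unfolding 1 by (simp add: scaleR_sum_right sum_distrib_left mult.assoc)
    qed
    show "R \<noteq> {}" using R_I by blast
    show "Y \<in> borel_measurable M" "(\<integral>x. cis (Y x) \<partial>M) = f \<eta>" if "(\<eta>, Y) \<in> R" for \<eta> Y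
      using that by (auto simp: R_def char)
  qed (fact cont f0 R_add')+
  have single: "(d i, X i) \<in> R" for i
    using R_I[of "\<lambda>j. if j = i then 1 else 0" "Suc i"] by simp

  define good where "good k \<delta> \<longleftrightarrow> \<delta> > 0 \<and>
      (\<forall>\<eta> Y. (\<eta>, Y) \<in> R \<longrightarrow> norm \<eta> < \<delta> \<longrightarrow> \<P>(x in M. (1/2) ^ k \<le> \<bar>Y x\<bar>) \<le> (1/2) ^ k)" for k :: nat and \<delta>
  have "\<exists>\<delta>. good k \<delta>" for k
    unfolding good_def by (rule R.R_prob_small[of "(1/2) ^ k" "(1/2) ^ k"]) (simp, simp, blast)
  then obtain \<delta> where "\<And>k. good k (\<delta> k)" by metis
  then have \<delta>: "\<And>k. \<delta> k > 0"
    "\<And>k \<eta> Y. (\<eta>, Y) \<in> R \<Longrightarrow> norm \<eta> < \<delta> k \<Longrightarrow> \<P>(x in M. (1/2) ^ k \<le> \<bar>Y x\<bar>) \<le> (1/2) ^ k"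
    unfolding good_def by blast+
  \<comment> \<open>The minimum over all \<open>\<delta>\<close> up to \<open>k\<close> also gives
    \<open>\<rho> (Suc k) \<le> \<delta> k\<close>, so consecutive approximants, each within half
    its \<open>\<rho>\<close>, differ by less than \<open>\<delta> k\<close>.\<close>
  define \<rho> where "\<rho> k = min ((1/2) ^ k) (Min (\<delta> ` {..k}))" for k
  have \<rho>: "\<rho> k > 0" "\<rho> k \<le> (1/2) ^ k" "\<rho> k \<le> \<delta> k" "\<rho> (Suc k) \<le> \<delta> k" for k
    using \<delta>(1) by (auto simp: \<rho>_def min_le_iff_disj Min_le_iff)
  have "\<exists>i. dist (d i) \<xi> < \<rho> k / 2" for \<xi> k
  proof -
    have "\<xi> \<in> closure (range d)" using dense by simp
    moreover have "\<rho> k / 2 > 0" using \<rho>(1)[of k] by simp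
    ultimately have "\<exists>y\<in>range d. dist y \<xi> < \<rho> k / 2" unfolding closure_approachable by blast
    then show ?thesis by blast
  qed
  then obtain I where I: "\<And>\<xi> k. dist (d (I \<xi> k)) \<xi> < \<rho> k / 2" by metis
  have d_lim: "(\<lambda>k. d (I \<xi> k)) \<longlonglongrightarrow> \<xi>" for \<xi>
  proof -
    have "dist (d (I \<xi> k)) \<xi> \<le> (1/2) ^ k" for k using I[of \<xi> k] \<rho>(1,2)[of k] by linarith
    then have "\<forall>\<^sub>F k in sequentially. norm (dist (d (I \<xi> k)) \<xi>) \<le> (1/2) ^ k" by simp
    moreover have "(\<lambda>k. (1/2::real) ^ k) \<longlonglongrightarrow> 0" by (rule LIMSEQ_power_zero) simp
    ultimately have "(\<lambda>k. dist (d (I \<xi> k)) \<xi>) \<longlonglongrightarrow> 0" by (rule Lim_null_comparison)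
    then show ?thesis by (rule tendsto_dist_iff[THEN iffD2])
  qed
  define L where "L \<xi> x = lim (\<lambda>k. X (I \<xi> k) x)" for \<xi> x
  have Lm [measurable]: "L \<xi> \<in> borel_measurable M" for \<xi> unfolding L_def by measurable
  have L_lim: "AE x in M. (\<lambda>k. X (I \<xi> k) x) \<longlonglongrightarrow> L \<xi> x" for \<xi>
  proof -
    let ?A = "\<lambda>k. {x \<in> space M. (1/2) ^ k \<le> \<bar>X (I \<xi> (Suc k)) x - X (I \<xi> k) x\<bar>}"
    have "measure M (?A k) \<le> (1/2) ^ k" for k
    proof (rule \<delta>(2))
      have "(d (I \<xi> (Suc k)) + (-1) *\<^sub>R d (I \<xi> k), \<lambda>x. X (I \<xi> (Suc k)) x + (-1) * X (I \<xi> k) x) \<in> R"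
        by (intro R.R_add R.R_scale single)
      then show "(d (I \<xi> (Suc k)) - d (I \<xi> k), \<lambda>x. X (I \<xi> (Suc k)) x - X (I \<xi> k) x) \<in> R" by simp
      have "dist (d (I \<xi> (Suc k))) (d (I \<xi> k)) < \<delta> k"
        using dist_triangle2[of "d (I \<xi> (Suc k))" "d (I \<xi> k)" \<xi>] I[of \<xi> k] I[of \<xi> "Suc k"] \<rho>(3,4)[of k]
        by linarith
      then show "norm (d (I \<xi> (Suc k)) - d (I \<xi> k)) < \<delta> k" by (simp add: dist_norm)
    qed
    then have "summable (\<lambda>k. measure M (?A k))"
      by (intro summable_comparison_test'[OF summable_geometric[of "1/2::real"], of 0]) auto
    then have "AE x in M. \<forall>\<^sub>F k in sequentially. x \<in> space M - ?A k"
      by (intro borel_cantelli_AE1) (auto simp: emeasure_eq_measure)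
    then show ?thesis
    proof eventually_elim
      case (elim x)
      then have "\<forall>\<^sub>F k in sequentially. norm (X (I \<xi> (Suc k)) x - X (I \<xi> k) x) \<le> (1/2) ^ k"
        by eventually_elim auto
      then have "summable (\<lambda>k. X (I \<xi> (Suc k)) x - X (I \<xi> k) x)"
        by (rule summable_comparison_test_ev) (simp add: summable_geometric)
      then have "convergent (\<lambda>n. \<Sum>k<n. X (I \<xi> (Suc k)) x - X (I \<xi> k) x)"
        by (simp add: summable_iff_convergent)
      then have "convergent (\<lambda>n. X (I \<xi> n) x - X (I \<xi> 0) x)"
        by (simp add: sum_lessThan_telescope[of "\<lambda>k. X (I \<xi> k) x"])
      then have "convergent (\<lambda>n. X (I \<xi> n) x)" by (simp add: convergent_diff_const_right_iff)
      then show ?case unfolding L_def by (simp add: convergent_LIMSEQ_iff)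
    qed
  qed
  \<comment> \<open>Three limits and one original variable suffice for additivity, for homogeneity
    and for identifying \<open>L (d i)\<close> with \<open>X i\<close>; the slots left over get
    coefficient 0.\<close>
  have joint: "(\<integral>x. cis (a * L \<xi> x + (b * L \<eta> x + (c * L \<zeta> x + e * X j x))) \<partial>M) =
      f (a *\<^sub>R \<xi> + (b *\<^sub>R \<eta> + (c *\<^sub>R \<zeta> + e *\<^sub>R d j)))" for a b c e \<xi> \<eta> \<zeta> j
  proof (rule LIMSEQ_unique)
    let ?Y = "\<lambda>k x. a * X (I \<xi> k) x + (b * X (I \<eta> k) x + (c * X (I \<zeta> k) x + e * X j x))"
    show "(\<lambda>k. \<integral>x. cis (?Y k x) \<partial>M) \<longlonglongrightarrow>
        (\<integral>x. cis (a * L \<xi> x + (b * L \<eta> x + (c * L \<zeta> x + e * X j x))) \<partial>M)"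
    proof (rule integral_dominated_convergence[where w = "\<lambda>_. 1"])
      show "AE x in M. (\<lambda>k. cis (?Y k x)) \<longlonglongrightarrow> cis (a * L \<xi> x + (b * L \<eta> x + (c * L \<zeta> x + e * X j x)))"
        using L_lim[of \<xi>] L_lim[of \<eta>] L_lim[of \<zeta>]
        by eventually_elim (auto simp: cis_conv_exp intro!: tendsto_intros)
    qed (auto simp: cis_conv_exp)
    have "(\<integral>x. cis (?Y k x) \<partial>M) =
        f (a *\<^sub>R d (I \<xi> k) + (b *\<^sub>R d (I \<eta> k) + (c *\<^sub>R d (I \<zeta> k) + e *\<^sub>R d j)))" for k
      by (intro R.R_char R.R_add R.R_scale single)
    moreover have "(\<lambda>k. f (a *\<^sub>R d (I \<xi> k) + (b *\<^sub>R d (I \<eta> k) + (c *\<^sub>R d (I \<zeta> k) + e *\<^sub>R d j)))) \<longlonglongrightarrow>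
        f (a *\<^sub>R \<xi> + (b *\<^sub>R \<eta> + (c *\<^sub>R \<zeta> + e *\<^sub>R d j)))"
      by (intro continuous_on_tendsto_compose[OF cont] tendsto_intros d_lim) auto
    ultimately show "(\<lambda>k. \<integral>x. cis (?Y k x) \<partial>M) \<longlonglongrightarrow> f (a *\<^sub>R \<xi> + (b *\<^sub>R \<eta> + (c *\<^sub>R \<zeta> + e *\<^sub>R d j)))"
      by simp
  qed
  show ?thesis
  proof (rule that)
    show "linear_process M f L"
    proof
      fix \<xi> \<eta> :: 'h and a :: real
      have "AE x in M. L (\<xi> + \<eta>) x - L \<xi> x - L \<eta> x = 0"
      proof (rule AE_eq_0_of_char)
        show "(\<integral>x. cis (s * (L (\<xi> + \<eta>) x - L \<xi> x - L \<eta> x)) \<partial>M) = 1" for s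
          using joint[of s "\<xi> + \<eta>" "-s" \<xi> "-s" \<eta> 0 undefined] f0 by (simp add: algebra_simps)
      qed (intro borel_measurable_diff borel_measurable_times borel_measurable_const Lm X)
      then show "AE x in M. L (\<xi> + \<eta>) x = L \<xi> x + L \<eta> x" by eventually_elim simp
      have "AE x in M. L (a *\<^sub>R \<xi>) x - a * L \<xi> x = 0"
      proof (rule AE_eq_0_of_char)
        show "(\<integral>x. cis (s * (L (a *\<^sub>R \<xi>) x - a * L \<xi> x)) \<partial>M) = 1" for s
          using joint[of s "a *\<^sub>R \<xi>" "-s*a" \<xi> 0 undefined 0 undefined] f0 by (simp add: algebra_simps)
      qed (intro borel_measurable_diff borel_measurable_times borel_measurable_const Lm X)
      then show "AE x in M. L (a *\<^sub>R \<xi>) x = a * L \<xi> x" by eventually_elim simp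
      show "(\<integral>x. cis (L \<xi> x) \<partial>M) = f \<xi>"
        using joint[of 1 \<xi> 0 undefined 0 undefined 0 undefined] by simp
    qed (use cont f0 in auto)
    fix i
    have "AE x in M. L (d i) x - X i x = 0"
    proof (rule AE_eq_0_of_char)
      show "(\<integral>x. cis (s * (L (d i) x - X i x)) \<partial>M) = 1" for s
        using joint[of s "d i" 0 undefined 0 undefined "-s" i] f0 by (simp add: algebra_simps)
    qed (intro borel_measurable_diff borel_measurable_times borel_measurable_const Lm X)
    then show "AE x in M. L (d i) x = X i x" by eventually_elim simp
  qed
qed

subsection \<open>The invariant factorization weight\<close>

lemma AE_summable_of_integral_bound:
  fixes g :: "nat \<Rightarrow> 'a \<Rightarrow> real"
  assumes int: "\<And>n. integrable M (g n)" and nonneg: "\<And>n x. 0 \<le> g n x"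
    and le: "\<And>n. (\<integral>x. g n x \<partial>M) \<le> c n" and c: "summable c"
  shows "AE x in M. summable (\<lambda>n. g n x)"
proof -
  have c0: "0 \<le> c n" for n using le[of n] Bochner_Integration.integral_nonneg[of M "g n"] nonneg by (meson order_trans)
  have [measurable]: "g n \<in> borel_measurable M" for n using int by (rule borel_measurable_integrable)
  have "(\<integral>\<^sup>+x. (\<Sum>n. ennreal (g n x)) \<partial>M) = (\<Sum>n. \<integral>\<^sup>+x. ennreal (g n x) \<partial>M)"
    by (rule nn_integral_suminf) measurable
  also have "\<dots> \<le> (\<Sum>n. ennreal (c n))"
    using int nonneg le by (intro suminf_le) (auto simp: nn_integral_eq_integral ennreal_leI)
  also have "\<dots> = ennreal (\<Sum>n. c n)" by (rule suminf_ennreal2[OF c0 c])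
  also have "\<dots> < \<infinity>" by simp
  finally have "AE x in M. (\<Sum>n. ennreal (g n x)) \<noteq> \<infinity>"
    by (intro nn_integral_PInf_AE) auto
  then show ?thesis
    by eventually_elim (auto intro: summable_suminf_not_top nonneg)
qed

section \<open>Gaussian functionals of finite families\<close>

context linear_process
begin

text \<open>Families are lists, so that concatenation adds the sums and repetitions count.\<close>

definition sum_sq :: "'h list \<Rightarrow> 'a \<Rightarrow> real" where
  "sum_sq xs x = (\<Sum>\<xi>\<leftarrow>xs. (L \<xi> x)\<^sup>2)"

lemma sum_sq_simps [simp]:
  "sum_sq [] x = 0" "sum_sq (\<xi> # xs) x = (L \<xi> x)\<^sup>2 + sum_sq xs x"
  "sum_sq (xs @ ys) x = sum_sq xs x + sum_sq ys x"
  by (auto simp: sum_sq_def)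

lemma sum_sq_nonneg: "0 \<le> sum_sq xs x"
  by (induction xs) auto

lemma sum_sq_measurable [measurable]: "sum_sq xs \<in> borel_measurable M"
proof (induction xs)
  case (Cons \<xi> xs)
  note [measurable] = Cons
  show ?case by simp
qed simp

lemma sum_sq_scale: "AE x in M. sum_sq (map ((*\<^sub>R) a) xs) x = a\<^sup>2 * sum_sq xs x"
proof (induction xs)
  case (Cons \<xi> xs)
  then show ?case using L_scale[of a \<xi>]
    by eventually_elim (simp add: power_mult_distrib distrib_left)
qed simp

lemma integrable_exp_sum_sq:
  assumes "c \<ge> 0" shows "integrable M (\<lambda>x. exp (- (c * sum_sq xs x)))"
  by (rule integrable_const_bound[where B = 1]) (auto simp: sum_sq_nonneg assms)

text \<open>The factor \<open>sqrt (2 * c)\<close> is absorbed into the vectors. The bound sees the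
  family only through its sum of squared norms, whatever its length; this uniformity is what makes
  the weight nonzero.\<close>

lemma expectation_exp_sum_sq_ge:
  assumes bound: "\<And>\<eta>. norm (f \<eta>) \<le> 1 \<Longrightarrow> 1 - \<epsilon> - K * (norm \<eta>)\<^sup>2 \<le> Re (f \<eta>)" and c: "c \<ge> 0"
  shows "1 - \<epsilon> - K * (2 * c * (\<Sum>\<xi>\<leftarrow>xs. (norm \<xi>)\<^sup>2)) \<le> expectation (\<lambda>x. exp (- (c * sum_sq xs x)))"
proof -
  let ?s = "sqrt (2 * c)"
  let ?ps = "map (\<lambda>\<xi>. (?s *\<^sub>R \<xi>, \<lambda>x. ?s * L \<xi> x)) xs"
  have "AE x in M. ?s * L \<xi> x = L (?s *\<^sub>R \<xi>) x" for \<xi> using L_scale[of ?s \<xi>] by eventually_elim simp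
  then have "set ?ps \<subseteq> related" by (auto simp: related_def)
  from expectation_exp_ge[OF bound this]
  have "1 - \<epsilon> - K * (\<Sum>p\<leftarrow>?ps. (norm (fst p))\<^sup>2) \<le> expectation (\<lambda>x. exp (- (\<Sum>p\<leftarrow>?ps. (snd p x)\<^sup>2) / 2))" .
  moreover have "(\<Sum>p\<leftarrow>?ps. (norm (fst p))\<^sup>2) = 2 * c * (\<Sum>\<xi>\<leftarrow>xs. (norm \<xi>)\<^sup>2)"
    using c by (induction xs) (auto simp: power_mult_distrib distrib_left)
  moreover have "(\<Sum>p\<leftarrow>?ps. (snd p x)\<^sup>2) = 2 * (c * sum_sq xs x)" for x
    using c by (induction xs) (auto simp: power_mult_distrib distrib_left)
  ultimately show ?thesis by simp
qed

end

lemma tendsto_one_minus_exp_quotient: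
  "(\<lambda>n. (1 - exp (- ((1/2) ^ n * a))) / (1/2) ^ n) \<longlonglongrightarrow> (a::real)"
proof -
  have "((\<lambda>t. exp (- (t * a))) has_field_derivative - a) (at 0)"
    by (auto intro!: derivative_eq_intros)
  then have "((\<lambda>h. (exp (- (h * a)) - 1) / h) \<longlongrightarrow> - a) (at 0)"
    by (simp add: has_field_derivative_iff)
  moreover have "filterlim (\<lambda>n. (1/2::real) ^ n) (at 0) sequentially"
    unfolding filterlim_at by (auto intro!: LIMSEQ_power_zero)
  ultimately have "(\<lambda>n. (exp (- ((1/2) ^ n * a)) - 1) / (1/2) ^ n) \<longlonglongrightarrow> - a"
    by (rule filterlim_compose)
  from tendsto_minus[OF this] show ?thesis by (simp add: minus_divide_left del: power_divide)
qed

text \<open>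
  The weight is the limit of \<open>exp (- sum_sq xs / 2)\<close> along any sequence of finite families
  minimising the functional \<open>J\<close> below.  The parallelogram identity for the midpoint of two families makes
  every minimising sequence Cauchy in \<open>L\<^sup>2\<close>, so the limit exists and inherits all symmetries;
  the bound is the Euler inequality for adding one small vector to a family.
\<close>

lemma (in linear_process) factorization_weight:
  fixes N :: "'h \<Rightarrow> real"
  assumes N_scale: "\<And>a \<xi>. N (a *\<^sub>R \<xi>) = \<bar>a\<bar> * N \<xi>" and N_ge: "\<And>\<xi>. norm \<xi> \<le> N \<xi>"
  obtains v :: "'a \<Rightarrow> real" where "v \<in> borel_measurable M" "AE x in M. 0 < v x"
    "\<And>\<xi>. integrable M (\<lambda>x. (v x * L \<xi> x)\<^sup>2)" "\<And>\<xi>. (\<integral>x. (v x * L \<xi> x)\<^sup>2 \<partial>M) \<le> (N \<xi>)\<^sup>2"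
    "\<And>\<tau> u. \<tau> \<in> measurable M M \<Longrightarrow> distr M M \<tau> = M \<Longrightarrow> (\<And>\<xi>. N (u \<xi>) = N \<xi>) \<Longrightarrow>
      (\<And>\<xi>. AE x in M. L \<xi> (\<tau> x) = L (u \<xi>) x) \<Longrightarrow> AE x in M. v (\<tau> x) = v x"
proof -
  define E where "E xs = expectation (\<lambda>x. exp (- sum_sq xs x))" for xs
  define S where "S xs = (\<Sum>\<xi>\<leftarrow>xs. (N \<xi>)\<^sup>2)" for xs
  define J where "J xs = E xs + S xs" for xs
  define I where "I = (INF xs. J xs)"
  have int1: "integrable M (\<lambda>x. exp (- sum_sq xs x))" for xs using integrable_exp_sum_sq[of 1 xs] by simp
  have E0: "0 \<le> E xs" for xs unfolding E_def by (intro Bochner_Integration.integral_nonneg) simp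
  have S0: "0 \<le> S xs" for xs unfolding S_def by (intro sum_list_nonneg) auto
  have bdd: "bdd_below (range J)" by (rule bdd_belowI[of _ 0]) (use E0 S0 in \<open>auto simp: J_def\<close>)
  have I_le: "I \<le> J xs" for xs unfolding I_def by (rule cINF_lower[OF bdd]) simp
  have I0: "0 \<le> I" unfolding I_def by (rule cINF_greatest) (use E0 S0 in \<open>auto simp: J_def\<close>)
  have I1: "I \<le> 1" using I_le[of "[]"] by (simp add: J_def E_def S_def prob_space)
  define V where "V xs x = exp (- sum_sq xs x / 2)" for xs x
  have [measurable]: "V xs \<in> borel_measurable M" for xs unfolding V_def by measurable
  have V01: "0 < V xs x" "V xs x \<le> 1" for xs x using sum_sq_nonneg[of xs x] by (auto simp: V_def)
  have V2: "(V xs x)\<^sup>2 = exp (- sum_sq xs x)" for xs x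
    by (simp add: V_def power2_eq_square exp_add[symmetric])
  have V_int: "integrable M (\<lambda>x. (V xs x - V ys x)\<^sup>2)" for xs ys
  proof (rule integrable_const_bound[where B = 1])
    have "\<bar>V xs x - V ys x\<bar> \<le> 1" for x using V01[of xs x] V01[of ys x] by linarith
    then show "AE x in M. norm ((V xs x - V ys x)\<^sup>2) \<le> 1" by (simp add: abs_square_le_1)
  qed measurable
  \<comment> \<open>The midpoint of two families is their concatenation scaled by
    \<open>sqrt (1/2)\<close>. There \<open>S\<close> takes the mean value and the exponential
    becomes \<open>V xs x * V ys x\<close>, so \<open>J xs + J ys - 2 * J zs\<close> is exactly the
    squared distance, and \<open>I \<le> J zs\<close> bounds it.\<close>
  have V_dist: "(\<integral>x. (V xs x - V ys x)\<^sup>2 \<partial>M) \<le> (J xs - I) + (J ys - I)" for xs ys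
  proof -
    define zs where "zs = map ((*\<^sub>R) (sqrt (1/2))) (xs @ ys)"
    have "AE x in M. sum_sq zs x = (sum_sq xs x + sum_sq ys x) / 2"
      using sum_sq_scale[of "sqrt (1/2)" "xs @ ys"] unfolding zs_def by eventually_elim simp
    then have "AE x in M. exp (- sum_sq zs x) = V xs x * V ys x"
      by eventually_elim (simp add: V_def exp_add[symmetric] add_divide_distrib)
    then have Ez: "E zs = expectation (\<lambda>x. V xs x * V ys x)"
      unfolding E_def by (intro integral_cong_AE) auto
    have Sz: "S zs = (S xs + S ys) / 2"
    proof -
      have "(\<Sum>\<xi>\<leftarrow>map ((*\<^sub>R) a) ws. (N \<xi>)\<^sup>2) = a\<^sup>2 * (\<Sum>\<xi>\<leftarrow>ws. (N \<xi>)\<^sup>2)" for a ws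
        by (induction ws) (auto simp: N_scale power_mult_distrib distrib_left)
      from this[of "sqrt (1/2)" "xs @ ys"] show ?thesis unfolding zs_def S_def by simp
    qed
    have int2: "integrable M (\<lambda>x. V xs x * V ys x)"
      by (rule integrable_const_bound[where B = 1])
        (use V01 in \<open>auto simp: abs_mult less_imp_le intro!: AE_I2 mult_le_one\<close>)
    have "(\<integral>x. (V xs x - V ys x)\<^sup>2 \<partial>M) =
        (\<integral>x. exp (- sum_sq xs x) + exp (- sum_sq ys x) - 2 * (V xs x * V ys x) \<partial>M)"
      by (intro Bochner_Integration.integral_cong refl) (simp add: power2_diff V2)
    also have "\<dots> = E xs + E ys - 2 * E zs"
      using int1 int2 by (simp add: E_def[of xs] E_def[of ys] Ez)
    also have "\<dots> \<le> (J xs - I) + (J ys - I)" using I_le[of zs] Sz unfolding J_def by (simp add: field_simps)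
    finally show ?thesis .
  qed

  \<comment> \<open>The rate \<open>(1/4) ^ n\<close> survives two losses: a factor
    \<open>2 ^ n\<close> spent on pointwise convergence, and the division by
    \<open>(1/2) ^ n\<close> in the first variation.\<close>
  have "\<exists>xs. J xs < I + (1/4) ^ n" for n :: nat
  proof -
    have "I < I + (1/4) ^ n" by simp
    then have "\<exists>xs\<in>UNIV. J xs < I + (1/4) ^ n"
      unfolding I_def by (subst (asm) cINF_less_iff[OF _ bdd]) auto
    then show ?thesis by blast
  qed
  then obtain ws where ws: "\<And>n. J (ws n) < I + (1/4) ^ n" by metis
  define v where "v x = lim (\<lambda>n. V (ws n) x)" for x
  have v_meas [measurable]: "v \<in> borel_measurable M" unfolding v_def by measurable
  have V_lim: "AE x in M. (\<lambda>n. V (ws n) x) \<longlonglongrightarrow> v x"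
  proof -
    have "AE x in M. summable (\<lambda>n. 2 ^ n * (V (ws (Suc n)) x - V (ws n) x)\<^sup>2)"
    proof (rule AE_summable_of_integral_bound[where c = "\<lambda>n. 2 * (1/2) ^ n"])
      show "(\<integral>x. 2 ^ n * (V (ws (Suc n)) x - V (ws n) x)\<^sup>2 \<partial>M) \<le> 2 * (1/2) ^ n" for n
      proof -
        have "(\<integral>x. (V (ws (Suc n)) x - V (ws n) x)\<^sup>2 \<partial>M) \<le> (J (ws (Suc n)) - I) + (J (ws n) - I)"
          by (rule V_dist)
        also have "\<dots> \<le> 2 * (1/4) ^ n"
        proof -
          have "(1/4) ^ Suc n \<le> (1/4::real) ^ n" by (rule power_decreasing) auto
          then have "J (ws (Suc n)) < I + (1/4) ^ n" using ws[of "Suc n"] by linarith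
          then show ?thesis using ws[of n] by linarith
        qed
        finally have "2 ^ n * (\<integral>x. (V (ws (Suc n)) x - V (ws n) x)\<^sup>2 \<partial>M) \<le> 2 ^ n * (2 * (1/4) ^ n)"
          by (rule mult_left_mono) simp
        also have "2 ^ n * (2 * (1/4) ^ n) = 2 * (1/2::real) ^ n"
          by (simp add: power_mult_distrib[symmetric] mult.left_commute)
        finally show ?thesis by simp
      qed
    qed (use V_int in \<open>auto intro!: summable_mult summable_geometric\<close>)
    then show ?thesis
    proof eventually_elim
      case (elim x)
      let ?w = "\<lambda>n. V (ws (Suc n)) x - V (ws n) x"
      have "(\<lambda>n. 2 ^ n * (?w n)\<^sup>2) \<longlonglongrightarrow> 0" using elim by (rule summable_LIMSEQ_zero)
      then have "\<forall>\<^sub>F n in sequentially. 2 ^ n * (?w n)\<^sup>2 < 1" by (rule order_tendstoD(2)) simp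
      then have "\<forall>\<^sub>F n in sequentially. norm (?w n) \<le> (sqrt (1/2)) ^ n"
      proof eventually_elim
        case (elim n)
        have "(?w n)\<^sup>2 \<le> (1/2) ^ n" using elim by (simp add: power_divide field_simps)
        then have "sqrt ((?w n)\<^sup>2) \<le> sqrt ((1/2) ^ n)" by (rule real_sqrt_le_mono)
        then show ?case unfolding real_sqrt_abs real_sqrt_power[of "1/2" n] real_norm_def .
      qed
      then have "summable ?w"
        by (rule summable_comparison_test_ev) (auto intro!: summable_geometric simp: real_sqrt_divide)
      then have "convergent (\<lambda>n. \<Sum>k<n. ?w k)" by (simp add: summable_iff_convergent)
      then have "convergent (\<lambda>n. V (ws n) x - V (ws 0) x)"
        by (simp only: sum_lessThan_telescope[of "\<lambda>k. V (ws k) x"])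
      then have "convergent (\<lambda>n. V (ws n) x)" by (simp add: convergent_diff_const_right_iff)
      then show ?case unfolding v_def by (simp add: convergent_LIMSEQ_iff)
    qed
  qed

  \<comment> \<open>Add \<open>s *\<^sub>R \<xi>\<close> with \<open>s^2 = (1/2) ^ n\<close> to
    \<open>ws n\<close>. As \<open>ws n\<close> is minimal up to \<open>(1/4) ^ n\<close>, the drop
    in \<open>E\<close> is at most \<open>(1/4) ^ n + s^2 * (N \<xi>)^2\<close>. Divide by
    \<open>s^2\<close> and apply Fatou's lemma.\<close>
  have bound: "(\<integral>\<^sup>+x. ennreal ((v x * L \<xi> x)\<^sup>2) \<partial>M) \<le> ennreal ((N \<xi>)\<^sup>2)" for \<xi>
  proof -
    define g where "g n x = (V (ws n) x)\<^sup>2 * ((1 - exp (- ((1/2) ^ n * (L \<xi> x)\<^sup>2))) / (1/2) ^ n)" for n x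
    have [measurable]: "g n \<in> borel_measurable M" for n unfolding g_def by measurable
    have g_lim: "AE x in M. (\<lambda>n. ennreal (g n x)) \<longlonglongrightarrow> ennreal ((v x * L \<xi> x)\<^sup>2)"
      using V_lim
    proof eventually_elim
      case (elim x)
      have "(\<lambda>n. g n x) \<longlonglongrightarrow> (v x)\<^sup>2 * (L \<xi> x)\<^sup>2"
        unfolding g_def by (intro tendsto_mult tendsto_power elim tendsto_one_minus_exp_quotient)
      then show ?case by (intro tendsto_ennrealI) (simp add: power_mult_distrib)
    qed
    have g_int: "(\<integral>\<^sup>+x. ennreal (g n x) \<partial>M) \<le> ennreal ((1/2) ^ n + (N \<xi>)\<^sup>2)" for n
    proof -
      define s where "s = sqrt ((1/2::real) ^ n)"
      have s2: "s\<^sup>2 = (1/2) ^ n" by (simp add: s_def)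
      have "AE x in M. exp (- sum_sq (s *\<^sub>R \<xi> # ws n) x) = exp (- sum_sq (ws n) x) * exp (- ((1/2) ^ n * (L \<xi> x)\<^sup>2))"
        using L_scale[of s \<xi>]
        by eventually_elim (simp add: power_mult_distrib s2 exp_add[symmetric] del: power_divide)
      then have Es: "E (s *\<^sub>R \<xi> # ws n) = expectation (\<lambda>x. exp (- sum_sq (ws n) x) * exp (- ((1/2) ^ n * (L \<xi> x)\<^sup>2)))"
        unfolding E_def by (intro integral_cong_AE) auto
      have int3: "integrable M (\<lambda>x. exp (- sum_sq (ws n) x) * exp (- ((1/2) ^ n * (L \<xi> x)\<^sup>2)))"
        by (rule integrable_const_bound[where B = 1], rule AE_I2)
          (use sum_sq_nonneg[of "ws n"] in \<open>auto simp: abs_mult intro!: mult_le_one\<close>)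
      have g_eq: "g n x = (exp (- sum_sq (ws n) x) - exp (- sum_sq (ws n) x) * exp (- ((1/2) ^ n * (L \<xi> x)\<^sup>2))) / (1/2) ^ n" for x
        unfolding g_def V2 by (simp add: right_diff_distrib)
      have int4: "integrable M (g n)" unfolding g_eq[abs_def] using int1 int3 by (intro integrable_divide Bochner_Integration.integrable_diff)
      have "(\<integral>x. g n x \<partial>M) = (E (ws n) - E (s *\<^sub>R \<xi> # ws n)) / (1/2) ^ n"
        unfolding g_eq Es E_def[of "ws n"] using int1 int3 by simp
      also have "\<dots> \<le> ((1/4) ^ n + (1/2) ^ n * (N \<xi>)\<^sup>2) / (1/2) ^ n"
      proof (intro divide_right_mono)
        have "S (s *\<^sub>R \<xi> # ws n) = (1/2) ^ n * (N \<xi>)\<^sup>2 + S (ws n)"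
          by (simp add: S_def N_scale power_mult_distrib s2 del: power_divide)
        then show "E (ws n) - E (s *\<^sub>R \<xi> # ws n) \<le> (1/4) ^ n + (1/2) ^ n * (N \<xi>)\<^sup>2"
          using I_le[of "s *\<^sub>R \<xi> # ws n"] ws[of n] unfolding J_def by linarith
      qed simp
      also have "\<dots> = (1/2) ^ n + (N \<xi>)\<^sup>2"
      proof -
        have "(1/4::real) ^ n = (1/2) ^ n * (1/2) ^ n" by (simp flip: power_mult_distrib)
        then show ?thesis by (simp add: add_divide_distrib)
      qed
      finally have "(\<integral>x. g n x \<partial>M) \<le> (1/2) ^ n + (N \<xi>)\<^sup>2" .
      moreover have "AE x in M. 0 \<le> g n x" unfolding g_def by (rule AE_I2) simp
      ultimately show ?thesis using int4 by (subst nn_integral_eq_integral) (auto simp del: ennreal_plus intro: ennreal_leI)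
    qed
    have "(\<integral>\<^sup>+x. ennreal ((v x * L \<xi> x)\<^sup>2) \<partial>M) = (\<integral>\<^sup>+x. liminf (\<lambda>n. ennreal (g n x)) \<partial>M)"
    proof (rule nn_integral_cong_AE)
      show "AE x in M. ennreal ((v x * L \<xi> x)\<^sup>2) = liminf (\<lambda>n. ennreal (g n x))"
        using g_lim by eventually_elim (simp add: lim_imp_Liminf)
    qed
    also have "\<dots> \<le> liminf (\<lambda>n. \<integral>\<^sup>+x. ennreal (g n x) \<partial>M)" by (rule nn_integral_liminf) measurable
    also have "\<dots> \<le> liminf (\<lambda>n. ennreal ((1/2) ^ n + (N \<xi>)\<^sup>2))"
      using g_int by (intro Liminf_mono always_eventually) auto
    also have "\<dots> = ennreal ((N \<xi>)\<^sup>2)"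
    proof (rule lim_imp_Liminf)
      have "(\<lambda>n. (1/2) ^ n + (N \<xi>)\<^sup>2) \<longlonglongrightarrow> 0 + (N \<xi>)\<^sup>2" by (intro tendsto_intros LIMSEQ_power_zero) simp
      then show "(\<lambda>n. ennreal ((1/2) ^ n + (N \<xi>)\<^sup>2)) \<longlonglongrightarrow> ennreal ((N \<xi>)\<^sup>2)" by (intro tendsto_ennrealI) simp
    qed simp
    finally show ?thesis .
  qed

  \<comment> \<open>Where \<open>v\<close> vanishes, \<open>sum_sq (ws n)\<close> tends to infinity,
    so \<open>1 - exp (- (c * sum_sq (ws n) x))\<close> tends to 1 for every \<open>c > 0\<close>.
    But the squared norms in \<open>ws n\<close> add up to at most \<open>J (ws n) \<le> 2\<close>,
    so for small \<open>c\<close> its mean stays below any given \<open>\<epsilon>\<close>.\<close>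
  have "AE x in M. v x \<noteq> 0"
  proof -
    define Z where "Z = {x \<in> space M. v x = 0}"
    have [measurable]: "Z \<in> sets M" unfolding Z_def by measurable
    have "prob Z \<le> \<epsilon>" if \<epsilon>: "\<epsilon> > 0" for \<epsilon>
    proof -
      obtain K where K: "K \<ge> 0" "\<And>\<eta>. norm (f \<eta>) \<le> 1 \<Longrightarrow> 1 - \<epsilon> / 2 - K * (norm \<eta>)\<^sup>2 \<le> Re (f \<eta>)"
        using Re_ge_of_continuous_0[OF L_cont L_f_0, of "\<epsilon> / 2"] \<epsilon> by auto
      \<comment> \<open>Chosen so that \<open>K * (2 * c * 2) \<le> \<epsilon> / 2\<close>, where
        the last 2 bounds the sum of squared norms; adding 1 covers \<open>K = 0\<close>.\<close>
      define c where "c = \<epsilon> / 2 / (4 * K + 1)"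
      have K1: "4 * K + 1 > 0" using K by linarith
      have c: "c > 0" "K * (2 * c * 2) \<le> \<epsilon> / 2" using \<epsilon> K K1 by (auto simp: c_def field_simps)
      have intc: "integrable M (\<lambda>x. exp (- (c * sum_sq xs x)))" for xs using c by (intro integrable_exp_sum_sq) simp
      have "(\<lambda>n. expectation (\<lambda>x. indicator Z x * (1 - exp (- (c * sum_sq (ws n) x))))) \<longlonglongrightarrow> expectation (indicator Z :: 'a \<Rightarrow> real)"
      proof (rule integral_dominated_convergence[where w = "\<lambda>_. 1"])
        show "AE x in M. (\<lambda>n. indicator Z x * (1 - exp (- (c * sum_sq (ws n) x)))) \<longlonglongrightarrow> indicator Z x"
          using V_lim
        proof eventually_elim
          case (elim x)
          show ?case
          proof (cases "x \<in> Z")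
            case True
            then have "(\<lambda>n. V (ws n) x) \<longlonglongrightarrow> 0" using elim by (simp add: Z_def)
            then have "(\<lambda>n. V (ws n) x powr (2 * c)) \<longlonglongrightarrow> 0"
              using c by (intro tendsto_zero_powrI[where b = "2 * c"]) (auto simp: V01 less_imp_le)
            moreover have "V (ws n) x powr (2 * c) = exp (- (c * sum_sq (ws n) x))" for n
              by (simp add: powr_def V_def)
            ultimately have "(\<lambda>n. 1 - exp (- (c * sum_sq (ws n) x))) \<longlonglongrightarrow> 1 - 0"
              by (intro tendsto_diff) auto
            then show ?thesis using True by simp
          qed simp
        qed
        show "AE x in M. norm (indicator Z x * (1 - exp (- (c * sum_sq (ws n) x)))) \<le> 1" for n
          by (rule AE_I2) (use sum_sq_nonneg c in \<open>auto simp: indicator_def\<close>)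
      qed auto
      then have 1: "(\<lambda>n. expectation (\<lambda>x. indicator Z x * (1 - exp (- (c * sum_sq (ws n) x))))) \<longlonglongrightarrow> prob Z" by simp
      have "expectation (\<lambda>x. indicator Z x * (1 - exp (- (c * sum_sq (ws n) x)))) \<le> \<epsilon>" for n
      proof -
        have "expectation (\<lambda>x. indicator Z x * (1 - exp (- (c * sum_sq (ws n) x)))) \<le>
            expectation (\<lambda>x. 1 - exp (- (c * sum_sq (ws n) x)))"
        proof (rule integral_mono)
          show "integrable M (\<lambda>x. indicator Z x * (1 - exp (- (c * sum_sq (ws n) x))))"
            by (rule integrable_const_bound[where B = 1], rule AE_I2) (use sum_sq_nonneg c in \<open>auto simp: indicator_def\<close>)
        qed (use intc sum_sq_nonneg c in \<open>auto simp: indicator_def\<close>)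
        also have "\<dots> = 1 - expectation (\<lambda>x. exp (- (c * sum_sq (ws n) x)))"
          using intc by (simp add: prob_space)
        also have "\<dots> \<le> \<epsilon> / 2 + K * (2 * c * (\<Sum>\<xi>\<leftarrow>ws n. (norm \<xi>)\<^sup>2))"
          using expectation_exp_sum_sq_ge[OF K(2), of c "ws n"] c by simp
        also have "\<dots> \<le> \<epsilon> / 2 + K * (2 * c * 2)"
        proof -
          have "(\<Sum>\<xi>\<leftarrow>xs. (norm \<xi>)\<^sup>2) \<le> S xs" for xs
            unfolding S_def by (intro sum_list_mono power_mono N_ge) auto
          also have "S (ws n) \<le> J (ws n)" using E0 by (simp add: J_def)
          also have "\<dots> \<le> 2" using ws[of n] I1 power_le_one[of "1/4::real" n] by linarith
          finally show ?thesis using K c by (intro add_left_mono mult_left_mono) auto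
        qed
        also have "\<dots> \<le> \<epsilon>" using c by simp
        finally show ?thesis .
      qed
      then show ?thesis by (intro LIMSEQ_le_const2[OF 1]) auto
    qed
    then have "AE x in M. x \<notin> Z" by (intro AE_not_in_of_prob_le) auto
    then show ?thesis using AE_space by eventually_elim (auto simp: Z_def)
  qed
  moreover have "AE x in M. 0 \<le> v x"
    using V_lim by eventually_elim (rule LIMSEQ_le_const, auto simp: V01 less_imp_le)
  ultimately have v_pos: "AE x in M. 0 < v x" by eventually_elim auto

  have v_int: "integrable M (\<lambda>x. (v x * L \<xi> x)\<^sup>2)" for \<xi>
    by (rule integrableI_nonneg) (use bound[of \<xi>] in \<open>auto intro: le_less_trans\<close>)
  show ?thesis
  proof (rule that[OF v_meas v_pos v_int])
    fix \<xi>
    have "ennreal (\<integral>x. (v x * L \<xi> x)\<^sup>2 \<partial>M) \<le> ennreal ((N \<xi>)\<^sup>2)"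
      using bound[of \<xi>] nn_integral_eq_integral[OF v_int[of \<xi>]] by simp
    then show "(\<integral>x. (v x * L \<xi> x)\<^sup>2 \<partial>M) \<le> (N \<xi>)\<^sup>2" by (simp add: ennreal_le_iff)
  next
    fix \<tau> u
    assume \<tau> [measurable]: "\<tau> \<in> measurable M M" and distr: "distr M M \<tau> = M"
      and Nu: "\<And>\<xi>. N (u \<xi>) = N \<xi>" and Lu: "\<And>\<xi>. AE x in M. L \<xi> (\<tau> x) = L (u \<xi>) x"
    have AE_\<tau>: "AE x in M. P (\<tau> x)" if "AE x in M. P x" for P
    proof -
      have "AE x in distr M M \<tau>. P x" by (subst distr) (rule that)
      then show ?thesis by (rule AE_distrD[OF \<tau>])
    qed
    have sq: "AE x in M. sum_sq xs (\<tau> x) = sum_sq (map u xs) x" for xs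
    proof (induction xs)
      case (Cons \<xi> xs)
      then show ?case using Lu[of \<xi>] by eventually_elim simp
    qed simp
    have Eu: "E (map u xs) = E xs" for xs
    proof -
      have "E (map u xs) = expectation (\<lambda>x. exp (- sum_sq xs (\<tau> x)))"
        unfolding E_def using sq[of xs] by (intro integral_cong_AE) (auto elim: AE_mp)
      also have "\<dots> = (\<integral>x. exp (- sum_sq xs x) \<partial>distr M M \<tau>)" by (subst integral_distr) auto
      finally show ?thesis by (simp add: distr E_def)
    qed
    have Ju: "J (map u xs) = J xs" for xs by (simp add: J_def Eu S_def Nu o_def)
    \<comment> \<open>The transported families have the same values of \<open>J\<close>, so the
      distance estimate between two minimising sequences identifies their limits.\<close>
    have "AE x in M. summable (\<lambda>n. (V (map u (ws n)) x - V (ws n) x)\<^sup>2)"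
    proof (rule AE_summable_of_integral_bound[where c = "\<lambda>n. 2 * (1/4) ^ n"])
      show "(\<integral>x. (V (map u (ws n)) x - V (ws n) x)\<^sup>2 \<partial>M) \<le> 2 * (1/4) ^ n" for n
        using V_dist[of "map u (ws n)" "ws n"] ws[of n] by (simp add: Ju)
    qed (use V_int in \<open>auto intro!: summable_mult summable_geometric\<close>)
    moreover have "AE x in M. \<forall>n. sum_sq (ws n) (\<tau> x) = sum_sq (map u (ws n)) x"
      using sq unfolding AE_all_countable by blast
    ultimately show "AE x in M. v (\<tau> x) = v x"
      using V_lim AE_\<tau>[OF V_lim]
    proof eventually_elim
      case (elim x)
      have "(\<lambda>n. (V (map u (ws n)) x - V (ws n) x)\<^sup>2) \<longlonglongrightarrow> 0" using elim(1) by (rule summable_LIMSEQ_zero)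
      moreover have "V (map u (ws n)) x = V (ws n) (\<tau> x)" for n using elim(2) by (simp add: V_def)
      ultimately have "(\<lambda>n. (V (ws n) (\<tau> x) - V (ws n) x)\<^sup>2) \<longlonglongrightarrow> 0" by simp
      moreover have "(\<lambda>n. (V (ws n) (\<tau> x) - V (ws n) x)\<^sup>2) \<longlonglongrightarrow> (v (\<tau> x) - v x)\<^sup>2"
        by (intro tendsto_intros elim)
      ultimately have "(v (\<tau> x) - v x)\<^sup>2 = 0" by (rule LIMSEQ_unique[symmetric])
      then show ?case by simp
    qed
  qed
qed

subsection \<open>Uniqueness of joint laws\<close>

text \<open>A weight between 1 and 3 can be normalised, which turns the weighted law of
  \<open>Y\<close> into a probability on the line with known transform. The case
  \<open>s = 0\<close> shows that the two normalising constants agree.\<close>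

lemma weighted_law_eq:
  fixes M :: "'a measure" and M' :: "'b measure"
  assumes "prob_space M" "prob_space M'"
    and Y [measurable]: "Y \<in> borel_measurable M" and Y' [measurable]: "Y' \<in> borel_measurable M'"
    and G [measurable]: "G \<in> borel_measurable M" and G' [measurable]: "G' \<in> borel_measurable M'"
    and G_bd: "\<And>x. 1 \<le> G x \<and> G x \<le> 3" and G'_bd: "\<And>x. 1 \<le> G' x \<and> G' x \<le> 3"
    and eq: "\<And>s. (\<integral>x. G x *\<^sub>R cis (s * Y x) \<partial>M) = (\<integral>x. G' x *\<^sub>R cis (s * Y' x) \<partial>M')"
    and A [measurable]: "A \<in> sets borel"
  shows "(\<integral>x. G x * indicator A (Y x) \<partial>M) = (\<integral>x. G' x * indicator A (Y' x) \<partial>M')"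
proof -
  have aux: "\<exists>D m. real_distribution D \<and> m > 0 \<and> (\<forall>s. m *\<^sub>R char D s = (\<integral>x. G x *\<^sub>R cis (s * Y x) \<partial>M)) \<and>
      m * measure D A = (\<integral>x. G x * indicator A (Y x) \<partial>M)"
    if M: "prob_space M" and [measurable]: "Y \<in> borel_measurable M" "G \<in> borel_measurable M"
      and G: "\<And>x. 1 \<le> G x \<and> G x \<le> 3" for M :: "'c measure" and Y G :: "'c \<Rightarrow> real"
  proof -
    interpret prob_space M by fact
    define m where "m = (\<integral>x. G x \<partial>M)"
    have G_int: "integrable M G"
    proof (rule integrable_const_bound[where B = 3], rule AE_I2)
      show "norm (G x) \<le> 3" for x using G[of x] by simp
    qed measurable
    have "(\<integral>x. 1 \<partial>M) \<le> m" unfolding m_def using G_int G by (intro integral_mono) auto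
    then have m: "m > 0" by (simp add: prob_space)
    define N where "N = density M (\<lambda>x. ennreal (G x / m))"
    have G0: "0 \<le> G x / m" for x using G[of x] m by simp
    have "emeasure N (space N) = (\<integral>\<^sup>+x. ennreal (G x / m) \<partial>M)"
      unfolding N_def by (subst emeasure_density) (auto intro!: nn_integral_cong simp: space_density)
    also have "\<dots> = ennreal (\<integral>x. G x / m \<partial>M)"
      using G_int G0 by (intro nn_integral_eq_integral) auto
    also have "\<dots> = 1" using m by (simp add: m_def)
    finally have "prob_space N" by (rule prob_spaceI)
    moreover have [measurable]: "Y \<in> borel_measurable N" unfolding N_def by simp
    ultimately have D: "real_distribution (distr N borel Y)" by (rule prob_space.real_distribution_distr)
    have int: "(\<integral>y. h y \<partial>distr N borel Y) = (\<integral>x. (G x / m) *\<^sub>R h (Y x) \<partial>M)"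
      if [measurable]: "h \<in> borel_measurable borel" for h :: "real \<Rightarrow> 'd::{banach, second_countable_topology}"
    proof -
      have "(\<integral>y. h y \<partial>distr N borel Y) = (\<integral>x. h (Y x) \<partial>N)" by (rule integral_distr) measurable
      also have "\<dots> = (\<integral>x. (G x / m) *\<^sub>R h (Y x) \<partial>M)"
        unfolding N_def by (rule integral_density) (use G0 in auto)
      finally show ?thesis .
    qed
    have "m *\<^sub>R char (distr N borel Y) s = (\<integral>x. G x *\<^sub>R cis (s * Y x) \<partial>M)" for s
    proof -
      have "char (distr N borel Y) s = (\<integral>x. (G x / m) *\<^sub>R cis (s * Y x) \<partial>M)"
        unfolding char_def by (subst int) (auto simp: cis_conv_exp)
      also have "\<dots> = (\<integral>x. (1 / m) *\<^sub>R (G x *\<^sub>R cis (s * Y x)) \<partial>M)" by simp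
      also have "\<dots> = (1 / m) *\<^sub>R (\<integral>x. G x *\<^sub>R cis (s * Y x) \<partial>M)" by (rule integral_scaleR_right) 
      finally show ?thesis using m by simp
    qed
    moreover have "m * measure (distr N borel Y) A = (\<integral>x. G x * indicator A (Y x) \<partial>M)"
    proof -
      interpret D: real_distribution "distr N borel Y" by (rule D)
      have "measure (distr N borel Y) A = (\<integral>y. indicator A y \<partial>distr N borel Y)" by simp
      also have "\<dots> = (\<integral>x. (G x / m) *\<^sub>R indicator A (Y x) \<partial>M)" by (rule int) measurable
      also have "\<dots> = (\<integral>x. G x * indicator A (Y x) \<partial>M) / m" by simp
      finally show ?thesis using m by simp
    qed
    ultimately show ?thesis using D m by blast
  qed
  obtain D m where D: "real_distribution D" "m > 0" "\<And>s. m *\<^sub>R char D s = (\<integral>x. G x *\<^sub>R cis (s * Y x) \<partial>M)"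
      "m * measure D A = (\<integral>x. G x * indicator A (Y x) \<partial>M)"
    using aux[OF assms(1) Y G G_bd] by blast
  obtain D' m' where D': "real_distribution D'" "m' > 0" "\<And>s. m' *\<^sub>R char D' s = (\<integral>x. G' x *\<^sub>R cis (s * Y' x) \<partial>M')"
      "m' * measure D' A = (\<integral>x. G' x * indicator A (Y' x) \<partial>M')"
    using aux[OF assms(2) Y' G' G'_bd] by blast
  have e: "m *\<^sub>R char D s = m' *\<^sub>R char D' s" for s by (simp add: D(3) D'(3) eq)
  from e[of 0] have "m = m'"
    by (simp add: real_distribution.char_zero[OF D(1)] real_distribution.char_zero[OF D'(1)] scaleR_conv_of_real)
  then have "char D = char D'" using e D(2) by (intro ext) simp
  then have "D = D'" by (rule Levy_uniqueness[OF D(1) D'(1)])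
  then show ?thesis using D(4) D'(4) \<open>m = m'\<close> by simp
qed

text \<open>
  The joint law is recovered one coordinate at a time.  Adding the constant \<open>2\<close> to a bounded weight makes it
  positive, so that Levy's uniqueness theorem on the line applies.
\<close>

lemma indicator_cis_eq:
  fixes M :: "'a measure" and M' :: "'b measure" and X :: "nat \<Rightarrow> 'a \<Rightarrow> real" and X' :: "nat \<Rightarrow> 'b \<Rightarrow> real"
  assumes M: "prob_space M" and M': "prob_space M'"
    and X [measurable]: "\<And>i. X i \<in> borel_measurable M" and X' [measurable]: "\<And>i. X' i \<in> borel_measurable M'"
    and char: "\<And>n t. (\<integral>x. cis (\<Sum>i<n. t i * X i x) \<partial>M) = (\<integral>x. cis (\<Sum>i<n. t i * X' i x) \<partial>M')"
    and A [measurable]: "\<And>i. A i \<in> sets borel"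
  shows "(\<integral>x. (\<Prod>i<k. indicator (A i) (X i x)) *\<^sub>R cis (\<Sum>i<n. t i * X i x) \<partial>M) =
    (\<integral>x. (\<Prod>i<k. indicator (A i) (X' i x)) *\<^sub>R cis (\<Sum>i<n. t i * X' i x) \<partial>M')"
proof (induction k arbitrary: n t)
  case 0
  then show ?case using char by simp
next
  case (Suc k)
  define P where "P x = (\<Prod>i<k. indicator (A i) (X i x) :: real)" for x
  define P' where "P' x = (\<Prod>i<k. indicator (A i) (X' i x) :: real)" for x
  have [measurable]: "P \<in> borel_measurable M" "P' \<in> borel_measurable M'" unfolding P_def P'_def by measurable
  have P01: "0 \<le> P x \<and> P x \<le> 1" "0 \<le> P' y \<and> P' y \<le> 1" for x y
    unfolding P_def P'_def by (auto intro!: prod_nonneg prod_le_1)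
  define \<theta> where "\<theta> x = (\<Sum>i<n. t i * X i x)" for x
  define \<theta>' where "\<theta>' x = (\<Sum>i<n. t i * X' i x)" for x
  have [measurable]: "\<theta> \<in> borel_measurable M" "\<theta>' \<in> borel_measurable M'" unfolding \<theta>_def \<theta>'_def by measurable
  interpret M: prob_space M by fact
  interpret M': prob_space M' by fact
  have cis_meas [measurable]: "cis \<in> borel_measurable borel"
    unfolding cis_conv_exp[abs_def] by measurable
  have int: "integrable M (\<lambda>x. W x *\<^sub>R cis (Z x))"
    if [measurable]: "W \<in> borel_measurable M" "Z \<in> borel_measurable M" and "\<And>x. \<bar>W x\<bar> \<le> 3" for W Z
    by (rule M.integrable_const_bound[where B = 3]) (use that in auto)
  have int': "integrable M' (\<lambda>x. W x *\<^sub>R cis (Z x))"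
    if [measurable]: "W \<in> borel_measurable M'" "Z \<in> borel_measurable M'" and "\<And>x. \<bar>W x\<bar> \<le> 3" for W Z
    by (rule M'.integrable_const_bound[where B = 3]) (use that in auto)
  \<comment> \<open>The phase is again a linear combination of coordinates, with coefficients
    \<open>r\<close>, so the induction hypothesis covers it.\<close>
  have IH: "(\<integral>x. P x *\<^sub>R cis (a * \<theta> x + s * X k x) \<partial>M) = (\<integral>x. P' x *\<^sub>R cis (a * \<theta>' x + s * X' k x) \<partial>M')" for a s
  proof -
    define r where "r i = (if i < n then a * t i else 0) + (if i = k then s else 0)" for i
    have eq: "a * (\<Sum>i<n. t i * y i) + s * y k = (\<Sum>i<max n (Suc k). r i * y i)" for y :: "nat \<Rightarrow> real"
    proof -
      have "(\<Sum>i<max n (Suc k). r i * y i) =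
          (\<Sum>i<max n (Suc k). if i < n then a * t i * y i else 0) + (\<Sum>i<max n (Suc k). if i = k then s * y i else 0)"
        unfolding r_def sum.distrib[symmetric] by (intro sum.cong) (auto simp: distrib_right)
      also have "(\<Sum>i<max n (Suc k). if i < n then a * t i * y i else 0) = (\<Sum>i<n. a * t i * y i)"
        by (intro sum.mono_neutral_cong_right) auto
      finally show ?thesis by (simp add: sum_distrib_left mult.assoc)
    qed
    show ?thesis
      unfolding \<theta>_def \<theta>'_def P_def P'_def eq[of "\<lambda>i. X i x" for x] eq[of "\<lambda>i. X' i x" for x]
      by (rule Suc.IH)
  qed
  have char_k: "(\<integral>x. cis (s * X k x) \<partial>M) = (\<integral>x. cis (s * X' k x) \<partial>M')" for s
    using char[of "\<lambda>i. if i = k then s else 0" "Suc k"] by simp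
  have real_part: "(\<integral>x. indicator (A k) (X k x) * (P x * cos (\<theta> x - b)) \<partial>M) =
      (\<integral>x. indicator (A k) (X' k x) * (P' x * cos (\<theta>' x - b)) \<partial>M')" for b
  proof -
    have PC: "\<bar>P x * cos (\<theta> x - b)\<bar> \<le> 1" "\<bar>P' y * cos (\<theta>' y - b)\<bar> \<le> 1" for x y
      using P01 by (auto simp: abs_mult intro!: mult_le_one)
    define G where "G x = 2 + P x * cos (\<theta> x - b)" for x
    define G' where "G' x = 2 + P' x * cos (\<theta>' x - b)" for x
    have [measurable]: "G \<in> borel_measurable M" "G' \<in> borel_measurable M'" unfolding G_def G'_def by measurable
    have G_bd: "1 \<le> G x \<and> G x \<le> 3" "1 \<le> G' y \<and> G' y \<le> 3" for x y
      using PC(1)[of x] PC(2)[of y] by (auto simp: G_def G'_def)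
    \<comment> \<open>Writing the cosine as the mean of two exponentials expresses the transform of
      the weighted law through \<open>char_k\<close> and \<open>IH\<close> with \<open>a = 1\<close>
      and \<open>a = -1\<close>.\<close>
    have G_exp: "(2 + p * cos (h - b)) *\<^sub>R cis y = 2 * cis y + (cis (-b) / 2) * (p *\<^sub>R cis (1 * h + y)) + (cis b / 2) * (p *\<^sub>R cis ((-1) * h + y))"
      for p h y
      by (simp add: complex_eq_iff cos_add sin_add cos_diff sin_diff field_simps)
    have 1: "(\<integral>x. G x *\<^sub>R cis (s * X k x) \<partial>M) = (\<integral>x. G' x *\<^sub>R cis (s * X' k x) \<partial>M')" for s
    proof -
      have "integrable M (\<lambda>x. cis (s * X k x))" "integrable M' (\<lambda>x. cis (s * X' k x))"
        using int[of "\<lambda>_. 1"] int'[of "\<lambda>_. 1"] by auto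
      moreover have "integrable M (\<lambda>x. P x *\<^sub>R cis (a * \<theta> x + s * X k x))"
        "integrable M' (\<lambda>x. P' x *\<^sub>R cis (a * \<theta>' x + s * X' k x))" for a
      proof -
        have "\<bar>P x\<bar> \<le> 3" "\<bar>P' y\<bar> \<le> 3" for x y using P01(1)[of x] P01(2)[of y] by auto
        then show "integrable M (\<lambda>x. P x *\<^sub>R cis (a * \<theta> x + s * X k x))"
          "integrable M' (\<lambda>x. P' x *\<^sub>R cis (a * \<theta>' x + s * X' k x))" by (auto intro!: int int')
      qed
      ultimately show ?thesis unfolding G_def G'_def G_exp by (simp only: Bochner_Integration.integral_add
            Bochner_Integration.integrable_add integrable_mult_right integral_mult_right_zero IH char_k)
    qed
    have 2: "(\<integral>x. G x * indicator (A k) (X k x) \<partial>M) = (\<integral>x. G' x * indicator (A k) (X' k x) \<partial>M')"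
      by (rule weighted_law_eq[OF M M']) (use G_bd 1 in auto)
    have 3: "(\<integral>x. 1 * indicator (A k) (X k x) \<partial>M) = (\<integral>x. (1::real) * indicator (A k) (X' k x) \<partial>M')"
      by (rule weighted_law_eq[OF M M']) (use char_k in auto)
    have "integrable M (\<lambda>x. indicator (A k) (X k x) :: real)" "integrable M' (\<lambda>x. indicator (A k) (X' k x) :: real)"
      by (auto intro!: M.integrable_const_bound[where B = 1] M'.integrable_const_bound[where B = 1])
    moreover have "integrable M (\<lambda>x. G x * indicator (A k) (X k x))" "integrable M' (\<lambda>x. G' x * indicator (A k) (X' k x))"
    proof -
      have "norm (G x * indicator (A k) (X k x)) \<le> 3" "norm (G' y * indicator (A k) (X' k y)) \<le> 3" for x y
        using G_bd(1)[of x] G_bd(2)[of y] by (auto simp: indicator_def)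
      then show "integrable M (\<lambda>x. G x * indicator (A k) (X k x))" "integrable M' (\<lambda>x. G' x * indicator (A k) (X' k x))"
        by (auto intro!: M.integrable_const_bound[where B = 3] M'.integrable_const_bound[where B = 3])
    qed
    moreover have "indicator (A k) (X k x) * (P x * cos (\<theta> x - b)) = G x * indicator (A k) (X k x) - 2 * indicator (A k) (X k x)"
      "indicator (A k) (X' k y) * (P' y * cos (\<theta>' y - b)) = G' y * indicator (A k) (X' k y) - 2 * indicator (A k) (X' k y)" for x y
      by (simp_all add: G_def G'_def algebra_simps)
    ultimately show ?thesis using 2 3 by simp
  qed
  \<comment> \<open>Real and imaginary part are both cosines, with shifts 0 and
    \<open>pi / 2\<close>; this is why \<open>real_part\<close> carries the shift
    \<open>b\<close>.\<close>
  have cis_split: "(p * q) *\<^sub>R cis h = complex_of_real (q * (p * cos (h - 0))) + \<i> * complex_of_real (q * (p * cos (h - pi / 2)))" for p q h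
    by (simp add: complex_eq_iff cos_diff)
  have "(\<integral>x. (P x * indicator (A k) (X k x)) *\<^sub>R cis (\<theta> x) \<partial>M) =
      complex_of_real (\<integral>x. indicator (A k) (X k x) * (P x * cos (\<theta> x - 0)) \<partial>M) +
      \<i> * complex_of_real (\<integral>x. indicator (A k) (X k x) * (P x * cos (\<theta> x - pi / 2)) \<partial>M)"
  proof -
    have "integrable M (\<lambda>x. indicator (A k) (X k x) * (P x * cos (\<theta> x - b)))" for b
      by (rule M.integrable_const_bound[where B = 1], rule AE_I2)
        (use P01 in \<open>auto simp: abs_mult indicator_def intro!: mult_le_one\<close>)
    then show ?thesis
      unfolding cis_split by (simp only: Bochner_Integration.integral_add integrable_of_real
          integrable_mult_right integral_mult_right_zero integral_complex_of_real)
  qed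
  also have "\<dots> = complex_of_real (\<integral>x. indicator (A k) (X' k x) * (P' x * cos (\<theta>' x - 0)) \<partial>M') +
      \<i> * complex_of_real (\<integral>x. indicator (A k) (X' k x) * (P' x * cos (\<theta>' x - pi / 2)) \<partial>M')"
    unfolding real_part ..
  also have "\<dots> = (\<integral>x. (P' x * indicator (A k) (X' k x)) *\<^sub>R cis (\<theta>' x) \<partial>M')"
  proof -
    have "integrable M' (\<lambda>x. indicator (A k) (X' k x) * (P' x * cos (\<theta>' x - b)))" for b
      by (rule M'.integrable_const_bound[where B = 1], rule AE_I2)
        (use P01 in \<open>auto simp: abs_mult indicator_def intro!: mult_le_one\<close>)
    then show ?thesis
      unfolding cis_split by (simp only: Bochner_Integration.integral_add integrable_of_real
          integrable_mult_right integral_mult_right_zero integral_complex_of_real)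
  qed
  finally show ?case by (simp add: P_def P'_def \<theta>_def \<theta>'_def)
qed

text \<open>Cylinder sets determine a law on the product, and \<open>indicator_cis_eq\<close> with
  an empty character gives their probabilities.\<close>

lemma joint_law_eq_of_char:
  fixes M :: "'a measure" and M' :: "'b measure" and X :: "nat \<Rightarrow> 'a \<Rightarrow> real" and X' :: "nat \<Rightarrow> 'b \<Rightarrow> real"
  assumes M: "prob_space M" and M': "prob_space M'"
    and X [measurable]: "\<And>i. X i \<in> borel_measurable M" and X' [measurable]: "\<And>i. X' i \<in> borel_measurable M'"
    and char: "\<And>n t. (\<integral>x. cis (\<Sum>i<n. t i * X i x) \<partial>M) = (\<integral>x. cis (\<Sum>i<n. t i * X' i x) \<partial>M')"
  shows "distr M borel (\<lambda>x i. X i x) = distr M' borel (\<lambda>x i. X' i x)"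
proof (rule measure_eqI_PiM_infinite)
  interpret M: prob_space M by fact
  interpret M': prob_space M' by fact
  have [measurable]: "(\<lambda>x i. X i x) \<in> borel_measurable M" "(\<lambda>x i. X' i x) \<in> borel_measurable M'"
    by (auto intro!: measurable_coordinatewise_then_product)
  show "sets (distr M borel (\<lambda>x i. X i x)) = sets (Pi\<^sub>M UNIV (\<lambda>_. borel))"
    "sets (distr M' borel (\<lambda>x i. X' i x)) = sets (Pi\<^sub>M UNIV (\<lambda>_. borel))"
    by (simp_all add: sets_PiM_equal_borel)
  show "finite_measure (distr M borel (\<lambda>x i. X i x))"
    by (intro prob_space.finite_measure M.prob_space_distr) measurable
  fix A :: "nat \<Rightarrow> real set" and J :: "nat set"
  assume J: "finite J" and AJ: "\<And>i. i \<in> J \<Longrightarrow> A i \<in> sets borel"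
  \<comment> \<open>Padding by \<open>UNIV\<close> turns a finite index set into an initial
    segment.\<close>
  define B where "B i = (if i \<in> J then A i else UNIV)" for i
  have B [measurable]: "B i \<in> sets borel" for i using AJ by (simp add: B_def)
  obtain k where k: "J \<subseteq> {..<k}" using J finite_nat_iff_bounded by auto
  let ?E = "prod_emb UNIV (\<lambda>_. borel) J (Pi\<^sub>E J A) :: (nat \<Rightarrow> real) set"
  have E: "?E \<in> sets borel"
    using J AJ unfolding sets_PiM_equal_borel[symmetric] by (intro sets_PiM_I) auto
  have mem: "indicator ?E y = (\<Prod>i<k. indicator (B i) (y i) :: real)" for y
  proof (cases "y \<in> ?E")
    case True
    then have "y i \<in> B i" for i by (auto simp: prod_emb_iff B_def PiE_iff)
    then show ?thesis using True by simp
  next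
    case False
    then obtain i where "i \<in> J" "y i \<notin> A i" by (auto simp: prod_emb_iff restrict_def PiE_iff extensional_def)
    then have "i \<in> {..<k}" "indicator (B i) (y i) = (0::real)" using k by (auto simp: B_def)
    then show ?thesis using False prod_zero[of "{..<k}" "\<lambda>i. indicator (B i) (y i) :: real"] by auto
  qed
  have "(\<integral>x. (\<Prod>i<k. indicator (B i) (X i x)) *\<^sub>R cis (\<Sum>i<0. 0 * X i x) \<partial>M) =
      (\<integral>x. (\<Prod>i<k. indicator (B i) (X' i x)) *\<^sub>R cis (\<Sum>i<0. 0 * X' i x) \<partial>M')"
    by (rule indicator_cis_eq[OF M M' X X' char B])
  then have "(\<integral>x. complex_of_real (indicator ?E (\<lambda>i. X i x)) \<partial>M) = (\<integral>x. complex_of_real (indicator ?E (\<lambda>i. X' i x)) \<partial>M')"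
    unfolding mem by (simp add: scaleR_conv_of_real)
  then have *: "(\<integral>x. indicator ?E (\<lambda>i. X i x) \<partial>M) = (\<integral>x. indicator ?E (\<lambda>i. X' i x) \<partial>M' :: real)"
    unfolding integral_complex_of_real of_real_eq_iff .
  interpret D: prob_space "distr M borel (\<lambda>x i. X i x)" by (intro M.prob_space_distr) measurable
  interpret D': prob_space "distr M' borel (\<lambda>x i. X' i x)" by (intro M'.prob_space_distr) measurable
  have "measure (distr M borel (\<lambda>x i. X i x)) ?E = (\<integral>y. indicator ?E y \<partial>distr M borel (\<lambda>x i. X i x))"
    using E by simp
  also have "\<dots> = (\<integral>x. indicator ?E (\<lambda>i. X i x) \<partial>M)" using E by (subst integral_distr) auto
  also have "\<dots> = (\<integral>y. indicator ?E y \<partial>distr M' borel (\<lambda>x i. X' i x))"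
    unfolding * using E by (subst integral_distr) auto
  also have "\<dots> = measure (distr M' borel (\<lambda>x i. X' i x)) ?E" using E by simp
  finally show "emeasure (distr M borel (\<lambda>x i. X i x)) ?E = emeasure (distr M' borel (\<lambda>x i. X' i x)) ?E"
    by (simp add: D.emeasure_eq_measure D'.emeasure_eq_measure)
qed

subsection \<open>The cube and almost everywhere defined automorphisms\<close>

definition cube :: "(nat \<Rightarrow> real) set" where
  "cube = {x. \<forall>i. x i \<in> {- (pi / 2)..pi / 2}}"

lemma compact_cube: "compact cube"
proof -
  have "cube = PiE UNIV (\<lambda>_. {- (pi / 2)..pi / 2})" by (auto simp: cube_def PiE_iff)
  moreover have "compactin (product_topology (\<lambda>_::nat. euclidean :: real topology) UNIV) (PiE UNIV (\<lambda>_. {- (pi / 2)..pi / 2}))"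
    by (subst compactin_PiE) auto
  ultimately show ?thesis by (simp add: euclidean_product_topology)
qed

lemma cube_borel [measurable]: "cube \<in> sets borel"
  using compact_cube by (simp add: compact_imp_closed)

lemma sets_borel_of_top_of_set:
  fixes S :: "'a::topological_space set"
  assumes "S \<in> sets borel"
  shows "sets (borel_of (top_of_set S)) = sets (restrict_space borel S)"
proof -
  have "sets (borel_of (top_of_set S)) = sigma_sets S {U. openin (top_of_set S) U}"
    unfolding borel_of_def by (subst sets_measure_of) (auto dest!: openin_imp_subset)
  also have "{U. openin (top_of_set S) U} = (\<inter>) S ` {U. open U}"
    by (auto simp: openin_open)
  also have "sigma_sets S ((\<inter>) S ` {U. open U}) = (\<inter>) S ` sigma_sets UNIV {U. open U}"
    by (subst sigma_sets_Int) (use assms in \<open>auto simp: borel_def\<close>)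
  also have "\<dots> = sets (restrict_space borel S)"
    by (simp add: sets_restrict_space borel_def)
  finally show ?thesis .
qed

text \<open>Members of \<open>mp_bij\<close> are bijections of the whole space, but the transport
  maps below invert each other only almost everywhere. The remedy is to keep \<open>S\<close> on a
  conull set invariant under both maps and to use the identity elsewhere.\<close>

lemma mp_bij_modification:
  assumes S [measurable]: "S \<in> measurable M M" and T [measurable]: "T \<in> measurable M M"
    and dS: "distr M M S = M" and dT: "distr M M T = M"
    and ST: "AE x in M. S (T x) = x" and TS: "AE x in M. T (S x) = x"
  obtains \<sigma> where "\<sigma> \<in> mp_bij M" "AE x in M. \<sigma> x = S x"
proof -
  have AE_pres: "AE x in M. P ((g ^^ n) x)"
    if g: "g \<in> measurable M M" "distr M M g = M" and P: "AE x in M. P x" for g P n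
  proof (induction n)
    case (Suc n)
    have "AE x in distr M M g. P ((g ^^ n) x)" by (subst g(2)) (rule Suc)
    then have "AE x in M. P ((g ^^ n) (g x))" by (rule AE_distrD[OF g(1)])
    then show ?case by (simp add: funpow_swap1)
  qed (use P in simp)
  have "AE x in M. S (T x) = x \<and> T (S x) = x" using ST TS by eventually_elim simp
  then obtain N where "{x \<in> space M. \<not> (S (T x) = x \<and> T (S x) = x)} \<subseteq> N" "emeasure M N = 0" "N \<in> sets M"
    by (rule AE_E)
  then have N: "{x \<in> space M. \<not> (S (T x) = x \<and> T (S x) = x)} \<subseteq> N" "N \<in> null_sets M" by auto
  define B where "B = space M - N"
  have [measurable]: "B \<in> sets M" using N(2) unfolding B_def by auto
  have B: "x \<in> space M" "S (T x) = x" "T (S x) = x" if "x \<in> B" for x using that N(1) by (auto simp: B_def)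
  have AE_B: "AE x in M. x \<in> B" using AE_not_in[OF N(2)] AE_space by eventually_elim (simp add: B_def)
  have pow [measurable]: "S ^^ n \<in> measurable M M" "T ^^ n \<in> measurable M M" for n
    by (induction n) (auto intro: measurable_comp simp: id_def[symmetric])
  \<comment> \<open>Whole forward orbits under \<open>S\<close> and under \<open>T\<close> have to
    stay in \<open>B\<close>; then both maps send \<open>A\<close> into itself and are inverse to
    each other there.\<close>
  define A where "A = {x \<in> space M. \<forall>n. (S ^^ n) x \<in> B \<and> (T ^^ n) x \<in> B}"
  have A_meas [measurable]: "A \<in> sets M"
    unfolding A_def by measurable
  have AE_A: "AE x in M. x \<in> A"
  proof -
    have "AE x in M. \<forall>n. (S ^^ n) x \<in> B \<and> (T ^^ n) x \<in> B"
      unfolding AE_all_countable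
      by (intro allI AE_conjI AE_pres[where P = "\<lambda>x. x \<in> B"] S T dS dT AE_B)
    then show ?thesis using AE_space by eventually_elim (simp add: A_def)
  qed
  have A_B: "x \<in> B" if "x \<in> A" for x using that unfolding A_def by (auto dest: spec[of _ 0])
  have shift: "(h ^^ n) (h x) = (h ^^ Suc n) x" for h :: "'a \<Rightarrow> 'a" and n x by (simp add: funpow_swap1)
  have S_A: "S x \<in> A" if x: "x \<in> A" for x
  proof -
    have "(T ^^ n) (S x) \<in> B" for n
    proof (cases n)
      case 0
      have "(S ^^ Suc 0) x \<in> B" using x unfolding A_def by blast
      then show ?thesis using 0 by simp
    next
      case (Suc m)
      have "(T ^^ Suc m) (S x) = (T ^^ m) x" unfolding shift[symmetric] B(3)[OF A_B[OF x]] ..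
      then show ?thesis using x Suc unfolding A_def by auto
    qed
    moreover have "(S ^^ n) (S x) \<in> B" for n unfolding shift using x unfolding A_def by blast
    moreover have "S x \<in> space M" using x measurable_space[OF S, of x] by (simp add: A_def)
    ultimately show ?thesis unfolding A_def by blast
  qed
  have T_A: "T x \<in> A" if x: "x \<in> A" for x
  proof -
    have "(S ^^ n) (T x) \<in> B" for n
    proof (cases n)
      case 0
      have "(T ^^ Suc 0) x \<in> B" using x unfolding A_def by blast
      then show ?thesis using 0 by simp
    next
      case (Suc m)
      have "(S ^^ Suc m) (T x) = (S ^^ m) x" unfolding shift[symmetric] B(2)[OF A_B[OF x]] ..
      then show ?thesis using x Suc unfolding A_def by auto
    qed
    moreover have "(T ^^ n) (T x) \<in> B" for n unfolding shift using x unfolding A_def by blast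
    moreover have "T x \<in> space M" using x measurable_space[OF T, of x] by (simp add: A_def)
    ultimately show ?thesis unfolding A_def by blast
  qed
  have A_sub: "A \<subseteq> space M" by (auto simp: A_def)
  define \<sigma> where "\<sigma> = (\<lambda>x\<in>space M. if x \<in> A then S x else x)"
  define \<rho> where "\<rho> x = (if x \<in> A then T x else x)" for x
  have \<sigma>_space: "\<sigma> x \<in> space M" if "x \<in> space M" for x using that S_A A_sub by (auto simp: \<sigma>_def)
  have \<rho>_space: "\<rho> x \<in> space M" if "x \<in> space M" for x using that T_A A_sub by (auto simp: \<rho>_def)
  have \<rho>\<sigma>: "\<rho> (\<sigma> x) = x" if "x \<in> space M" for x using that S_A B(3)[OF A_B] by (auto simp: \<sigma>_def \<rho>_def)
  have \<sigma>\<rho>: "\<sigma> (\<rho> x) = x" if "x \<in> space M" for x using that T_A A_sub B(2)[OF A_B] by (auto simp: \<sigma>_def \<rho>_def)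
  have bij: "bij_betw \<sigma> (space M) (space M)"
    by (rule bij_betw_byWitness[where f' = \<rho>]) (use \<sigma>_space \<rho>_space \<rho>\<sigma> \<sigma>\<rho> in auto)
  have \<sigma>_meas: "\<sigma> \<in> measurable M M"
  proof -
    have "(\<lambda>x. if x \<in> A then S x else x) \<in> measurable M M" by measurable
    then show ?thesis by (rule measurable_cong[THEN iffD1, rotated]) (simp add: \<sigma>_def)
  qed
  have \<rho>_meas: "\<rho> \<in> measurable M M" unfolding \<rho>_def by measurable
  have "inv_into (space M) \<sigma> x = \<rho> x" if "x \<in> space M" for x
    using inv_into_f_f[of \<sigma> "space M" "\<rho> x"] bij \<sigma>\<rho>[OF that] \<rho>_space[OF that] by (simp add: bij_betw_def)
  then have inv_meas: "inv_into (space M) \<sigma> \<in> measurable M M"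
    using \<rho>_meas measurable_cong by blast
  have AE_\<sigma>: "AE x in M. \<sigma> x = S x" using AE_A AE_space by eventually_elim (simp add: \<sigma>_def)
  have "distr M M \<sigma> = distr M M S" by (rule distr_cong_AE) (use AE_\<sigma> \<sigma>_meas in auto)
  then have "\<sigma> \<in> mp_bij M"
    using bij \<sigma>_meas inv_meas dS unfolding mp_bij_def Bij_def by (auto simp: \<sigma>_def)
  then show ?thesis using AE_\<sigma> by (rule that)
qed

lemma AE_mp_bij_inv:
  assumes "\<theta> \<in> mp_bij M" "AE x in M. P (\<theta> x)"
  shows "AE x in M. P x"
proof -
  have m: "\<theta> \<in> measurable M M" "inv_into (space M) \<theta> \<in> measurable M M" "distr M M \<theta> = M"
    and b: "bij_betw \<theta> (space M) (space M)"
    using assms by (auto simp: mp_bij_def Bij_def)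
  have "distr M M (inv_into (space M) \<theta>) = distr (distr M M \<theta>) M (inv_into (space M) \<theta>)" using m by simp
  also have "\<dots> = distr M M (inv_into (space M) \<theta> \<circ> \<theta>)" by (rule distr_distr[OF m(2,1)])
  also have "\<dots> = distr M M (\<lambda>x. x)"
    using b by (intro distr_cong) (auto simp: bij_betw_def)
  finally have d: "distr M M (inv_into (space M) \<theta>) = M" by simp
  have "AE x in distr M M (inv_into (space M) \<theta>). P (\<theta> x)" by (subst d) (rule assms(2))
  then have "AE x in M. P (\<theta> (inv_into (space M) \<theta> x))" by (rule AE_distrD[OF m(2)])
  then show ?thesis using AE_space
    by eventually_elim (use b in \<open>simp add: bij_betw_def f_inv_into_f\<close>)
qed

lemma abs_arctan_diff_le: "\<bar>arctan p - arctan q\<bar> \<le> \<bar>p - q\<bar>"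
proof -
  have *: "arctan b - arctan a \<le> b - a" if ab: "a < b" for a b :: real
  proof -
    obtain z where "arctan b - arctan a = (b - a) * inverse (1 + z\<^sup>2)"
      using MVT2[OF ab, of arctan "\<lambda>x. inverse (1 + x\<^sup>2)"] DERIV_arctan by blast
    also have "\<dots> \<le> (b - a) * 1" using ab by (intro mult_left_mono) (auto simp: inverse_le_1_iff)
    finally show ?thesis by simp
  qed
  show ?thesis
    using *[of p q] *[of q p] arctan_monotone[of p q] arctan_monotone[of q p] by (cases p q rule: linorder_cases) (auto simp: abs_if)
qed

subsection \<open>Transport along symmetries\<close>

text \<open>The strict lower bound makes the sets shrink to the empty set, even if \<open>g\<close>
  vanishes on a large set.\<close>

lemma (in finite_measure) measure_small_positive:
  fixes g :: "'a \<Rightarrow> real"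
  assumes [measurable]: "g \<in> borel_measurable M" and e: "e > 0"
  obtains n where "measure M {x \<in> space M. 0 < g x \<and> g x < inverse (real (Suc n))} < e"
proof -
  let ?A = "\<lambda>n. {x \<in> space M. 0 < g x \<and> g x < inverse (real (Suc n))}"
  have "(\<lambda>n. measure M (?A n)) \<longlonglongrightarrow> measure M (\<Inter>n. ?A n)"
  proof (rule finite_Lim_measure_decseq)
    show "decseq ?A"
    proof (unfold decseq_def, intro allI impI subsetI)
      fix m n :: nat and x assume "m \<le> n" and x: "x \<in> ?A n"
      then have "inverse (real (Suc n)) \<le> inverse (real (Suc m))" by (intro le_imp_inverse_le) auto
      moreover have "g x < inverse (real (Suc n))" using x by blast
      ultimately have "g x < inverse (real (Suc m))" by linarith
      with x show "x \<in> ?A m" by blast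
    qed
  qed auto
  moreover have "x \<notin> (\<Inter>n. ?A n)" for x
  proof
    assume x: "x \<in> (\<Inter>n. ?A n)"
    then have "0 < g x" by blast
    then obtain n where "inverse (real (Suc n)) < g x" using reals_Archimedean by blast
    moreover have "g x < inverse (real (Suc n))" using x by blast
    ultimately show False by linarith
  qed
  then have "(\<Inter>n. ?A n) = {}" by blast
  ultimately have "(\<lambda>n. measure M (?A n)) \<longlonglongrightarrow> 0" by simp
  then have "\<forall>\<^sub>F n in sequentially. measure M (?A n) < e" using e by (rule order_tendstoD(2))
  then show ?thesis using that by (auto simp: eventually_sequentially)
qed

section \<open>Continuity in probability of the process\<close>

lemma (in linear_process) L_diff_related:
  "(\<xi> - \<eta>, \<lambda>x. L \<xi> x - L \<eta> x) \<in> related"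
proof -
  have R: "(\<xi>, L \<xi>) \<in> related" for \<xi> by (simp add: related_def)
  have "(\<xi> + (-1) *\<^sub>R \<eta>, \<lambda>x. L \<xi> x + (-1) * L \<eta> x) \<in> related"
    by (intro R_add R_scale R)
  then show ?thesis by simp
qed

lemma (in linear_process) L_diff_prob_small:
  assumes "\<kappa> > 0" "\<epsilon> > 0"
  obtains \<delta> where "\<delta> > 0" "\<And>\<xi> \<eta>. norm (\<xi> - \<eta>) < \<delta> \<Longrightarrow> \<P>(x in M. \<kappa> \<le> \<bar>L \<xi> x - L \<eta> x\<bar>) \<le> \<epsilon>"
proof -
  obtain \<delta> where "\<delta> > 0" and \<delta>: "\<And>\<eta> Y. (\<eta>, Y) \<in> related \<Longrightarrow>
      norm \<eta> < \<delta> \<Longrightarrow> \<P>(x in M. \<kappa> \<le> \<bar>Y x\<bar>) \<le> \<epsilon>"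
    by (rule R_prob_small[OF assms]) blast
  show ?thesis
    by (rule that[OF \<open>\<delta> > 0\<close>]) (rule \<delta>[OF L_diff_related])
qed

lemma (in linear_process) L_sum:
  fixes t :: "nat \<Rightarrow> real" shows
  "AE x in M. L (\<Sum>i<n. t i *\<^sub>R \<xi> i) x = (\<Sum>i<n. t i * L (\<xi> i) x)"
proof (induction n)
  case 0
  then show ?case using L_scale[of 0 0] by simp
next
  case (Suc n)
  then show ?case using L_add[of "\<Sum>i<n. t i *\<^sub>R \<xi> i" "t n *\<^sub>R \<xi> n"] L_scale[of "t n" "\<xi> n"]
    by eventually_elim simp
qed

text \<open>The coordinates play the role of \<open>arctan (L (d i))\<close>. The condition
  \<open>arctan_tan\<close> says that the faces \<open>x i = pi / 2\<close> and
  \<open>x i = - pi / 2\<close> are null.\<close>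

locale cube_process = linear_process M f L
  for M :: "(nat \<Rightarrow> real) measure" and f :: "'h::real_inner \<Rightarrow> complex" and L +
  fixes d :: "nat \<Rightarrow> 'h"
  assumes sets_M: "sets M = sets (restrict_space borel cube)"
    and L_d: "AE x in M. L (d i) x = tan (x i)"
    and arctan_tan: "AE x in M. arctan (tan (x i)) = x i"
    and d_dense: "closure (range d) = UNIV"
begin

lemma space_M: "space M = cube"
  using sets_eq_imp_space_eq[OF sets_M] by (simp add: space_restrict_space)

lemma sets_M_borel: "A \<in> sets M \<longleftrightarrow> A \<in> sets borel \<and> A \<subseteq> cube"
  by (simp add: sets_M sets_restrict_space_iff conj_commute)

lemma coordinate_measurable [measurable]: "(\<lambda>x. x i) \<in> borel_measurable M"
proof -
  have "(\<lambda>x::nat \<Rightarrow> real. x i) \<in> borel_measurable (restrict_space borel cube)"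
    by (rule measurable_restrict_space1) (rule measurable_product_then_coordinatewise, simp)
  then show ?thesis using measurable_cong_sets[OF sets_M refl] by blast
qed

text \<open>A point stands for the functional \<open>\<xi> \<mapsto> L \<xi> x\<close>. Transport
  composes this functional with \<open>u\<close>, that is, it is the dual map read in the
  coordinates of \<open>d\<close>; hence the order reversal in
  \<open>transport_transport\<close>.\<close>

definition transport :: "('h \<Rightarrow>\<^sub>L 'h) \<Rightarrow> (nat \<Rightarrow> real) \<Rightarrow> nat \<Rightarrow> real" where
  "transport u x i = arctan (L (blinfun_apply u (d i)) x)"

lemma transport_borel: "transport u \<in> borel_measurable M"
proof (rule measurable_coordinatewise_then_product)
  show "(\<lambda>x. transport u x i) \<in> borel_measurable M" for i
    unfolding transport_def by measurable
qed

lemma transport_in_cube: "transport u x \<in> cube"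
  unfolding cube_def transport_def
  using arctan_lbound[THEN less_imp_le] arctan_ubound[THEN less_imp_le] by auto

lemma transport_measurable [measurable]: "transport u \<in> measurable M M"
proof -
  have "transport u \<in> measurable M (restrict_space borel cube)"
    by (rule measurable_restrict_space2) (use transport_in_cube transport_borel in auto)
  then show ?thesis using measurable_cong_sets[OF refl sets_M] by blast
qed

lemma arctan_L_d: "AE x in M. (\<lambda>i. arctan (L (d i) x)) = x"
proof -
  have "AE x in M. \<forall>i. arctan (L (d i) x) = x i"
    unfolding AE_all_countable
  proof
    fix i
    show "AE x in M. arctan (L (d i) x) = x i"
      using L_d[of i] arctan_tan[of i] by eventually_elim simp
  qed
  then show ?thesis by eventually_elim auto
qed

text \<open>Invariance of \<open>f\<close> gives the variables \<open>L (u (d i))\<close> and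
  \<open>L (d i)\<close> the same joint transforms, hence the same joint law; the arctangents of the
  latter are almost surely the coordinates themselves.\<close>

lemma distr_transport:
  assumes fu: "\<And>\<xi>. f (blinfun_apply u \<xi>) = f \<xi>"
  shows "distr M M (transport u) = M"
proof (rule measure_eqI)
  fix A assume "A \<in> sets (distr M M (transport u))"
  then have A: "A \<in> sets M" and A': "A \<in> sets borel" by (auto simp: sets_M_borel)
  have char: "(\<integral>x. cis (\<Sum>i<n. t i * L (\<xi> i) x) \<partial>M) = f (\<Sum>i<n. t i *\<^sub>R \<xi> i)" for n :: nat and t \<xi>
  proof -
    have "(\<integral>x. cis (\<Sum>i<n. t i * L (\<xi> i) x) \<partial>M) = (\<integral>x. cis (L (\<Sum>i<n. t i *\<^sub>R \<xi> i) x) \<partial>M)"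
    proof (rule integral_cong_AE)
      show "AE x in M. cis (\<Sum>i<n. t i * L (\<xi> i) x) = cis (L (\<Sum>i<n. t i *\<^sub>R \<xi> i) x)"
        using L_sum[of t \<xi> n] by eventually_elim simp
    qed (simp_all add: cis_conv_exp)
    then show ?thesis by (simp add: L_char)
  qed
  have "(\<Sum>i<n. t i *\<^sub>R blinfun_apply u (d i)) = blinfun_apply u (\<Sum>i<n. t i *\<^sub>R d i)" for n :: nat and t
    by (simp add: blinfun.sum_right blinfun.scaleR_right)
  then have "distr M borel (\<lambda>x i. L (blinfun_apply u (d i)) x) = distr M borel (\<lambda>x i. L (d i) x)"
    by (intro joint_law_eq_of_char prob_space_axioms) (auto simp: char fu)
  from arg_cong[OF this, of "\<lambda>N. distr N borel (\<lambda>y i. arctan (y i))"]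
  have eq: "distr M borel (transport u) = distr M borel (\<lambda>x i. arctan (L (d i) x))"
  proof -
    have [measurable]: "(\<lambda>y i. arctan (y i)) \<in> borel_measurable (borel :: (nat \<Rightarrow> real) measure)"
    proof (rule measurable_coordinatewise_then_product)
      fix i :: nat
      have [measurable]: "(\<lambda>x::nat \<Rightarrow> real. x i) \<in> borel_measurable borel"
        by (rule measurable_product_then_coordinatewise) simp
      show "(\<lambda>x::nat \<Rightarrow> real. arctan (x i)) \<in> borel_measurable borel" by measurable
    qed
    have [measurable]: "(\<lambda>x i. L (\<xi> i) x) \<in> borel_measurable M" for \<xi> :: "nat \<Rightarrow> 'h"
      by (rule measurable_coordinatewise_then_product) measurable
    assume "distr (distr M borel (\<lambda>x i. L (blinfun_apply u (d i)) x)) borel (\<lambda>y i. arctan (y i)) =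
        distr (distr M borel (\<lambda>x i. L (d i) x)) borel (\<lambda>y i. arctan (y i))"
    moreover have "distr (distr M borel (\<lambda>x i. L (\<xi> i) x)) borel (\<lambda>y i. arctan (y i)) =
        distr M borel (\<lambda>x i. arctan (L (\<xi> i) x))" for \<xi> :: "nat \<Rightarrow> 'h"
      by (subst distr_distr) (auto simp: o_def)
    ultimately show ?thesis by (simp add: transport_def[abs_def])
  qed
  have meas: "(\<lambda>x i. arctan (L (d i) x)) \<in> borel_measurable M"
    by (rule measurable_coordinatewise_then_product) measurable
  have "emeasure (distr M M (transport u)) A = emeasure (distr M borel (transport u)) A"
    using A A' transport_borel by (simp add: emeasure_distr)
  also have "\<dots> = emeasure M ((\<lambda>x i. arctan (L (d i) x)) -` A \<inter> space M)"
    unfolding eq using A' meas by (simp add: emeasure_distr)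
  also have "\<dots> = emeasure M A"
  proof (rule emeasure_eq_AE)
    show "AE x in M. x \<in> (\<lambda>x i. arctan (L (d i) x)) -` A \<inter> space M \<longleftrightarrow> x \<in> A"
      using arctan_L_d AE_space by eventually_elim simp
  qed (use A A' meas in \<open>auto intro: measurable_sets\<close>)
  finally show "emeasure (distr M M (transport u)) A = emeasure M A" .
qed simp

lemma AE_transport:
  assumes "\<And>\<xi>. f (blinfun_apply u \<xi>) = f \<xi>" "AE x in M. P x"
  shows "AE x in M. P (transport u x)"
proof -
  have "AE x in distr M M (transport u). P x" by (subst distr_transport[OF assms(1)]) (rule assms(2))
  then show ?thesis by (rule AE_distrD[OF transport_measurable])
qed

lemma prob_transport:
  assumes "\<And>\<xi>. f (blinfun_apply u \<xi>) = f \<xi>" and [measurable]: "Measurable.pred M P"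
  shows "\<P>(x in M. P (transport u x)) = \<P>(x in M. P x)"
proof -
  have "\<P>(x in M. P x) = measure (distr M M (transport u)) {x \<in> space M. P x}"
    by (simp add: distr_transport[OF assms(1)])
  also have "\<dots> = measure M (transport u -` {x \<in> space M. P x} \<inter> space M)"
    by (rule measure_distr) measurable
  also have "transport u -` {x \<in> space M. P x} \<inter> space M = {x \<in> space M. P (transport u x)}"
    using measurable_space[OF transport_measurable] by auto
  finally show ?thesis ..
qed

text \<open>At \<open>\<xi> = d i\<close> this holds by construction. Both sides are continuous in
  probability in \<open>\<xi>\<close>, the left one because \<open>transport u\<close> preserves the
  measure, so density of \<open>d\<close> gives the rest.\<close>

lemma L_transport:
  assumes fu: "\<And>\<xi>. f (blinfun_apply u \<xi>) = f \<xi>"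
  shows "AE x in M. L \<xi> (transport u x) = L (blinfun_apply u \<xi>) x"
proof -
  have d: "AE x in M. L (d i) (transport u x) = L (blinfun_apply u (d i)) x" for i
    using AE_transport[OF fu L_d[of i]] by eventually_elim (simp add: transport_def tan_arctan)
  let ?Y = "\<lambda>x. L \<xi> (transport u x) - L (blinfun_apply u \<xi>) x"
  have [measurable]: "(\<lambda>x. L \<eta> (transport u x)) \<in> borel_measurable M" for \<eta>
    by (rule measurable_compose[OF transport_measurable L_measurable])
  have small: "\<P>(x in M. \<kappa> \<le> \<bar>?Y x\<bar>) \<le> 2 * \<epsilon>" if \<kappa>: "\<kappa> > 0" and \<epsilon>: "\<epsilon> > 0" for \<kappa> \<epsilon>
  proof -
    obtain \<delta> where \<delta>: "\<delta> > 0" "\<And>\<xi> \<eta>. norm (\<xi> - \<eta>) < \<delta> \<Longrightarrow> \<P>(x in M. \<kappa> / 2 \<le> \<bar>L \<xi> x - L \<eta> x\<bar>) \<le> \<epsilon>"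
      by (rule L_diff_prob_small[of "\<kappa> / 2" \<epsilon>]) (use \<kappa> \<epsilon> in auto)
    \<comment> \<open>One denominator serves both estimates: \<open>d i\<close> comes within
      \<open>\<delta>\<close> of \<open>\<xi>\<close>, and \<open>u (d i)\<close> within
      \<open>\<delta>\<close> of \<open>u \<xi>\<close>.\<close>
    have nu: "norm u + 1 > 0" by (simp add: add_nonneg_pos)
    have "\<xi> \<in> closure (range d)" using d_dense by simp
    moreover have "\<delta> / (norm u + 1) > 0" using \<delta> nu by simp
    ultimately have "\<exists>y\<in>range d. dist y \<xi> < \<delta> / (norm u + 1)" unfolding closure_approachable by blast
    then obtain i where i: "norm (d i - \<xi>) < \<delta> / (norm u + 1)" by (auto simp: dist_norm)
    then have i': "norm (d i - \<xi>) * (norm u + 1) < \<delta>" using nu by (simp add: field_simps)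
    have i1: "norm (d i - \<xi>) < \<delta>"
    proof -
      have "0 \<le> norm (d i - \<xi>) * norm u" by simp
      with i' show ?thesis unfolding distrib_left mult_1_right by linarith
    qed
    have "norm (blinfun_apply u (d i) - blinfun_apply u \<xi>) \<le> norm u * norm (d i - \<xi>)"
      using norm_blinfun[of u "d i - \<xi>"] by (simp add: blinfun.diff_right)
    also have "\<dots> < \<delta>" using i' norm_ge_zero[of "d i - \<xi>"] unfolding distrib_left mult_1_right mult.commute[of "norm u"] by linarith
    finally have i2: "norm (blinfun_apply u (d i) - blinfun_apply u \<xi>) < \<delta>" .
    let ?D = "\<lambda>x. \<bar>L (d i) x - L \<xi> x\<bar>" and ?E = "\<lambda>x. \<bar>L (blinfun_apply u (d i)) x - L (blinfun_apply u \<xi>) x\<bar>"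
    have "\<P>(x in M. \<kappa> \<le> \<bar>?Y x\<bar>) \<le> \<P>(x in M. \<kappa> / 2 \<le> ?D (transport u x) \<or> \<kappa> / 2 \<le> ?E x)"
    proof (rule finite_measure_mono_AE)
      show "AE x in M. x \<in> {x \<in> space M. \<kappa> \<le> \<bar>?Y x\<bar>} \<longrightarrow> x \<in> {x \<in> space M. \<kappa> / 2 \<le> ?D (transport u x) \<or> \<kappa> / 2 \<le> ?E x}"
        using d[of i]
      proof eventually_elim
        case (elim x)
        have "\<kappa> \<le> \<bar>p - q\<bar> \<Longrightarrow> \<kappa> / 2 \<le> \<bar>r - p\<bar> \<or> \<kappa> / 2 \<le> \<bar>r - q\<bar>" for p q r :: real by linarith
        then show ?case by (simp only: mem_Collect_eq elim) blast
      qed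
    qed measurable
    also have "\<dots> \<le> \<P>(x in M. \<kappa> / 2 \<le> ?D (transport u x)) + \<P>(x in M. \<kappa> / 2 \<le> ?E x)"
    proof -
      have "{x \<in> space M. \<kappa> / 2 \<le> ?D (transport u x) \<or> \<kappa> / 2 \<le> ?E x} =
          {x \<in> space M. \<kappa> / 2 \<le> ?D (transport u x)} \<union> {x \<in> space M. \<kappa> / 2 \<le> ?E x}" by auto
      then show ?thesis by (simp only:) (rule measure_Un_le; measurable)
    qed
    also have "\<P>(x in M. \<kappa> / 2 \<le> ?D (transport u x)) = \<P>(x in M. \<kappa> / 2 \<le> ?D x)"
      by (rule prob_transport[OF fu]) measurable
    also have "\<dots> + \<P>(x in M. \<kappa> / 2 \<le> ?E x) \<le> \<epsilon> + \<epsilon>" by (intro add_mono \<delta>(2) i1 i2)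
    finally show ?thesis by simp
  qed
  have "AE x in M. \<bar>?Y x\<bar> < 1 / real (Suc n)" for n
  proof -
    have "\<P>(x in M. 1 / real (Suc n) \<le> \<bar>?Y x\<bar>) \<le> e" if "e > 0" for e
      using small[of "1 / real (Suc n)" "e / 2"] that by simp
    then have "AE x in M. x \<notin> {x \<in> space M. 1 / real (Suc n) \<le> \<bar>?Y x\<bar>}"
      by (intro AE_not_in_of_prob_le) measurable
    then show ?thesis using AE_space by eventually_elim auto
  qed
  then have "AE x in M. \<forall>n. \<bar>?Y x\<bar> < 1 / real (Suc n)" unfolding AE_all_countable by blast
  then show ?thesis
  proof eventually_elim
    case (elim x)
    show ?case
    proof (rule ccontr)
      assume "\<not> ?case"
      then have "0 < \<bar>?Y x\<bar>" by simp
      then obtain n where "inverse (real (Suc n)) < \<bar>?Y x\<bar>" using reals_Archimedean by blast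
      with elim show False by (auto simp: inverse_eq_divide dest!: spec[of _ n])
    qed
  qed
qed

lemma transport_transport:
  assumes fu: "\<And>\<xi>. f (blinfun_apply u \<xi>) = f \<xi>"
  shows "AE x in M. transport w (transport u x) = transport (u o\<^sub>L w) x"
proof -
  have "AE x in M. \<forall>i. L (blinfun_apply w (d i)) (transport u x) = L (blinfun_apply u (blinfun_apply w (d i))) x"
    unfolding AE_all_countable using L_transport[OF fu] by blast
  then show ?thesis by eventually_elim (simp add: transport_def[abs_def] fun_eq_iff)
qed

lemma transport_id: "AE x in M. transport id_blinfun x = x"
  using arctan_L_d by eventually_elim (simp add: transport_def[abs_def])

section \<open>Continuity of the transport maps\<close>

definition transport_diff :: "('h \<Rightarrow>\<^sub>L 'h) \<Rightarrow> ('h \<Rightarrow>\<^sub>L 'h) \<Rightarrow> (nat \<Rightarrow> real) set \<Rightarrow> real" where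
  "transport_diff u w A = \<P>(x in M. transport u x \<in> A \<longleftrightarrow> transport w x \<notin> A)"

text \<open>As arctan is 1-Lipschitz, disagreement about \<open>x i < a\<close> while the two values
  of \<open>L\<close> differ by less than \<open>\<eta>\<close> puts one of the two images into the
  strip just below \<open>a\<close>. Both transports preserve the measure of that strip, hence the
  factor 2.\<close>

lemma transport_diff_halfspace_le:
  assumes fu: "\<And>\<xi>. f (blinfun_apply u \<xi>) = f \<xi>" and fw: "\<And>\<xi>. f (blinfun_apply w \<xi>) = f \<xi>"
  shows "transport_diff u w {x. x i < a} \<le>
    2 * \<P>(x in M. a - \<eta> < x i \<and> x i < a) + \<P>(x in M. \<eta> \<le> \<bar>L (blinfun_apply u (d i)) x - L (blinfun_apply w (d i)) x\<bar>)"
proof -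
  let ?B = "\<lambda>x. a - \<eta> < x i \<and> x i < a"
  let ?C = "\<lambda>x. \<eta> \<le> \<bar>L (blinfun_apply u (d i)) x - L (blinfun_apply w (d i)) x\<bar>"
  have [measurable]: "(\<lambda>x. transport v x i) \<in> borel_measurable M" for v
    unfolding transport_def by measurable
  have "transport_diff u w {x. x i < a} \<le> \<P>(x in M. (?B (transport u x) \<or> ?B (transport w x)) \<or> ?C x)"
    unfolding transport_diff_def
  proof (rule finite_measure_mono, rule subsetI)
    fix x assume x: "x \<in> {x \<in> space M. (transport u x \<in> {x. x i < a}) = (transport w x \<notin> {x. x i < a})}"
    have "\<bar>transport u x i - transport w x i\<bar> \<le> \<bar>L (blinfun_apply u (d i)) x - L (blinfun_apply w (d i)) x\<bar>"
      unfolding transport_def by (rule abs_arctan_diff_le)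
    then show "x \<in> {x \<in> space M. (?B (transport u x) \<or> ?B (transport w x)) \<or> ?C x}"
      using x by (auto simp: abs_if split: if_splits)
  qed measurable
  also have "\<dots> \<le> (\<P>(x in M. ?B (transport u x)) + \<P>(x in M. ?B (transport w x))) + \<P>(x in M. ?C x)"
  proof -
    have or_le: "\<P>(x in M. P x \<or> Q x) \<le> \<P>(x in M. P x) + \<P>(x in M. Q x)"
      if [measurable]: "Measurable.pred M P" "Measurable.pred M Q" for P Q
    proof -
      have "{x \<in> space M. P x \<or> Q x} = {x \<in> space M. P x} \<union> {x \<in> space M. Q x}" by auto
      then show ?thesis by (simp only:) (rule measure_Un_le; measurable)
    qed
    show ?thesis
      by (rule order_trans[OF or_le add_right_mono[OF or_le]]) measurable
  qed
  also have "\<P>(x in M. ?B (transport u x)) = \<P>(x in M. ?B x)" by (rule prob_transport[OF fu]) measurable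
  also have "\<P>(x in M. ?B (transport w x)) = \<P>(x in M. ?B x)" by (rule prob_transport[OF fw]) measurable
  finally show ?thesis by simp
qed

text \<open>
  The sets \<open>A\<close> along which the action is continuous form a sigma-algebra, because the action
  preserves the measure; it contains the generating half-spaces.
\<close>

lemma tendsto_transport_diff:
  fixes F :: "('h \<Rightarrow>\<^sub>L 'h) filter"
  assumes F: "\<forall>\<^sub>F u in F. \<forall>\<xi>. f (blinfun_apply u \<xi>) = f \<xi>" and fw: "\<And>\<xi>. f (blinfun_apply w \<xi>) = f \<xi>"
    and lim: "\<And>\<xi>. ((\<lambda>u. blinfun_apply u \<xi>) \<longlongrightarrow> blinfun_apply w \<xi>) F"
    and A: "A \<in> sets borel"
  shows "((\<lambda>u. transport_diff u w A) \<longlongrightarrow> 0) F"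
proof -
  define \<A> where "\<A> = {A \<in> sets borel. ((\<lambda>u. transport_diff u w A) \<longlongrightarrow> 0) F}"
  have tr_sets: "Measurable.pred M (\<lambda>x. transport u x \<in> A)" if "A \<in> sets borel" for A u
    using transport_borel that by measurable
  have td_nonneg: "0 \<le> transport_diff u w A" for u A by (simp add: transport_diff_def)
  have tendsto0I: "((\<lambda>u. transport_diff u w A) \<longlongrightarrow> 0) F"
    if "\<And>e. e > 0 \<Longrightarrow> \<forall>\<^sub>F u in F. transport_diff u w A < e" for A
  proof (rule order_tendstoI)
    show "\<forall>\<^sub>F u in F. a < transport_diff u w A" if "a < 0" for a
      by (rule always_eventually) (use that td_nonneg in \<open>auto intro: less_le_trans\<close>)
  qed (rule that)
  have "sigma_algebra UNIV \<A>"
    unfolding sigma_algebra_iff2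
  proof (intro conjI ballI allI impI)
    show "{} \<in> \<A>" by (simp add: \<A>_def transport_diff_def)
    show "UNIV - A \<in> \<A>" if "A \<in> \<A>" for A
    proof -
      have "transport_diff u w (UNIV - A) = transport_diff u w A" for u
        unfolding transport_diff_def by (rule arg_cong[of _ _ "measure M"]) auto
      then show ?thesis using that by (auto simp: \<A>_def)
    qed
    fix B :: "nat \<Rightarrow> (nat \<Rightarrow> real) set" assume "range B \<subseteq> \<A>"
    then have B [measurable]: "B i \<in> sets borel" and B_lim: "((\<lambda>u. transport_diff u w (B i)) \<longlongrightarrow> 0) F" for i
      by (auto simp: \<A>_def)
    have "((\<lambda>u. transport_diff u w (\<Union>i. B i)) \<longlongrightarrow> 0) F"
    proof (rule tendsto0I)
      fix e :: real assume e: "e > 0"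
      \<comment> \<open>The part missed by the first \<open>n\<close> sets is charged twice, under
        \<open>u\<close> and under \<open>w\<close>. Invariance of the measure makes both charges
        equal to the measure of \<open>C n\<close>, uniformly in \<open>u\<close>.\<close>
      define C where "C n = (\<Union>i. B i) - (\<Union>i<n. B i)" for n
      have C [measurable]: "C n \<in> sets borel" for n unfolding C_def by measurable
      have pred_C: "Measurable.pred M (\<lambda>x. x \<in> C n)" for n
      proof -
        have "cube \<inter> C n \<in> sets M" by (simp add: sets_M_borel)
        moreover have "{x \<in> space M. x \<in> C n} = cube \<inter> C n" by (auto simp: space_M)
        ultimately show ?thesis by (simp add: pred_def)
      qed
      have "(\<lambda>n. \<P>(x in M. x \<in> C n)) \<longlonglongrightarrow> prob (\<Inter>n. {x \<in> space M. x \<in> C n})"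
      proof (rule finite_Lim_measure_decseq)
        show "range (\<lambda>n. {x \<in> space M. x \<in> C n}) \<subseteq> sets M" using pred_C by (auto simp: pred_def)
        show "decseq (\<lambda>n. {x \<in> space M. x \<in> C n})" by (fastforce simp: decseq_def C_def)
      qed
      moreover have "(\<Inter>n. {x \<in> space M. x \<in> C n}) = {}" by (auto simp: C_def)
      ultimately have "(\<lambda>n. \<P>(x in M. x \<in> C n)) \<longlonglongrightarrow> 0" by simp
      then have "\<forall>\<^sub>F n in sequentially. \<P>(x in M. x \<in> C n) < e / 3" using e by (intro order_tendstoD(2)) auto
      then obtain n where n: "\<P>(x in M. x \<in> C n) < e / 3" by (auto simp: eventually_sequentially)
      have "((\<lambda>u. \<Sum>i<n. transport_diff u w (B i)) \<longlongrightarrow> (\<Sum>i<n. 0)) F" by (intro tendsto_sum B_lim)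
      then have "\<forall>\<^sub>F u in F. (\<Sum>i<n. transport_diff u w (B i)) < e / 3" using e by (intro order_tendstoD(2)) auto
      then show "\<forall>\<^sub>F u in F. transport_diff u w (\<Union>i. B i) < e"
        using F
      proof eventually_elim
        case (elim u)
        let ?S = "\<lambda>i. {x \<in> space M. transport u x \<in> B i \<longleftrightarrow> transport w x \<notin> B i}"
        let ?U = "{x \<in> space M. transport u x \<in> C n}" and ?W = "{x \<in> space M. transport w x \<in> C n}"
        have S: "?S i \<in> sets M" "?U \<in> sets M" "?W \<in> sets M" for i
          using tr_sets[OF B] tr_sets[OF C] by (auto simp: pred_def[symmetric])
        have "transport_diff u w (\<Union>i. B i) \<le> prob ((\<Union>i<n. ?S i) \<union> (?U \<union> ?W))"
          unfolding transport_diff_def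
        proof (rule finite_measure_mono)
          show "{x \<in> space M. transport u x \<in> (\<Union>i. B i) \<longleftrightarrow> transport w x \<notin> (\<Union>i. B i)} \<subseteq> (\<Union>i<n. ?S i) \<union> (?U \<union> ?W)"
            unfolding C_def by blast
        qed (use S in auto)
        also have "\<dots> \<le> prob (\<Union>i<n. ?S i) + prob (?U \<union> ?W)"
          by (rule measure_Un_le) (use S in auto)
        also have "\<dots> \<le> (\<Sum>i<n. prob (?S i)) + (prob ?U + prob ?W)"
          by (intro add_mono measure_UNION_le measure_Un_le) (use S in auto)
        also have "prob ?U = \<P>(x in M. x \<in> C n)"
          using elim by (intro prob_transport pred_C) auto
        also have "prob ?W = \<P>(x in M. x \<in> C n)"
          using fw by (intro prob_transport pred_C) auto
        also have "(\<Sum>i<n. prob (?S i)) + (\<P>(x in M. x \<in> C n) + \<P>(x in M. x \<in> C n)) < e"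
          using elim(1) n unfolding transport_diff_def by linarith
        finally show ?case .
      qed
    qed
    then show "(\<Union>i. B i) \<in> \<A>" by (auto simp: \<A>_def)
  qed auto
  then have sets_A: "sets (sigma UNIV \<A>) = \<A>" by (rule sigma_algebra.sets_measure_of_eq)
  have half: "{x. x i < a} \<in> \<A>" for i a
  proof -
    have "((\<lambda>u. transport_diff u w {x. x i < a}) \<longlongrightarrow> 0) F"
    proof (rule tendsto0I)
      fix e :: real assume e: "e > 0"
      obtain n where "\<P>(x in M. 0 < a - x i \<and> a - x i < inverse (real (Suc n))) < e / 4"
        by (rule measure_small_positive[of "\<lambda>x. a - x i" "e / 4"]) (use e in auto)
      moreover have "0 < a - x i \<and> a - x i < h \<longleftrightarrow> a - h < x i \<and> x i < a" for h and x :: "nat \<Rightarrow> real" by linarith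
      ultimately have n: "\<P>(x in M. a - inverse (real (Suc n)) < x i \<and> x i < a) < e / 4" by (simp only:)
      define \<eta> where "\<eta> = inverse (real (Suc n))"
      obtain \<delta> where \<delta>: "\<delta> > 0" "\<And>\<xi> \<zeta>. norm (\<xi> - \<zeta>) < \<delta> \<Longrightarrow> \<P>(x in M. \<eta> \<le> \<bar>L \<xi> x - L \<zeta> x\<bar>) \<le> e / 4"
        by (rule L_diff_prob_small[of \<eta> "e / 4"]) (use e in \<open>auto simp: \<eta>_def\<close>)
      have "\<forall>\<^sub>F u in F. dist (blinfun_apply u (d i)) (blinfun_apply w (d i)) < \<delta>"
        using lim[of "d i"] \<delta>(1) by (auto simp: tendsto_iff)
      then show "\<forall>\<^sub>F u in F. transport_diff u w {x. x i < a} < e"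
        using F
      proof eventually_elim
        case (elim u)
        have "transport_diff u w {x. x i < a} \<le> 2 * \<P>(x in M. a - \<eta> < x i \<and> x i < a) +
            \<P>(x in M. \<eta> \<le> \<bar>L (blinfun_apply u (d i)) x - L (blinfun_apply w (d i)) x\<bar>)"
          by (rule transport_diff_halfspace_le) (use elim fw in auto)
        moreover have "\<P>(x in M. \<eta> \<le> \<bar>L (blinfun_apply u (d i)) x - L (blinfun_apply w (d i)) x\<bar>) \<le> e / 4"
          using elim(1) by (intro \<delta>(2)) (simp add: dist_norm)
        ultimately show ?case using n e unfolding \<eta>_def by linarith
      qed
    qed
    moreover have "{x :: nat \<Rightarrow> real. x i < a} \<in> sets borel"
    proof -
      have [measurable]: "(\<lambda>x::nat \<Rightarrow> real. x i) \<in> borel_measurable borel"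
        by (rule measurable_product_then_coordinatewise) simp
      show ?thesis by measurable
    qed
    ultimately show ?thesis by (simp add: \<A>_def)
  qed
  \<comment> \<open>Half-spaces generate the Borel sets of the countable product; this is expressed
    as measurability of the identity.\<close>
  have "(\<lambda>x. x) \<in> measurable (sigma UNIV \<A>) borel"
  proof (rule measurable_coordinatewise_then_product)
    show "(\<lambda>x. x i) \<in> borel_measurable (sigma UNIV \<A>)" for i
      unfolding borel_measurable_iff_less using half by (simp add: sets_A)
  qed
  from measurable_sets[OF this A] have "A \<in> \<A>" by (simp add: sets_A)
  then show ?thesis by (simp add: \<A>_def)
qed

end

subsection \<open>The operator into square-integrable functions\<close>

text \<open>Pushing the process forward by arctan in each coordinate makes it live on a compact
  metrizable space, and no mass reaches the faces because arctan takes its values strictly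
  inside.\<close>

lemma cube_process_exists:
  fixes f :: "'h::real_inner \<Rightarrow> complex"
  assumes sep: "separable_space (euclidean :: 'h topology)" and cont: "continuous_on UNIV f"
    and pd: "positive_definite f" and f0: "f 0 = 1"
  obtains M L d where "cube_process M f L d"
proof -
  obtain C :: "'h set" where C: "countable C" "closure C = UNIV"
    using sep unfolding separable_space_def by auto
  define d where "d = from_nat_into C"
  have "C \<noteq> {}" using C(2) by auto
  then have d: "closure (range d) = UNIV" using C by (simp add: d_def range_from_nat_into)
  obtain \<Omega> :: "real measure" and X :: "nat \<Rightarrow> real \<Rightarrow> real" where "prob_space \<Omega>"
    and X [measurable]: "\<And>i. X i \<in> borel_measurable \<Omega>"
    and char: "\<And>n t. (\<integral>w. cis (\<Sum>i<n. t i * X i w) \<partial>\<Omega>) = f (\<Sum>i<n. t i *\<^sub>R d i)"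
    by (rule bochner_process[OF pd f0 cont, of d]) blast
  interpret \<Omega>: prob_space \<Omega> by fact
  define \<Phi> where "\<Phi> w = (\<lambda>i. arctan (X i w))" for w
  define M where "M = distr \<Omega> (restrict_space borel cube) \<Phi>"
  have \<Phi> [measurable]: "\<Phi> \<in> measurable \<Omega> (restrict_space borel cube)"
  proof (rule measurable_restrict_space2)
    show "\<Phi> \<in> space \<Omega> \<rightarrow> cube"
      unfolding cube_def \<Phi>_def using arctan_lbound[THEN less_imp_le] arctan_ubound[THEN less_imp_le] by auto
    show "\<Phi> \<in> borel_measurable \<Omega>"
      unfolding \<Phi>_def by (rule measurable_coordinatewise_then_product) measurable
  qed
  interpret M: prob_space M unfolding M_def by (rule \<Omega>.prob_space_distr[OF \<Phi>])
  have coord [measurable]: "(\<lambda>x. x i) \<in> borel_measurable (restrict_space borel cube :: (nat \<Rightarrow> real) measure)" for i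
    by (rule measurable_restrict_space1) (rule measurable_product_then_coordinatewise, simp)
  have tan_meas [measurable]: "(\<lambda>x. tan (x i)) \<in> borel_measurable (restrict_space borel cube :: (nat \<Rightarrow> real) measure)" for i
    unfolding tan_def by measurable
  have "(\<lambda>x. tan (x i)) \<in> borel_measurable M" for i unfolding M_def by simp
  moreover have "(\<integral>x. cis (\<Sum>i<n. t i * tan (x i)) \<partial>M) = f (\<Sum>i<n. t i *\<^sub>R d i)" for n t
  proof -
    have "(\<lambda>x. cis (\<Sum>i<n. t i * tan (x i))) \<in> borel_measurable (restrict_space borel cube)"
      unfolding cis_conv_exp by measurable
    from integral_distr[OF \<Phi> this] show ?thesis by (simp add: M_def \<Phi>_def tan_arctan char)
  qed
  ultimately obtain L where L: "linear_process M f L" "\<And>i. AE x in M. L (d i) x = tan (x i)"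
    using M.linear_process_extension[of "\<lambda>i x. tan (x i)" f d] d cont f0 by blast
  have "AE x in M. arctan (tan (x i)) = x i" for i
  proof -
    have "{x \<in> space (restrict_space borel cube). arctan (tan (x i)) = x i} \<in> sets (restrict_space borel cube)"
      by measurable
    from AE_distr_iff[OF \<Phi> this] have "AE x in distr \<Omega> (restrict_space borel cube) \<Phi>. arctan (tan (x i)) = x i"
      by (simp add: \<Phi>_def tan_arctan)
    then show ?thesis by (fold M_def)
  qed
  then have "cube_process M f L d"
    using L d by (intro cube_process.intro cube_process_axioms.intro) (simp_all add: M_def)
  then show ?thesis by (rule that)
qed

section \<open>Weighted representations and neighbourhoods of 0\<close>

context linear_process
begin

lemma represents_weight:
  assumes v [measurable]: "v \<in> borel_measurable M" and pos: "AE x in M. 0 < v x"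
    and int: "\<And>\<xi>. integrable M (\<lambda>x. (v x * L \<xi> x)\<^sup>2)"
    and le: "\<And>\<xi>. (\<integral>x. (v x * L \<xi> x)\<^sup>2 \<partial>M) \<le> (C * norm \<xi>)\<^sup>2" and C: "C \<ge> 0"
  shows "represents M (\<lambda>\<xi> x. v x * L \<xi> x) (\<lambda>x. 1 / v x) f"
  unfolding represents_def bounded_linear_L2_def
proof (intro conjI allI)
  fix \<xi> \<eta> :: 'h and a :: real
  show "(\<lambda>x. v x * L \<xi> x) \<in> L2 M" using int[of \<xi>] by (simp add: L2_def)
  show "AE x in M. v x * L (\<xi> + \<eta>) x = v x * L \<xi> x + v x * L \<eta> x"
    using L_add[of \<xi> \<eta>] by eventually_elim (simp add: distrib_left)
  show "AE x in M. v x * L (a *\<^sub>R \<xi>) x = a * (v x * L \<xi> x)"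
    using L_scale[of a \<xi>] by eventually_elim simp
  have "L2_norm M (\<lambda>x. v x * L \<xi> x) \<le> C * norm \<xi>" for \<xi>
    unfolding L2_norm_def using real_sqrt_le_mono[OF le[of \<xi>]] C by simp
  then show "\<exists>C. \<forall>\<xi>. L2_norm M (\<lambda>x. v x * L \<xi> x) \<le> C * norm \<xi>" by blast
  have "f \<xi> = (\<integral>x. cis (L \<xi> x) \<partial>M)" by (simp add: L_char)
  also have "\<dots> = (\<integral>x. exp (\<i> * complex_of_real (1 / v x * (v x * L \<xi> x))) \<partial>M)"
  proof (rule integral_cong_AE)
    show "AE x in M. cis (L \<xi> x) = exp (\<i> * complex_of_real (1 / v x * (v x * L \<xi> x)))"
      using pos by eventually_elim (simp add: cis_conv_exp)
  qed (simp_all add: cis_conv_exp)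
  finally show "f \<xi> = (\<integral>x. exp (\<i> * complex_of_real (1 / v x * (v x * L \<xi> x))) \<partial>M)" .
  show "AE x in M. 0 < 1 / v x" using pos by eventually_elim simp
qed measurable

text \<open>Control from the weighted process back to \<open>f\<close>: outside a small set
  \<open>v\<close> is bounded below, so a small mean square of \<open>v * L \<xi>\<close> forces
  \<open>L \<xi>\<close> to be small there.\<close>

lemma f_near_1_of_weight:
  assumes v [measurable]: "v \<in> borel_measurable M" and pos: "AE x in M. 0 < v x"
    and int: "\<And>\<xi>. integrable M (\<lambda>x. (v x * L \<xi> x)\<^sup>2)" and e: "e > 0"
  obtains \<delta> where "\<delta> > 0" "\<And>\<xi>. L2_norm M (\<lambda>x. v x * L \<xi> x) < \<delta> \<Longrightarrow> norm (f \<xi> - 1) < e"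
proof -
  let ?A = "\<lambda>n. {x \<in> space M. v x < inverse (real (Suc n))}"
  obtain n where "\<P>(x in M. 0 < v x \<and> v x < inverse (real (Suc n))) < e / 8"
    by (rule measure_small_positive[OF v, of "e / 8"]) (use e in auto)
  moreover have "prob (?A n) = \<P>(x in M. 0 < v x \<and> v x < inverse (real (Suc n)))"
    by (rule measure_eq_AE) (use pos in \<open>auto elim: AE_mp\<close>)
  ultimately have n: "prob (?A n) < e / 8" by simp
  define \<kappa> where "\<kappa> = inverse (real (Suc n))"
  have \<kappa>: "\<kappa> > 0" by (simp add: \<kappa>_def)
  \<comment> \<open>The exceptional set, the constant term and the quadratic term each contribute at
    most \<open>s\<close>, and \<open>3 * s < e\<close>.\<close>
  define s where "s = e / 4"
  have s: "s > 0" and s_eq: "e = 4 * s" using e by (simp_all add: s_def)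
  define \<delta> where "\<delta> = s * \<kappa>"
  show ?thesis
  proof (rule that[of \<delta>])
    show "\<delta> > 0" using s \<kappa> by (simp add: \<delta>_def)
    fix \<xi> assume \<xi>: "L2_norm M (\<lambda>x. v x * L \<xi> x) < \<delta>"
    define I where "I = (\<integral>x. (v x * L \<xi> x)\<^sup>2 \<partial>M)"
    have "0 \<le> I" unfolding I_def by simp
    then have "sqrt I ^ 2 = I" by simp
    moreover have "sqrt I ^ 2 < \<delta> ^ 2" using \<xi> \<open>0 \<le> I\<close> unfolding L2_norm_def I_def[symmetric]
      by (intro power_strict_mono) auto
    ultimately have I: "I < s\<^sup>2 * \<kappa>\<^sup>2" by (simp add: \<delta>_def power_mult_distrib)
    have ptw: "norm (cis (L \<xi> x) - 1) \<le> 2 * indicator (?A n) x + (s + (v x * L \<xi> x)\<^sup>2 / (s * \<kappa>\<^sup>2))"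
      if x: "x \<in> space M" for x
    proof (cases "x \<in> ?A n")
      case True
      have "norm (cis (L \<xi> x) - 1) \<le> 2" using norm_triangle_ineq4[of "cis (L \<xi> x)" 1] by simp
      moreover have "0 \<le> s + (v x * L \<xi> x)\<^sup>2 / (s * \<kappa>\<^sup>2)" using s \<kappa> by simp
      moreover have "indicator (?A n) x = (1::real)" using True by simp
      ultimately show ?thesis by linarith
    next
      case False
      then have vx: "\<kappa> \<le> v x" using x by (auto simp: \<kappa>_def not_less)
      have "norm (cis (L \<xi> x) - 1) \<le> \<bar>L \<xi> x\<bar>"
        using dist_exp_i_1[of "L \<xi> x"] abs_sin_x_le_abs_x[of "L \<xi> x / 2"] by (simp add: cis_conv_exp)
      \<comment> \<open>A linear term is traded for a square because it is the second moment that is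
        under control.\<close>
      also have "\<bar>L \<xi> x\<bar> \<le> s + (L \<xi> x)\<^sup>2 / s"
      proof -
        have "\<bar>L \<xi> x\<bar> * s \<le> s\<^sup>2 + (L \<xi> x)\<^sup>2"
          using sum_squares_bound[of "\<bar>L \<xi> x\<bar>" s] s by (simp add: power2_abs) (use mult_nonneg_nonneg[of "\<bar>L \<xi> x\<bar>" s] s in linarith)
        then show ?thesis using s by (simp add: field_simps power2_eq_square)
      qed
      also have "(L \<xi> x)\<^sup>2 / s \<le> (v x * L \<xi> x)\<^sup>2 / (s * \<kappa>\<^sup>2)"
      proof -
        have "\<kappa>\<^sup>2 * (L \<xi> x)\<^sup>2 \<le> (v x)\<^sup>2 * (L \<xi> x)\<^sup>2"
          using vx \<kappa> by (intro mult_right_mono power_mono) auto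
        then show ?thesis using s \<kappa> by (simp add: field_simps power_mult_distrib)
      qed
      finally show ?thesis using False by simp
    qed
    have int1: "integrable M (\<lambda>x. cis (L \<xi> x))"
      by (rule integrable_const_bound[where B = 1]) (auto simp: cis_conv_exp)
    have int2: "integrable M (\<lambda>x. 2 * indicator (?A n) x + (s + (v x * L \<xi> x)\<^sup>2 / (s * \<kappa>\<^sup>2)) :: real)"
      using int[of \<xi>] by (auto intro!: integrable_real_indicator simp: emeasure_eq_measure)
    have "norm (f \<xi> - 1) = norm (\<integral>x. cis (L \<xi> x) - 1 \<partial>M)"
      using int1 by (simp add: L_char prob_space)
    also have "\<dots> \<le> (\<integral>x. norm (cis (L \<xi> x) - 1) \<partial>M)" by (rule integral_norm_bound)
    also have "\<dots> \<le> (\<integral>x. 2 * indicator (?A n) x + (s + (v x * L \<xi> x)\<^sup>2 / (s * \<kappa>\<^sup>2)) \<partial>M)"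
      using int1 int2 ptw by (intro integral_mono) auto
    also have "\<dots> = 2 * prob (?A n) + (s + I / (s * \<kappa>\<^sup>2))"
      using int[of \<xi>] by (simp add: I_def prob_space emeasure_eq_measure)
    finally have "norm (f \<xi> - 1) \<le> 2 * prob (?A n) + (s + I / (s * \<kappa>\<^sup>2))" .
    moreover have "I / (s * \<kappa>\<^sup>2) < s" using I s \<kappa> by (simp add: divide_less_eq power2_eq_square mult_ac)
    ultimately show "norm (f \<xi> - 1) < e" using n s s_eq by linarith
  qed
qed

lemma L2_diff_weight:
  assumes v [measurable]: "v \<in> borel_measurable M"
  shows "L2_norm M (\<lambda>x. v x * L \<xi> x - v x * L \<eta> x) = L2_norm M (\<lambda>x. v x * L (\<xi> - \<eta>) x)"
proof -
  have "AE x in M. L \<xi> x - L \<eta> x = L (\<xi> - \<eta>) x" using L_diff_related[of \<xi> \<eta>] by (simp add: related_def)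
  then have "AE x in M. (v x * L \<xi> x - v x * L \<eta> x)\<^sup>2 = (v x * L (\<xi> - \<eta>) x)\<^sup>2"
    by eventually_elim (metis right_diff_distrib)
  then have "(\<integral>x. (v x * L \<xi> x - v x * L \<eta> x)\<^sup>2 \<partial>M) = (\<integral>x. (v x * L (\<xi> - \<eta>) x)\<^sup>2 \<partial>M)"
    by (rule integral_cong_AE[rotated 2]) measurable
  then show ?thesis by (simp add: L2_norm_def)
qed

end

text \<open>With both distances below half of \<open>r\<close>, the inequality
  \<open>(p + q)^2 \<le> 2 * p^2 + 2 * q^2\<close> already gives the exact constant.\<close>

lemma L2_norm_triangle_half:
  assumes "g \<in> L2 M" "h \<in> L2 M" "k \<in> L2 M"
    and gh: "L2_norm M (\<lambda>x. g x - h x) < r / 2" and hk: "L2_norm M (\<lambda>x. h x - k x) < r / 2"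
  shows "L2_norm M (\<lambda>x. g x - k x) < r"
proof -
  have [measurable]: "g \<in> borel_measurable M" "h \<in> borel_measurable M" "k \<in> borel_measurable M"
    using assms by (auto simp: L2_def)
  have diff: "integrable M (\<lambda>x. (a x - b x)\<^sup>2)" if a: "a \<in> L2 M" and b: "b \<in> L2 M" for a b
  proof (rule Bochner_Integration.integrable_bound)
    show "integrable M (\<lambda>x. 2 * (a x)\<^sup>2 + 2 * (b x)\<^sup>2)" using a b by (auto simp: L2_def)
    have [measurable]: "a \<in> borel_measurable M" "b \<in> borel_measurable M" using a b by (auto simp: L2_def)
    show "(\<lambda>x. (a x - b x)\<^sup>2) \<in> borel_measurable M" by measurable
    have "(p - q)\<^sup>2 \<le> 2 * p\<^sup>2 + 2 * q\<^sup>2" for p q :: real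
      using zero_le_power2[of "p + q"] by (simp add: power2_sum power2_diff)
    then show "AE x in M. norm ((a x - b x)\<^sup>2) \<le> norm (2 * (a x)\<^sup>2 + 2 * (b x)\<^sup>2)" by simp
  qed
  define I where "I a b = (\<integral>x. (a x - b x)\<^sup>2 \<partial>M)" for a b :: "'a \<Rightarrow> real"
  have I0: "0 \<le> I a b" for a b unfolding I_def by simp
  have sq: "I a b < t\<^sup>2" if "L2_norm M (\<lambda>x. a x - b x) < t" for a b t
  proof -
    have "sqrt (I a b) ^ 2 < t ^ 2"
      using that I0 unfolding L2_norm_def I_def[symmetric] by (intro power_strict_mono) auto
    then show ?thesis using I0 by simp
  qed
  have "I g k \<le> (\<integral>x. 2 * (g x - h x)\<^sup>2 + 2 * (h x - k x)\<^sup>2 \<partial>M)"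
    unfolding I_def
  proof (rule integral_mono)
    show "(g x - k x)\<^sup>2 \<le> 2 * (g x - h x)\<^sup>2 + 2 * (h x - k x)\<^sup>2" for x
    proof -
      have "(p + q)\<^sup>2 \<le> 2 * p\<^sup>2 + 2 * q\<^sup>2" for p q :: real
        using zero_le_power2[of "p - q"] by (simp add: power2_sum power2_diff)
      from this[of "g x - h x" "h x - k x"] show ?thesis by simp
    qed
  qed (use diff assms in auto)
  also have "\<dots> = 2 * I g h + 2 * I h k" using diff assms by (simp add: I_def)
  also have "\<dots> < 2 * (r / 2)\<^sup>2 + 2 * (r / 2)\<^sup>2" using sq[OF gh] sq[OF hk] by linarith
  also have "\<dots> = r\<^sup>2" by (simp add: power2_eq_square)
  finally have "sqrt (I g k) < sqrt (r\<^sup>2)" by (rule real_sqrt_less_mono)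
  moreover have "0 \<le> r"
  proof -
    have "0 \<le> L2_norm M (\<lambda>x. g x - h x)" by (simp add: L2_norm_def)
    with gh show ?thesis by linarith
  qed
  ultimately show ?thesis by (simp add: L2_norm_def I_def)
qed

text \<open>The function \<open>f\<close> mediates: \<open>T \<xi>\<close> near 0 puts
  \<open>f \<xi>\<close> near 1, and the neighbourhood basis then puts \<open>\<xi>\<close> near
  0.\<close>

lemma (in linear_process) embedding_weight:
  assumes v [measurable]: "v \<in> borel_measurable M" and pos: "AE x in M. 0 < v x"
    and int: "\<And>\<xi>. integrable M (\<lambda>x. (v x * L \<xi> x)\<^sup>2)"
    and rep: "represents M (\<lambda>\<xi> x. v x * L \<xi> x) \<phi> f"
    and gen: "generates_nhds_basis_0 f"
  shows "embedding_map euclidean (L2_topology M) (\<lambda>\<xi> x. v x * L \<xi> x)"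
proof -
  define T where "T \<xi> x = v x * L \<xi> x" for \<xi> x
  have T_L2: "T \<xi> \<in> L2 M" for \<xi> using int[of \<xi>] by (simp add: L2_def T_def[abs_def])
  have T_diff: "L2_norm M (\<lambda>x. T \<xi> x - T \<eta> x) = L2_norm M (T (\<xi> - \<eta>))" for \<xi> \<eta>
    unfolding T_def[abs_def] by (rule L2_diff_weight[OF v])
  obtain C where C: "\<And>\<xi>. L2_norm M (T \<xi>) \<le> C * norm \<xi>"
    using rep unfolding represents_def bounded_linear_L2_def T_def[abs_def] by blast
  have near: "\<exists>\<delta>>0. \<forall>\<xi>. L2_norm M (T \<xi>) < \<delta> \<longrightarrow> norm \<xi> < r" if r: "r > 0" for r
  proof -
    have "0 \<in> interior (ball (0::'h) r)" using r by simp
    then obtain U where U: "open U" "0 \<in> f -` U" "f -` U \<subseteq> ball 0 r"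
      using gen unfolding generates_nhds_basis_0_def by blast
    then obtain e where e: "e > 0" "ball 1 e \<subseteq> U" using L_f_0 by (auto simp: open_contains_ball)
    obtain \<delta> where \<delta>: "\<delta> > 0" "\<And>\<xi>. L2_norm M (T \<xi>) < \<delta> \<Longrightarrow> norm (f \<xi> - 1) < e"
      unfolding T_def[abs_def] by (rule f_near_1_of_weight[OF v pos int e(1)]) blast
    have "norm \<xi> < r" if "L2_norm M (T \<xi>) < \<delta>" for \<xi>
    proof -
      have "f \<xi> \<in> ball 1 e" using \<delta>(2)[OF that] by (simp add: dist_norm norm_minus_commute)
      then show ?thesis using e U by (auto simp: subset_eq)
    qed
    then show ?thesis using \<delta>(1) by blast
  qed
  have inj: "inj T"
  proof (rule injI)
    fix \<xi> \<eta> assume eq: "T \<xi> = T \<eta>"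
    have "L2_norm M (T (\<xi> - \<eta>)) = 0" unfolding T_diff[symmetric] eq by (simp add: L2_norm_def)
    then have "norm (\<xi> - \<eta>) < r" if "r > 0" for r using near[OF that] by auto
    then have "\<not> 0 < norm (\<xi> - \<eta>)" by blast
    then show "\<xi> = \<eta>" by simp
  qed
  have top: "topspace (L2_topology M) = L2 M"
  proof -
    have "openin (L2_topology M) (L2 M)" unfolding openin_L2_topology by (auto intro: exI[of _ 1])
    then have "L2 M \<subseteq> topspace (L2_topology M)" by (rule openin_subset)
    moreover have "topspace (L2_topology M) \<subseteq> L2 M"
      using openin_topspace[of "L2_topology M"] unfolding openin_L2_topology by blast
    ultimately show ?thesis by blast
  qed
  have cont: "continuous_map euclidean (L2_topology M) T"
    unfolding continuous_map
  proof (intro conjI allI impI)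
    show "T ` topspace euclidean \<subseteq> topspace (L2_topology M)" using T_L2 top by auto
    fix U assume U: "openin (L2_topology M) U"
    have "open {\<xi>. T \<xi> \<in> U}"
      unfolding open_dist
    proof (intro ballI)
      fix \<xi> assume "\<xi> \<in> {\<xi>. T \<xi> \<in> U}"
      then obtain \<epsilon> where \<epsilon>: "\<epsilon> > 0" "\<And>h. h \<in> L2 M \<Longrightarrow> L2_norm M (\<lambda>x. h x - T \<xi> x) < \<epsilon> \<Longrightarrow> h \<in> U"
        using U unfolding openin_L2_topology by blast
      show "\<exists>e>0. \<forall>\<eta>. dist \<eta> \<xi> < e \<longrightarrow> \<eta> \<in> {\<xi>. T \<xi> \<in> U}"
      proof (intro exI[of _ "\<epsilon> / (\<bar>C\<bar> + 1)"] conjI allI impI)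
        show "\<epsilon> / (\<bar>C\<bar> + 1) > 0" using \<epsilon> by simp
        fix \<eta> assume "dist \<eta> \<xi> < \<epsilon> / (\<bar>C\<bar> + 1)"
        then have "(\<bar>C\<bar> + 1) * norm (\<eta> - \<xi>) < \<epsilon>" by (simp add: dist_norm field_simps)
        moreover have "L2_norm M (T (\<eta> - \<xi>)) \<le> (\<bar>C\<bar> + 1) * norm (\<eta> - \<xi>)"
          by (rule order_trans[OF C mult_right_mono]) auto
        ultimately show "\<eta> \<in> {\<xi>. T \<xi> \<in> U}" using \<epsilon>(2)[OF T_L2] by (simp add: T_diff)
      qed
    qed
    then show "openin euclidean {x \<in> topspace euclidean. T x \<in> U}" by simp
  qed
  have opn: "open_map euclidean (subtopology (L2_topology M) (range T)) T"
    unfolding open_map_def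
  proof (intro allI impI)
    fix V :: "'h set" assume V: "openin euclidean V"
    \<comment> \<open>An open set of the ambient pseudometric space whose trace on the range is the
      image of \<open>V\<close>: it collects the centres around which every nearby
      \<open>T \<xi>\<close> comes from \<open>V\<close>.\<close>
    define U where "U = {g \<in> L2 M. \<exists>r>0. \<forall>\<xi>. L2_norm M (\<lambda>x. T \<xi> x - g x) < r \<longrightarrow> \<xi> \<in> V}"
    have "openin (L2_topology M) U"
      unfolding openin_L2_topology
    proof (intro conjI ballI)
      show "U \<subseteq> L2 M" by (auto simp: U_def)
      fix g assume "g \<in> U"
      then obtain r where g: "g \<in> L2 M" and r: "r > 0" "\<And>\<xi>. L2_norm M (\<lambda>x. T \<xi> x - g x) < r \<Longrightarrow> \<xi> \<in> V"
        unfolding U_def by blast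
      show "\<exists>\<epsilon>>0. \<forall>h\<in>L2 M. L2_norm M (\<lambda>x. h x - g x) < \<epsilon> \<longrightarrow> h \<in> U"
      proof (intro exI[of _ "r / 2"] conjI ballI impI)
        fix h assume h: "h \<in> L2 M" "L2_norm M (\<lambda>x. h x - g x) < r / 2"
        have "\<xi> \<in> V" if "L2_norm M (\<lambda>x. T \<xi> x - h x) < r / 2" for \<xi>
          by (rule r(2)) (rule L2_norm_triangle_half[OF T_L2 h(1) g that h(2)])
        then show "h \<in> U" using h r(1) unfolding U_def by (auto intro!: exI[of _ "r / 2"])
      qed (use r in simp)
    qed
    moreover have "T ` V = U \<inter> range T"
    proof (intro equalityI subsetI)
      fix g assume "g \<in> T ` V"
      then obtain \<xi> where \<xi>: "\<xi> \<in> V" "g = T \<xi>" by blast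
      then obtain r where r: "r > 0" "ball \<xi> r \<subseteq> V" using V by (auto simp: open_contains_ball)
      obtain \<delta> where \<delta>: "\<delta> > 0" "\<And>\<zeta>. L2_norm M (T \<zeta>) < \<delta> \<Longrightarrow> norm \<zeta> < r" using near[OF r(1)] by blast
      have "\<eta> \<in> V" if "L2_norm M (\<lambda>x. T \<eta> x - g x) < \<delta>" for \<eta>
      proof -
        have "norm (\<eta> - \<xi>) < r" using that \<delta>(2) by (simp add: \<xi> T_diff)
        then show ?thesis using r(2) by (auto simp: dist_norm norm_minus_commute subset_eq)
      qed
      then show "g \<in> U \<inter> range T" using \<delta>(1) T_L2 \<xi> unfolding U_def by blast
    next
      fix g assume "g \<in> U \<inter> range T"
      then obtain \<xi> r where "g = T \<xi>" "r > 0" "\<And>\<eta>. L2_norm M (\<lambda>x. T \<eta> x - g x) < r \<Longrightarrow> \<eta> \<in> V"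
        unfolding U_def by blast
      then show "g \<in> T ` V" by (auto simp: L2_norm_def)
    qed
    ultimately show "openin (subtopology (L2_topology M) (range T)) (T ` V)"
      unfolding openin_subtopology by blast
  qed
  have "homeomorphic_map euclidean (subtopology (L2_topology M) (range T)) T"
  proof (rule bijective_open_imp_homeomorphic_map)
    show "continuous_map euclidean (subtopology (L2_topology M) (range T)) T"
      using cont by (simp add: continuous_map_in_subtopology)
    show "T ` topspace euclidean = topspace (subtopology (L2_topology M) (range T))"
      using T_L2 by (auto simp: top)
  qed (use opn inj in auto)
  then show ?thesis unfolding embedding_map_def T_def[abs_def] by simp
qed

subsection \<open>The action on the measure space\<close>

lemma GL_simps: "mult GL = (o\<^sub>L)" "one GL = id_blinfun"
  by (simp_all add: GL_def units_of_def)

lemma subgroup_GL: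
  assumes G: "subgroup G GL"
  shows "id_blinfun \<in> G" "u \<in> G \<Longrightarrow> w \<in> G \<Longrightarrow> u o\<^sub>L w \<in> G" "u \<in> G \<Longrightarrow> inv\<^bsub>GL\<^esub> u \<in> G"
    "u \<in> G \<Longrightarrow> u o\<^sub>L inv\<^bsub>GL\<^esub> u = id_blinfun" "u \<in> G \<Longrightarrow> inv\<^bsub>GL\<^esub> u o\<^sub>L u = id_blinfun"
    "u \<in> G \<Longrightarrow> w \<in> G \<Longrightarrow> inv\<^bsub>GL\<^esub> (u o\<^sub>L w) = inv\<^bsub>GL\<^esub> w o\<^sub>L inv\<^bsub>GL\<^esub> u"
  using subgroup.one_closed[OF G] subgroup.m_closed[OF G, of u w] subgroup.m_inv_closed[OF G, of u]
    group.r_inv[OF group_GL, of u] group.l_inv[OF group_GL, of u] group.inv_mult_group[OF group_GL, of u w]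
    subgroup.mem_carrier[OF G]
  by (auto simp: GL_simps)

text \<open>An equivalent norm invariant under the group, in general not Hilbertian. The
  parallelogram law is applied to the original norm, which this one dominates.\<close>

definition orbit_norm :: "('h::real_normed_vector \<Rightarrow>\<^sub>L 'h) set \<Rightarrow> 'h \<Rightarrow> real" where
  "orbit_norm G \<xi> = (SUP u\<in>G. norm (blinfun_apply u \<xi>))"

lemma orbit_norm_props:
  assumes G: "subgroup G GL" and bdd: "uniformly_bounded G"
  shows "norm \<xi> \<le> orbit_norm G \<xi>" "orbit_norm G (a *\<^sub>R \<xi>) = \<bar>a\<bar> * orbit_norm G \<xi>"
    "w \<in> G \<Longrightarrow> orbit_norm G (blinfun_apply w \<xi>) = orbit_norm G \<xi>"
    "\<exists>C\<ge>0. \<forall>\<xi>. orbit_norm G \<xi> \<le> C * norm \<xi>"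
proof -
  note GL = subgroup_GL[OF G]
  obtain C where C: "\<And>u. u \<in> G \<Longrightarrow> norm u \<le> C" using bdd unfolding uniformly_bounded_def bdd_above_def by auto
  have le_C: "norm (blinfun_apply u \<xi>) \<le> C * norm \<xi>" if "u \<in> G" for u \<xi>
    by (rule order_trans[OF norm_blinfun mult_right_mono[OF C[OF that]]]) simp
  have bdd': "bdd_above ((\<lambda>u. norm (blinfun_apply u \<xi>)) ` G)" for \<xi>
    by (rule bdd_aboveI2) (rule le_C)
  have upper: "norm (blinfun_apply u \<xi>) \<le> orbit_norm G \<xi>" if "u \<in> G" for u \<xi>
    unfolding orbit_norm_def by (rule cSUP_upper[OF that bdd'])
  have least: "orbit_norm G \<xi> \<le> b" if "\<And>u. u \<in> G \<Longrightarrow> norm (blinfun_apply u \<xi>) \<le> b" for \<xi> b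
    unfolding orbit_norm_def by (rule cSUP_least) (use GL(1) that in auto)
  show ge: "norm \<xi> \<le> orbit_norm G \<xi>" for \<xi> using upper[OF GL(1), of \<xi>] by simp
  have scale_le: "orbit_norm G (a *\<^sub>R \<xi>) \<le> \<bar>a\<bar> * orbit_norm G \<xi>" for a \<xi>
    by (rule least) (auto simp: blinfun.scaleR_right intro: mult_left_mono upper)
  show "orbit_norm G (a *\<^sub>R \<xi>) = \<bar>a\<bar> * orbit_norm G \<xi>"
  proof (cases "a = 0")
    case True
    have "orbit_norm G (0 *\<^sub>R \<xi>) \<le> 0" using scale_le[of 0 \<xi>] by simp
    moreover have "0 \<le> orbit_norm G (0 *\<^sub>R \<xi>)" by (rule order_trans[OF norm_ge_zero ge])
    ultimately show ?thesis using True by simp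
  next
    case False
    have "orbit_norm G (inverse a *\<^sub>R (a *\<^sub>R \<xi>)) \<le> \<bar>inverse a\<bar> * orbit_norm G (a *\<^sub>R \<xi>)" by (rule scale_le)
    then have "\<bar>a\<bar> * orbit_norm G \<xi> \<le> orbit_norm G (a *\<^sub>R \<xi>)" using False by (simp add: field_simps abs_inverse)
    then show ?thesis using scale_le[of a \<xi>] by simp
  qed
  have inv_le: "orbit_norm G (blinfun_apply w \<xi>) \<le> orbit_norm G \<xi>" if "w \<in> G" for w \<xi>
    by (rule least) (use upper[OF GL(2)[OF _ that]] in auto)
  show "orbit_norm G (blinfun_apply w \<xi>) = orbit_norm G \<xi>" if w: "w \<in> G"
  proof (rule antisym)
    have "orbit_norm G (blinfun_apply (inv\<^bsub>GL\<^esub> w o\<^sub>L w) \<xi>) \<le> orbit_norm G (blinfun_apply w \<xi>)"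
      unfolding blinfun_apply_blinfun_compose by (rule inv_le[OF GL(3)[OF w]])
    then show "orbit_norm G \<xi> \<le> orbit_norm G (blinfun_apply w \<xi>)" by (simp add: GL(5)[OF w])
  qed (rule inv_le[OF w])
  have "0 \<le> C" using C[OF GL(1)] norm_ge_zero[of id_blinfun] by (rule order_trans[rotated])
  then show "\<exists>C\<ge>0. \<forall>\<xi>. orbit_norm G \<xi> \<le> C * norm \<xi>" using least le_C by blast
qed

section \<open>Automorphisms as classes modulo null sets\<close>

lemma carrier_Aut: "\<Sigma> \<in> carrier (Aut M) \<longleftrightarrow> (\<exists>\<sigma>\<in>mp_bij M. \<Sigma> = {\<theta> \<in> mp_bij M. AE x in M. \<theta> x = \<sigma> x})"
  by (auto simp: Aut_def FactGroup_def RCOSETS_def rcoset_ae_id)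

lemma mult_Aut:
  assumes "\<sigma> \<in> mp_bij M" "\<tau> \<in> mp_bij M"
  shows "{\<theta> \<in> mp_bij M. AE x in M. \<theta> x = \<sigma> x} \<otimes>\<^bsub>Aut M\<^esub> {\<theta> \<in> mp_bij M. AE x in M. \<theta> x = \<tau> x} =
    {\<theta> \<in> mp_bij M. AE x in M. \<theta> x = \<sigma> (\<tau> x)}"
proof -
  interpret normal "ae_id M" "mp_bij_group M" by (rule normal_ae_id)
  have comp: "\<sigma> \<otimes>\<^bsub>mp_bij_group M\<^esub> \<tau> \<in> mp_bij M" using m_closed[of \<sigma> \<tau>] assms by simp
  have "{\<theta> \<in> mp_bij M. AE x in M. \<theta> x = \<sigma> x} \<otimes>\<^bsub>Aut M\<^esub> {\<theta> \<in> mp_bij M. AE x in M. \<theta> x = \<tau> x} =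
      ae_id M #>\<^bsub>mp_bij_group M\<^esub> (\<sigma> \<otimes>\<^bsub>mp_bij_group M\<^esub> \<tau>)"
    using assms by (simp add: Aut_def FactGroup_def rcoset_ae_id[symmetric] rcos_sum)
  also have "\<dots> = {\<theta> \<in> mp_bij M. AE x in M. \<theta> x = (\<sigma> \<otimes>\<^bsub>mp_bij_group M\<^esub> \<tau>) x}"
    by (rule rcoset_ae_id[OF comp])
  also have "\<dots> = {\<theta> \<in> mp_bij M. AE x in M. \<theta> x = \<sigma> (\<tau> x)}"
  proof -
    have "AE x in M. (\<sigma> \<otimes>\<^bsub>mp_bij_group M\<^esub> \<tau>) x = \<sigma> (\<tau> x)"
      using AE_space by eventually_elim (simp add: mult_mp_bij_group assms compose_eq)
    then have "(AE x in M. \<theta> x = (\<sigma> \<otimes>\<^bsub>mp_bij_group M\<^esub> \<tau>) x) \<longleftrightarrow> (AE x in M. \<theta> x = \<sigma> (\<tau> x))" for \<theta>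
      by (auto elim: AE_mp)
    then show ?thesis by simp
  qed
  finally show ?thesis .
qed

lemma mp_bij_image_sets:
  assumes "\<theta> \<in> mp_bij M" "A \<in> sets M" shows "\<theta> ` A \<in> sets M"
proof -
  have b: "bij_betw \<theta> (space M) (space M)" and m: "inv_into (space M) \<theta> \<in> measurable M M"
    using assms by (auto simp: mp_bij_def Bij_def)
  have "\<theta> ` A = inv_into (space M) \<theta> -` A \<inter> space M"
  proof (intro equalityI subsetI)
    fix y assume "y \<in> \<theta> ` A"
    then obtain x where "x \<in> A" "x \<in> space M" "y = \<theta> x" using sets.sets_into_space[OF assms(2)] by blast
    then show "y \<in> inv_into (space M) \<theta> -` A \<inter> space M" using b by (auto simp: bij_betw_def)
  next
    fix y assume "y \<in> inv_into (space M) \<theta> -` A \<inter> space M"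
    then have "inv_into (space M) \<theta> y \<in> A" "\<theta> (inv_into (space M) \<theta> y) = y"
      using bij_betw_inv_into_right[OF b] by auto
    then show "y \<in> \<theta> ` A" by (metis imageI)
  qed
  then show ?thesis using measurable_sets[OF m assms(2)] by simp
qed

lemma mp_bij_mem_image:
  assumes "\<theta> \<in> mp_bij M" "A \<in> sets M" "x \<in> space M"
  shows "\<theta> x \<in> \<theta> ` A \<longleftrightarrow> x \<in> A"
  using bij_betw_mp_bij[OF assms(1)] sets.sets_into_space[OF assms(2)] assms(3)
  by (intro inj_on_image_mem_iff) (auto simp: bij_betw_def)

section \<open>The action of a group that fixes \<open>f\<close>\<close>

context cube_process
begin

text \<open>The inverse compensates the order reversal of \<open>transport\<close>, so that a
  homomorphism results. Inverses of representatives are then almost everywhere equal to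
  \<open>transport u\<close>, in line with \<open>implements\<close>.\<close>

definition action :: "('h \<Rightarrow>\<^sub>L 'h) \<Rightarrow> ((nat \<Rightarrow> real) \<Rightarrow> nat \<Rightarrow> real) set" where
  "action u = {\<theta> \<in> mp_bij M. AE x in M. \<theta> x = transport (inv\<^bsub>GL\<^esub> u) x}"

context
  fixes G :: "('h \<Rightarrow>\<^sub>L 'h) set"
  assumes G: "subgroup G GL" and fG: "G \<subseteq> GL_fixing f"
begin

lemma f_G: "u \<in> G \<Longrightarrow> f (blinfun_apply u \<xi>) = f \<xi>"
  using fG by (auto simp: GL_fixing_def)

lemma transport_inverse:
  assumes u: "u \<in> G"
  shows "AE x in M. transport u (transport (inv\<^bsub>GL\<^esub> u) x) = x" "AE x in M. transport (inv\<^bsub>GL\<^esub> u) (transport u x) = x"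
proof -
  note GL = subgroup_GL[OF G]
  show "AE x in M. transport u (transport (inv\<^bsub>GL\<^esub> u) x) = x"
    using transport_transport[of "inv\<^bsub>GL\<^esub> u" u, OF f_G[OF GL(3)[OF u]]] transport_id
    by eventually_elim (simp add: GL(5)[OF u])
  show "AE x in M. transport (inv\<^bsub>GL\<^esub> u) (transport u x) = x"
    using transport_transport[of u "inv\<^bsub>GL\<^esub> u", OF f_G[OF u]] transport_id
    by eventually_elim (simp add: GL(4)[OF u])
qed

lemma action_nonempty:
  assumes u: "u \<in> G" obtains \<theta> where "\<theta> \<in> action u"
proof -
  have ui: "inv\<^bsub>GL\<^esub> u \<in> G" by (rule subgroup_GL(3)[OF G u])
  obtain \<sigma> where "\<sigma> \<in> mp_bij M" "AE x in M. \<sigma> x = transport (inv\<^bsub>GL\<^esub> u) x"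
    by (rule mp_bij_modification[OF transport_measurable transport_measurable
          distr_transport[OF f_G[OF ui]] distr_transport[OF f_G[OF u]] transport_inverse(2,1)[OF u]]) blast
  then show ?thesis by (intro that[of \<sigma>]) (simp add: action_def)
qed

lemma action_eq:
  assumes "\<theta> \<in> action u"
  shows "\<theta> \<in> mp_bij M" "action u = {\<sigma> \<in> mp_bij M. AE x in M. \<sigma> x = \<theta> x}"
proof -
  show "\<theta> \<in> mp_bij M" using assms by (simp add: action_def)
  have "AE x in M. \<theta> x = transport (inv\<^bsub>GL\<^esub> u) x" using assms by (simp add: action_def)
  then have "(AE x in M. \<sigma> x = transport (inv\<^bsub>GL\<^esub> u) x) \<longleftrightarrow> (AE x in M. \<sigma> x = \<theta> x)" for \<sigma>
    by (auto elim: AE_mp)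
  then show "action u = {\<sigma> \<in> mp_bij M. AE x in M. \<sigma> x = \<theta> x}" by (simp add: action_def)
qed

lemma action_carrier: "u \<in> G \<Longrightarrow> action u \<in> carrier (Aut M)"
  by (rule action_nonempty) (auto simp only: carrier_Aut intro!: bexI action_eq)

lemma action_transport:
  assumes u: "u \<in> G" and \<theta>: "\<theta> \<in> action u"
  shows "AE x in M. transport u (\<theta> x) = x" "AE x in M. \<theta> (transport u x) = x"
    "AE x in M. inv_into (space M) \<theta> x = transport u x"
proof -
  have eq: "AE x in M. \<theta> x = transport (inv\<^bsub>GL\<^esub> u) x" using \<theta> by (simp add: action_def)
  show "AE x in M. transport u (\<theta> x) = x"
    using eq transport_inverse(1)[OF u] by eventually_elim simp
  show *: "AE x in M. \<theta> (transport u x) = x"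
    using AE_transport[OF f_G[OF u] eq] transport_inverse(2)[OF u] by eventually_elim simp
  have b: "bij_betw \<theta> (space M) (space M)" by (rule bij_betw_mp_bij[OF action_eq(1)[OF \<theta>]])
  show "AE x in M. inv_into (space M) \<theta> x = transport u x"
    using * AE_space
  proof eventually_elim
    case (elim x)
    have "inv_into (space M) \<theta> (\<theta> (transport u x)) = transport u x"
      using b measurable_space[OF transport_measurable elim(2)] by (intro inv_into_f_f) (auto simp: bij_betw_def)
    then show ?case using elim by simp
  qed
qed

lemma action_hom: "action \<in> hom (GL\<lparr>carrier := G\<rparr>) (Aut M)"
proof (rule homI)
  note GL = subgroup_GL[OF G]
  show "action u \<in> carrier (Aut M)" if "u \<in> carrier (GL\<lparr>carrier := G\<rparr>)" for u
    using that by (simp add: action_carrier)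
  fix u w assume "u \<in> carrier (GL\<lparr>carrier := G\<rparr>)" "w \<in> carrier (GL\<lparr>carrier := G\<rparr>)"
  then have u: "u \<in> G" and w: "w \<in> G" by auto
  obtain \<theta> where \<theta>: "\<theta> \<in> action u" by (rule action_nonempty[OF u])
  obtain \<sigma> where \<sigma>: "\<sigma> \<in> action w" by (rule action_nonempty[OF w])
  have "AE x in M. \<theta> x = transport (inv\<^bsub>GL\<^esub> u) x" using \<theta> by (simp add: action_def)
  then have "AE x in M. \<theta> (\<sigma> x) = transport (inv\<^bsub>GL\<^esub> u) (\<sigma> x)" by (rule AE_mp_bij[OF action_eq(1)[OF \<sigma>]])
  moreover have "AE x in M. \<sigma> x = transport (inv\<^bsub>GL\<^esub> w) x" using \<sigma> by (simp add: action_def)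
  ultimately have *: "AE x in M. \<theta> (\<sigma> x) = transport (inv\<^bsub>GL\<^esub> (u o\<^sub>L w)) x"
    using transport_transport[of "inv\<^bsub>GL\<^esub> w" "inv\<^bsub>GL\<^esub> u", OF f_G[OF GL(3)[OF w]]]
    by eventually_elim (simp add: GL(6)[OF u w])
  have "action u \<otimes>\<^bsub>Aut M\<^esub> action w = {\<tau> \<in> mp_bij M. AE x in M. \<tau> x = \<theta> (\<sigma> x)}"
    unfolding action_eq(2)[OF \<theta>] action_eq(2)[OF \<sigma>]
    by (rule mult_Aut[OF action_eq(1)[OF \<theta>] action_eq(1)[OF \<sigma>]])
  also have "\<dots> = action (u o\<^sub>L w)"
  proof -
    have "(AE x in M. \<tau> x = \<theta> (\<sigma> x)) \<longleftrightarrow> (AE x in M. \<tau> x = transport (inv\<^bsub>GL\<^esub> (u o\<^sub>L w)) x)" for \<tau>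
      using * by (auto elim: AE_mp)
    then show ?thesis by (simp add: action_def)
  qed
  finally show "action (u \<otimes>\<^bsub>GL\<lparr>carrier := G\<rparr>\<^esub> w) = action u \<otimes>\<^bsub>Aut M\<^esub> action w"
    by (simp add: GL_simps)
qed

text \<open>The measure of the symmetric difference equals a number \<open>D u\<close> that is free
  of representatives, and \<open>D u \<le> transport_diff u w A + D w\<close> reduces continuity at
  \<open>w\<close> to that of the transports.\<close>

lemma action_continuous: "continuous_map (subtopology strong_operator_topology G) (weak_topology M) action"
  unfolding weak_topology_def
proof (rule continuous_on_generated_topo)
  let ?S = "{{\<Theta> \<in> carrier (Aut M). \<forall>\<theta>\<in>\<Theta>. \<forall>\<sigma>\<in>\<Sigma>. measure M (sym_diff (\<theta> ` A) (\<sigma> ` A)) < \<epsilon>} | \<Sigma> A \<epsilon>.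
        \<Sigma> \<in> carrier (Aut M) \<and> A \<in> sets M \<and> \<epsilon> > 0}"
  let ?X = "subtopology strong_operator_topology G"
  have top: "topspace ?X = G" by (simp add: strong_operator_topology_topspace)
  have "\<Union>?S = carrier (Aut M)"
    using topspace_weak_topology[of M] unfolding weak_topology_def topology_generated_by_topspace .
  then show "action ` topspace ?X \<subseteq> \<Union>?S" using action_carrier top by auto
  fix U assume "U \<in> ?S"
  then obtain \<Sigma> A \<epsilon> where U: "U = {\<Theta> \<in> carrier (Aut M). \<forall>\<theta>\<in>\<Theta>. \<forall>\<sigma>\<in>\<Sigma>. measure M (sym_diff (\<theta> ` A) (\<sigma> ` A)) < \<epsilon>}"
    and \<Sigma>: "\<Sigma> \<in> carrier (Aut M)" and A: "A \<in> sets M" and \<epsilon>: "\<epsilon> > 0" by blast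
  obtain \<sigma>0 where \<sigma>0: "\<sigma>0 \<in> mp_bij M" and \<Sigma>_eq: "\<Sigma> = {\<theta> \<in> mp_bij M. AE x in M. \<theta> x = \<sigma>0 x}"
    using \<Sigma> unfolding carrier_Aut by blast
  have A_borel: "A \<in> sets borel" using A by (simp add: sets_M_borel)
  \<comment> \<open>Subbasic sets are centred at arbitrary classes, not only at values of
    \<open>action\<close>. So \<open>D\<close> compares a transport with a fixed measurable set and
    not with another transport.\<close>
  define B where "B = \<sigma>0 ` A"
  have [measurable]: "B \<in> sets M" unfolding B_def by (rule mp_bij_image_sets[OF \<sigma>0 A])
  have [measurable]: "A \<in> sets M" by (rule A)
  define D where "D u = \<P>(x in M. transport u x \<in> A \<longleftrightarrow> x \<notin> B)" for u
  have dist_eq: "measure M (sym_diff (\<theta> ` A) (\<sigma> ` A)) = D u" if u: "u \<in> G" and \<theta>: "\<theta> \<in> action u" and \<sigma>: "\<sigma> \<in> \<Sigma>" for u \<theta> \<sigma>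
  proof -
    have \<theta>': "\<theta> \<in> mp_bij M" by (rule action_eq(1)[OF \<theta>])
    have \<sigma>': "\<sigma> \<in> mp_bij M" "AE x in M. \<sigma> x = \<sigma>0 x" using \<sigma> by (auto simp: \<Sigma>_eq)
    have [measurable]: "\<theta> ` A \<in> sets M" "\<sigma> ` A \<in> sets M" by (auto intro: mp_bij_image_sets \<theta>' \<sigma>' A)
    have "AE x in M. \<theta> x \<in> \<theta> ` A \<longleftrightarrow> transport u (\<theta> x) \<in> A"
      using action_transport(1)[OF u \<theta>] AE_space by eventually_elim (simp add: mp_bij_mem_image[OF \<theta>' A])
    then have 1: "AE x in M. x \<in> \<theta> ` A \<longleftrightarrow> transport u x \<in> A" by (rule AE_mp_bij_inv[OF \<theta>'])
    have "AE x in M. \<sigma> x \<in> \<sigma> ` A \<longleftrightarrow> \<sigma> x \<in> B"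
      using \<sigma>'(2) AE_space
    proof eventually_elim
      case (elim x)
      have "\<sigma> x \<in> \<sigma> ` A \<longleftrightarrow> x \<in> A" by (rule mp_bij_mem_image[OF \<sigma>'(1) A elim(2)])
      moreover have "\<sigma>0 x \<in> \<sigma>0 ` A \<longleftrightarrow> x \<in> A" by (rule mp_bij_mem_image[OF \<sigma>0 A elim(2)])
      ultimately show ?case unfolding B_def elim(1) by blast
    qed
    then have 2: "AE x in M. x \<in> \<sigma> ` A \<longleftrightarrow> x \<in> B" by (rule AE_mp_bij_inv[OF \<sigma>'(1)])
    show ?thesis unfolding D_def
    proof (rule measure_eq_AE)
      show "AE x in M. x \<in> sym_diff (\<theta> ` A) (\<sigma> ` A) \<longleftrightarrow> x \<in> {x \<in> space M. transport u x \<in> A \<longleftrightarrow> x \<notin> B}"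
        using 1 2 AE_space by eventually_elim auto
    qed measurable
  qed
  have pre: "action -` U \<inter> topspace ?X = {u \<in> G. D u < \<epsilon>}"
  proof -
    have "action u \<in> U \<longleftrightarrow> D u < \<epsilon>" if u: "u \<in> G" for u
    proof -
      obtain \<theta> where \<theta>: "\<theta> \<in> action u" by (rule action_nonempty[OF u])
      have "\<sigma>0 \<in> \<Sigma>" using \<sigma>0 by (simp add: \<Sigma>_eq)
      then show ?thesis using dist_eq[OF u] \<theta> action_carrier[OF u] unfolding U by auto
    qed
    then show ?thesis unfolding top by blast
  qed
  show "openin ?X (action -` U \<inter> topspace ?X)"
    unfolding pre
  proof (subst openin_subopen, intro ballI)
    fix w assume w: "w \<in> {u \<in> G. D u < \<epsilon>}"
    let ?F = "nhdsin ?X w"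
    have "((\<lambda>u. transport_diff u w A) \<longlongrightarrow> 0) ?F"
    proof (rule tendsto_transport_diff[OF _ _ _ A_borel])
      have "openin ?X G" using openin_topspace[of ?X] unfolding top .
      then show "\<forall>\<^sub>F u in ?F. \<forall>\<xi>. f (blinfun_apply u \<xi>) = f \<xi>"
        unfolding eventually_nhdsin using w f_G by blast
      show "f (blinfun_apply w \<xi>) = f \<xi>" for \<xi> using w f_G by blast
      show "((\<lambda>u. blinfun_apply u \<xi>) \<longlongrightarrow> blinfun_apply w \<xi>) ?F" for \<xi>
      proof (rule topological_tendstoI)
        fix V assume V: "open V" "blinfun_apply w \<xi> \<in> V"
        have "continuous_map ?X euclidean (\<lambda>u. blinfun_apply u \<xi>)"
          by (intro continuous_map_from_subtopology strong_operator_topology_continuous_evaluation)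
        then have "openin ?X {u \<in> topspace ?X. blinfun_apply u \<xi> \<in> V}"
          by (rule openin_continuous_map_preimage) (use V in simp)
        then show "\<forall>\<^sub>F u in ?F. blinfun_apply u \<xi> \<in> V"
          unfolding eventually_nhdsin top using V(2) w by blast
      qed
    qed
    moreover have "0 < \<epsilon> - D w" using w by simp
    ultimately have "\<forall>\<^sub>F u in ?F. transport_diff u w A < \<epsilon> - D w" by (rule order_tendstoD(2))
    then obtain T where T: "openin ?X T" "w \<in> T" "\<And>u. u \<in> T \<Longrightarrow> transport_diff u w A < \<epsilon> - D w"
      unfolding eventually_nhdsin top using w by blast
    have "T \<subseteq> {u \<in> G. D u < \<epsilon>}"
    proof
      fix u assume u: "u \<in> T"
      let ?P = "{x \<in> space M. transport u x \<in> A \<longleftrightarrow> transport w x \<notin> A}"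
      let ?Q = "{x \<in> space M. transport w x \<in> A \<longleftrightarrow> x \<notin> B}"
      have "D u \<le> prob (?P \<union> ?Q)" unfolding D_def by (rule finite_measure_mono) (blast, measurable)
      also have "\<dots> \<le> prob ?P + prob ?Q" by (rule measure_Un_le) measurable
      also have "\<dots> = transport_diff u w A + D w" by (simp add: transport_diff_def D_def)
      also have "\<dots> < \<epsilon>" using T(3)[OF u] by simp
      finally show "u \<in> {u \<in> G. D u < \<epsilon>}" using openin_subset[OF T(1)] u unfolding top by blast
    qed
    then show "\<exists>T. openin ?X T \<and> w \<in> T \<and> T \<subseteq> {u \<in> G. D u < \<epsilon>}" using T by blast
  qed
qed

text \<open>The orbit norm is invariant under \<open>G\<close>, so the weight built from it is
  invariant under every transport. Composing \<open>v * L \<xi>\<close> with a transport then moves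
  \<open>L \<xi>\<close> and leaves \<open>v\<close> fixed.\<close>

lemma represents_and_implements:
  assumes bdd: "uniformly_bounded G"
  shows "\<exists>T \<phi>. represents M T \<phi> f \<and>
    (generates_nhds_basis_0 f \<longrightarrow> embedding_map euclidean (L2_topology M) T) \<and>
    (\<exists>\<beta>. implements M T \<phi> G \<beta>)"
proof -
  note N = orbit_norm_props[OF G bdd]
  obtain v where v [measurable]: "v \<in> borel_measurable M" and pos: "AE x in M. 0 < v x"
    and int: "\<And>\<xi>. integrable M (\<lambda>x. (v x * L \<xi> x)\<^sup>2)"
    and le: "\<And>\<xi>. (\<integral>x. (v x * L \<xi> x)\<^sup>2 \<partial>M) \<le> (orbit_norm G \<xi>)\<^sup>2"
    and inv: "\<And>\<tau> u. \<tau> \<in> measurable M M \<Longrightarrow> distr M M \<tau> = M \<Longrightarrow> (\<And>\<xi>. orbit_norm G (u \<xi>) = orbit_norm G \<xi>) \<Longrightarrow>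
      (\<And>\<xi>. AE x in M. L \<xi> (\<tau> x) = L (u \<xi>) x) \<Longrightarrow> AE x in M. v (\<tau> x) = v x"
    by (rule factorization_weight[of "orbit_norm G", OF N(2,1)]) blast
  obtain C where C: "C \<ge> 0" "\<And>\<xi>. orbit_norm G \<xi> \<le> C * norm \<xi>" using N(4) by blast
  have "(orbit_norm G \<xi>)\<^sup>2 \<le> (C * norm \<xi>)\<^sup>2" for \<xi>
    by (rule power_mono[OF C(2)]) (rule order_trans[OF norm_ge_zero N(1)])
  then have rep: "represents M (\<lambda>\<xi> x. v x * L \<xi> x) (\<lambda>x. 1 / v x) f"
    using le by (intro represents_weight[OF v pos int _ C(1)]) (rule order_trans)
  have v_inv: "AE x in M. v (transport u x) = v x" if u: "u \<in> G" for u
    by (rule inv[of "transport u" "blinfun_apply u"])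
      (use u f_G in \<open>auto intro: distr_transport L_transport N(3)\<close>)
  have "implements M (\<lambda>\<xi> x. v x * L \<xi> x) (\<lambda>x. 1 / v x) G action"
    unfolding implements_def
  proof (intro conjI ballI allI action_hom action_continuous)
    fix u \<theta> assume u: "u \<in> G" and \<theta>: "\<theta> \<in> action u"
    show "AE x in M. v x * L (blinfun_apply u \<xi>) x =
        v (inv_into (space M) \<theta> x) * L \<xi> (inv_into (space M) \<theta> x)" for \<xi>
      using action_transport(3)[OF u \<theta>] v_inv[OF u] L_transport[OF f_G[OF u], of \<xi>]
      by eventually_elim simp
    have "AE x in M. v (transport u (\<theta> x)) = v (\<theta> x)"
      by (rule AE_mp_bij[OF action_eq(1)[OF \<theta>] v_inv[OF u]])
    then show "AE x in M. 1 / v (\<theta> x) = 1 / v x"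
      using action_transport(1)[OF u \<theta>] by eventually_elim simp
  qed
  then show ?thesis using rep embedding_weight[OF v pos int rep] by blast
qed

end

end

theorem theorem1p3:
  fixes f :: "'h::{real_inner, complete_space} \<Rightarrow> complex"
  assumes "separable_space (euclidean :: 'h topology)"
    and "continuous_on UNIV f"
    and "positive_definite f"
    and "f 0 = 1"
  shows "\<exists>(X :: (nat \<Rightarrow> real) topology) (M :: (nat \<Rightarrow> real) measure).
    compact_space X \<and> metrizable_space X \<and> prob_space M \<and> sets M = sets (borel_of X) \<and>
    (\<exists>T \<phi>. represents M T \<phi> f \<and>
       (generates_nhds_basis_0 f \<longrightarrow> embedding_map euclidean (L2_topology M) T)) \<and>
    (\<forall>G. subgroup G GL \<and> G \<subseteq> GL_fixing f \<and> uniformly_bounded G \<longrightarrow>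
       (\<exists>T \<phi>. represents M T \<phi> f \<and>
          (generates_nhds_basis_0 f \<longrightarrow> embedding_map euclidean (L2_topology M) T) \<and>
          (\<exists>\<beta>. implements M T \<phi> G \<beta>)))"
proof -
  obtain M L d where "cube_process M f L d"
    by (rule cube_process_exists[OF assms])
  then interpret cube_process M f L d .
  \<comment> \<open>The representation without a prescribed symmetry group is the case of the
    trivial group.\<close>
  have "subgroup {id_blinfun} (GL :: ('h \<Rightarrow>\<^sub>L 'h) monoid)"
    using group.triv_subgroup[OF group_GL] by (simp add: GL_simps)
  moreover from this have "{id_blinfun} \<subseteq> GL_fixing f"
    by (auto simp: GL_fixing_def dest: subgroup.subset)
  moreover have "uniformly_bounded {id_blinfun :: 'h \<Rightarrow>\<^sub>L 'h}" by (simp add: uniformly_bounded_def)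
  ultimately have trivial: "\<exists>T \<phi>. represents M T \<phi> f \<and>
      (generates_nhds_basis_0 f \<longrightarrow> embedding_map euclidean (L2_topology M) T)"
    using represents_and_implements by blast
  show ?thesis
  proof (intro exI[of _ "top_of_set cube"] exI[of _ M] conjI allI impI trivial)
    show "compact_space (top_of_set cube)" using compact_cube by (simp add: compact_space_subtopology)
    show "metrizable_space (top_of_set cube)"
      by (intro metrizable_space_subtopology metrizable_space_euclidean)
    show "sets M = sets (borel_of (top_of_set cube))"
      by (simp add: sets_M sets_borel_of_top_of_set)
    fix G assume "subgroup G GL \<and> G \<subseteq> GL_fixing f \<and> uniformly_bounded G"
    then show "\<exists>T \<phi>. represents M T \<phi> f \<and>
        (generates_nhds_basis_0 f \<longrightarrow> embedding_map euclidean (L2_topology M) T) \<and> (\<exists>\<beta>. implements M T \<phi> G \<beta>)"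
      using represents_and_implements by blast
  qed (rule prob_space_axioms)
qed

end
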